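(* Let $q$ be a prime power and let \[ f(X)=X+\frac{aX^2+bX+c}{X^3+dX+e}\in\mathbb F_q(X), \] where $a,b,c,d,e\in\mathbb F_q$, $a,b,c$ are not all $0$, and $X^3+dX+e$ is irreducible over $\mathbb F_q$. If $q\ge 113$, then $f$ is a permutation rational function of $\mathbb P^1(\mathbb F_q)$ if and only if $a=-3d$, $b=-9e$ and $c=d^2$. Moreover, for every prime power $q$, the conditions $a=-3d$, $b=-9e$, $c=d^2$ imply that $f$ is a permutation rational function of $\mathbb P^1(\mathbb F_q)$.
   Context: $\mathbb P^1(\mathbb F_q)=\mathbb F_q\cup\{\infty\}$. A rational function $f=P/Q\in\mathbb F_q(X)$ with $P,Q\in\mathbb F_q[X]$ coprime defines a map $\mathbb P^1(\mathbb F_q)\to\mathbb P^1(\mathbb F_q)$ in the usual way: $f(x)=P(x)/Q(x)$ if $Q(x)\neq0$, $f(x)=\infty$ if $Q(x)=0$, and $f(\infty)=\lim_{x\to\infty}P(x)/Q(x)$ (equal to $\infty$ when $\deg P>\deg Q$). Such an $f$ is called a permutation rational function (PR) of $\mathbb P^1(\mathbb F_q)$ if this map is a bijection. *)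

theory Defs
  imports "HOL-Computational_Algebra.Polynomial" "HOL-Computational_Algebra.Fraction_Field"
    "HOL-Library.Cardinality"
begin

datatype 'a proj_line = Finite 'a | Infinity

text \<open>
  The map on the projective line given by \<open>P / Q\<close>, meaningful for coprime \<open>P\<close>, \<open>Q\<close> with
  \<open>Q \<noteq> 0\<close>.  At infinity, \<open>coeff P (degree Q)\<close> is the leading coefficient of \<open>P\<close> if the degrees
  agree, and \<open>0\<close> if \<open>degree P < degree Q\<close>.
\<close>
fun proj_map :: "'a::field poly \<Rightarrow> 'a poly \<Rightarrow> 'a proj_line \<Rightarrow> 'a proj_line" where
  "proj_map P Q (Finite x) =
     (if poly Q x \<noteq> 0 then Finite (poly P x / poly Q x) else Infinity)"
| "proj_map P Q Infinity =
     (if degree P > degree Q then Infinity else Finite (coeff P (degree Q) / lead_coeff Q))"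

text \<open>The choice of the reduced representation is immaterial: see \<open>ratfun_map_Fract\<close>.\<close>
definition ratfun_map :: "'a::field poly fract \<Rightarrow> 'a proj_line \<Rightarrow> 'a proj_line" where
  "ratfun_map f =
     (let (P, Q) = (SOME (P, Q). coprime P Q \<and> Q \<noteq> 0 \<and> f = Fract P Q) in proj_map P Q)"

definition permutation_ratfun :: "'a::field poly fract \<Rightarrow> bool" where
  "permutation_ratfun f \<longleftrightarrow> bij (ratfun_map f)"

lemma proj_map_smult:
  assumes "k \<noteq> 0"
  shows "proj_map (smult k P) (smult k Q) = proj_map P Q"
proof
  fix x show "proj_map (smult k P) (smult k Q) x = proj_map P Q x"
    using assms by (cases x) auto
qed

lemma field_poly_bezout:
  fixes P Q :: "'a::field poly"
  assumes "coprime P Q"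
  shows "\<exists>u v. u * P + v * Q = 1"
proof -
  define S where "S = {u * P + v * Q | u v. True}"
  have S_diff: "x - y * z \<in> S" if "x \<in> S" "z \<in> S" for x y z
  proof -
    from that obtain u v u' v' where "x = u * P + v * Q" "z = u' * P + v' * Q"
      unfolding S_def by blast
    hence "x - y * z = (u - y * u') * P + (v - y * v') * Q" by (simp add: algebra_simps)
    thus ?thesis unfolding S_def by blast
  qed
  have P: "P \<in> S" unfolding S_def by (intro CollectI exI[of _ 1] exI[of _ 0]) simp
  have Q: "Q \<in> S" unfolding S_def by (intro CollectI exI[of _ 0] exI[of _ 1]) simp
  have "P \<noteq> 0 \<or> Q \<noteq> 0" using assms by auto
  hence "\<exists>g. g \<in> S \<and> g \<noteq> 0" using P Q by blast
  then obtain g where g: "g \<in> S" "g \<noteq> 0"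
      and least: "\<And>h. h \<in> S \<Longrightarrow> h \<noteq> 0 \<Longrightarrow> degree g \<le> degree h"
    using ex_has_least_nat[of "\<lambda>g. g \<in> S \<and> g \<noteq> 0" _ degree] by blast
  have dvd: "g dvd x" if "x \<in> S" for x
  proof -
    have "x - x div g * g \<in> S" using S_diff that g(1) by blast
    hence "x mod g \<in> S" by (simp add: minus_div_mult_eq_mod)
    hence "x mod g = 0" using least[of "x mod g"] degree_mod_less[of g x] g(2) by fastforce
    thus ?thesis by (simp add: mod_eq_0_iff_dvd)
  qed
  have "is_unit g" using assms dvd[OF P] dvd[OF Q] by (rule coprime_common_divisor)
  then obtain k where k: "1 = g * k" by (elim dvdE)
  obtain u v where "g = u * P + v * Q" using g(1) unfolding S_def by blast
  hence "(k * u) * P + (k * v) * Q = 1" using k by (simp add: algebra_simps)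
  thus ?thesis by blast
qed

lemma field_poly_coprime_dvd_mult:
  fixes P Q R :: "'a::field poly"
  assumes "coprime P Q" "Q dvd P * R"
  shows "Q dvd R"
proof -
  obtain u v where "u * P + v * Q = 1" using field_poly_bezout[OF assms(1)] by blast
  hence "(u * P + v * Q) * R = R" by simp
  hence "R = u * (P * R) + Q * (v * R)" by (simp add: algebra_simps)
  thus ?thesis using assms(2) by (metis dvd_add dvd_mult dvd_triv_left)
qed

lemma coprime_Fract_eqD:
  fixes P Q P' Q' :: "'a::field poly"
  assumes "coprime P Q" "Q \<noteq> 0" "coprime P' Q'" "Q' \<noteq> 0" "Fract P Q = Fract P' Q'"
  shows "\<exists>k. k \<noteq> 0 \<and> P' = smult k P \<and> Q' = smult k Q"
proof -
  have eq: "P * Q' = P' * Q"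
    using assms by (simp add: eq_fract)
  have "Q dvd P * Q'" using eq by simp
  hence "Q dvd Q'"
    using field_poly_coprime_dvd_mult assms(1) by blast
  then obtain u where u: "Q' = Q * u" by (elim dvdE)
  have "Q' dvd P' * Q" using eq by (simp flip: eq)
  hence "Q' dvd Q"
    using field_poly_coprime_dvd_mult assms(3) by blast
  hence "is_unit u"
    using u assms(2) by simp
  then obtain k where k: "u = [:k:]" "k \<noteq> 0"
    by (auto simp: is_unit_poly_iff dvd_field_iff)
  have "Q * P' = Q * (u * P)" using eq u by (metis mult.assoc mult.commute)
  hence "P' = u * P" using assms(2) by simp
  thus ?thesis using u k by (intro exI[of _ k]) simp
qed

lemma ratfun_map_Fract:
  assumes "coprime P Q" "Q \<noteq> 0"
  shows "ratfun_map (Fract P Q) = proj_map P Q"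
proof -
  define R where "R = (\<lambda>(P', Q'). coprime P' Q' \<and> Q' \<noteq> 0 \<and> Fract P Q = Fract P' Q')"
  obtain P' Q' where *: "(SOME z. R z) = (P', Q')"
    by (cases "SOME z. R z")
  have "R (P, Q)" using assms by (simp add: R_def)
  hence "R (SOME z. R z)" by (rule someI)
  hence "coprime P' Q'" "Q' \<noteq> 0" "Fract P Q = Fract P' Q'"
    unfolding * by (simp_all add: R_def)
  then obtain k where "k \<noteq> 0" "P' = smult k P" "Q' = smult k Q"
    using coprime_Fract_eqD assms by blast
  hence "proj_map P' Q' = proj_map P Q" by (simp add: proj_map_smult)
  thus ?thesis using * unfolding ratfun_map_def R_def by simp
qed

end

theory Submission
  imports "HOL-Algebra.Algebraic_Closure_Type" Defs
begin

text \<open>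
  Write \<open>f = P / Q\<close>. If \<open>f\<close> permutes the projective line, every fibre quartic \<open>P - t Q\<close> with
  \<open>t\<close> rational is, unless it has a repeated root, a linear factor times an irreducible cubic.
  Hence its discriminant \<open>D(t)\<close>, a polynomial of degree 6 in \<open>t\<close>, is a square at all rational
  points. Stepanov's method applies to this extreme situation without any bound for point
  counts: the Taylor expansion of the square root of \<open>D\<close> in powers of \<open>t\<^sup>q - t\<close> has to
  terminate, so \<open>D = s\<^sup>2\<close> for a polynomial \<open>s\<close>.

  In odd characteristic, \<open>s\<close> is an irreducible cubic. Over a root of \<open>s\<close>, the quartic is a
  square or it has a triple root. The first case gives the asserted values of \<open>a\<close>, \<open>b\<close>, \<open>c\<close>
  by comparing coefficients. In the second case the cubic resolvent has the form
  \<open>w\<^sup>3 + \<sigma>(t) = 0\<close>; diagonalizing \<open>\<sigma>\<close> produces a rational point, which splits the irreducible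
  cubic. In characteristic 2, the square root is replaced by a root of the quadratic resolvent
  \<open>Z\<^sup>2 + A Z + A\<^sup>2 + C\<^sup>3\<close>, and the conclusion is read off from the zeros of \<open>A\<close>.

  Conversely, for the asserted values (and \<open>q\<close> odd) \<open>f\<close> is 4 times the doubling map of an
  elliptic curve without rational points of order 2; the algebra works in every characteristic.
\<close>

section \<open>Finite fields\<close>

text \<open>The discriminant condition expresses a parity: Frobenius fixes one root of the quartic
  and cycles the other three, an even permutation. At a zero of \<open>s\<close> the discriminant
  has a multiple zero. As P and Q have no common zero, one double root of the quartic cannot cause
  this in odd characteristic; a further coincidence of roots is needed, whence the two cases. Such a
  zero \<open>t\<close> has degree 3 over the ground field, so 1, t, t^2 are independent and each
  quadratic relation for \<open>t\<close> splits into coefficient equations; the roots of Q are used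
  in the same way. Outside characteristic 3 the triple root case survives these comparisons and has
  to be excluded arithmetically: in a fibre without multiple roots Frobenius also cycles the roots
  of the resolvent, so a rational root of the resolvent is a contradiction. In characteristic 2
  every field element is a square, so the discriminant carries no information; the quadratic
  resolvent detects the parity instead.\<close>

lemma card_field_gt_1: "CARD('a::{field,finite}) > 1"
proof -
  have "card {0, 1 :: 'a} \<le> CARD('a)" by (intro card_mono) auto
  thus ?thesis by simp
qed

lemma power_card_minus_1:
  fixes x :: "'a::{field,finite}"
  assumes "x \<noteq> 0"
  shows "x ^ (CARD('a) - 1) = 1"
proof -
  define S where "S = UNIV - {0 :: 'a}"
  have "(*) x ` S = S"
  proof (rule card_subset_eq)
    show "card ((*) x ` S) = card S" using assms by (intro card_image inj_onI) simp
  qed (use assms in \<open>auto simp: S_def\<close>)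
  moreover have "inj_on ((*) x) S" using assms by (intro inj_onI) simp
  ultimately have "\<Prod>S = (\<Prod>y\<in>S. x * y)"
    using prod.reindex[of "(*) x" S "\<lambda>y. y"] by simp
  also have "\<dots> = x ^ card S * \<Prod>S" by (simp add: prod.distrib)
  finally have "x ^ card S = 1" by (simp add: S_def)
  thus ?thesis by (simp add: S_def card_Diff_singleton)
qed

lemma power_card_eq_self:
  fixes x :: "'a::{field,finite}"
  shows "x ^ CARD('a) = x"
proof (cases "x = 0")
  case False
  have "x ^ CARD('a) = x * x ^ (CARD('a) - 1)"
    using card_field_gt_1[where ?'a = 'a] by (intro power_eq_if[THEN trans]) simp
  thus ?thesis using power_card_minus_1[OF False] by simp
qed (use card_field_gt_1[where ?'a = 'a] in auto)

lemma poly_eqI_card: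
  fixes p q :: "'a::{field,finite} poly"
  assumes "degree p < CARD('a)" "degree q < CARD('a)" "\<And>x. poly p x = poly q x"
  shows "p = q"
  using assms poly_eqI_degree[of UNIV p q] by auto

text \<open>
  Since \<open>(X + 1)\<^sup>q - X\<^sup>q - 1\<close> has degree less than \<open>q\<close> and vanishes at all \<open>q\<close> elements of
  the field, its coefficients vanish; no information on the shape of \<open>q\<close> is needed.
\<close>
lemma of_nat_card_choose_eq_0:
  assumes "0 < i" "i < CARD('a)"
  shows "of_nat (CARD('a) choose i) = (0 :: 'a::{field,finite})"
proof -
  let ?q = "CARD('a)"
  define p :: "'a poly" where "p = [:1, 1:] ^ ?q"
  have q: "?q > 1" by (rule card_field_gt_1)
  have deg: "degree p = ?q" by (simp add: p_def degree_power_eq)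
  have lc: "coeff p ?q = 1"
    using deg lead_coeff_power[of "[:1, 1 :: 'a:]" ?q] by (simp add: p_def)
  have "degree (p - monom 1 ?q) < ?q"
  proof -
    have "degree (p - monom 1 ?q) \<le> ?q"
      by (rule degree_diff_le) (simp_all add: deg degree_monom_le)
    moreover have "coeff (p - monom 1 ?q) ?q = 0" using lc by simp
    ultimately show ?thesis using q
      by (metis degree_0 leading_coeff_0_iff less_le_trans less_or_eq_imp_le nless_le zero_less_one)
  qed
  moreover have "poly (p - monom 1 ?q) x = poly 1 x" for x
    by (simp add: p_def poly_monom power_card_eq_self)
  ultimately have eq: "p - monom 1 ?q = 1"
    using q by (intro poly_eqI_card) auto
  have "coeff p i = of_nat (?q choose i)"
    using coeff_linear_power[of 1] assms
    by (simp add: p_def coeff_linear_poly_power)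
  moreover have "coeff p i = 0"
  proof -
    have "coeff (p - monom 1 ?q) i = 0" using eq assms by simp
    thus ?thesis using assms by simp
  qed
  ultimately show ?thesis by simp
qed

text \<open>The vanishing of the inner binomial coefficients depends on the characteristic only. The
  target ring is kept arbitrary so that polynomials and the algebraic closure are both
  covered.\<close>

lemma power_card_add:
  fixes x y :: "'b::comm_ring_1"
  assumes "CHAR('b) = CHAR('a::{field,finite})"
  shows "(x + y) ^ CARD('a) = x ^ CARD('a) + y ^ CARD('a)"
proof -
  let ?q = "CARD('a)"
  have "(x + y) ^ ?q = (\<Sum>k\<le>?q. of_nat (?q choose k) * x ^ k * y ^ (?q - k))"
    by (simp add: binomial_ring)
  also have "\<dots> = (\<Sum>k\<in>{0, ?q}. of_nat (?q choose k) * x ^ k * y ^ (?q - k))"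
  proof (rule sum.mono_neutral_right)
    show "\<forall>k\<in>{..?q} - {0, ?q}. of_nat (?q choose k) * x ^ k * y ^ (?q - k) = 0"
    proof
      fix k assume "k \<in> {..?q} - {0, ?q}"
      hence "of_nat (?q choose k) = (0 :: 'a)" by (intro of_nat_card_choose_eq_0) auto
      hence "of_nat (?q choose k) = (0 :: 'b)"
        using assms by (simp add: of_nat_eq_0_iff_char_dvd)
      thus "of_nat (?q choose k) * x ^ k * y ^ (?q - k) = 0" by simp
    qed
  qed auto
  also have "\<dots> = x ^ ?q + y ^ ?q"
    using card_field_gt_1[where ?'a = 'a] by (simp add: add.commute)
  finally show ?thesis .
qed

lemma poly_power_card:
  fixes p :: "'a::{field,finite} poly"
  shows "p ^ CARD('a) = pcompose p (monom 1 (CARD('a)))"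
proof (induction p)
  case (pCons a p)
  have *: "pCons a p = [:a:] + [:0, 1:] * p" by simp
  have "(pCons a p) ^ CARD('a) = [:a:] ^ CARD('a) + ([:0, 1:] * p) ^ CARD('a)"
    unfolding * by (rule power_card_add) simp
  also have "[:a:] ^ CARD('a) = [:a:]"
    by (simp add: poly_const_pow power_card_eq_self)
  also have "[:0, 1:] ^ CARD('a) = monom (1 :: 'a) (CARD('a))"
    by (simp add: monom_altdef)
  hence "([:0, 1:] * p) ^ CARD('a) = monom 1 (CARD('a)) * pcompose p (monom 1 (CARD('a)))"
    by (simp add: power_mult_distrib pCons.IH del: mult_pCons_left)
  finally show ?case by (simp add: pcompose_pCons)
qed (use card_field_gt_1[where ?'a = 'a] in auto)

section \<open>The Frobenius map on the algebraic closure and its fixed field\<close>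

definition frob :: "'a::{field,finite} alg_closure \<Rightarrow> 'a alg_closure" where
  "frob x = x ^ CARD('a)"

lemma frob_add [simp]: "frob (x + y) = frob x + frob y"
  unfolding frob_def by (rule power_card_add) simp

lemma frob_mult [simp]: "frob (x * y) = frob x * frob y"
  by (simp add: frob_def power_mult_distrib)

lemma frob_power [simp]: "frob (x ^ n) = frob x ^ n"
  by (simp add: frob_def flip: power_mult) (simp add: mult.commute)

lemma frob_to_ac [simp]: "frob (to_ac x) = to_ac x"
  by (simp add: frob_def power_card_eq_self flip: to_ac_power)

lemma frob_0 [simp]: "frob (0 :: 'a::{field,finite} alg_closure) = 0"
  and frob_1 [simp]: "frob (1 :: 'a alg_closure) = 1"
  and frob_numeral [simp]: "frob (numeral n :: 'a alg_closure) = numeral n"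
  using frob_to_ac[of "0 :: 'a"] frob_to_ac[of "1 :: 'a"] frob_to_ac[of "numeral n :: 'a"]
  by simp_all

lemma frob_minus [simp]: "frob (- x) = - frob x"
  using frob_add[of x "- x"] by (simp add: eq_neg_iff_add_eq_0 add.commute)

lemma frob_diff [simp]: "frob (x - y) = frob x - frob y"
  using frob_add[of x "- y"] by simp

lemma frob_eq_0_iff [simp]: "frob x = 0 \<longleftrightarrow> x = 0"
  by (simp add: frob_def)

lemma frob_eq_iff [simp]: "frob x = frob y \<longleftrightarrow> x = y"
  using frob_eq_0_iff[of "x - y"] by simp

text \<open>\<open>X^q - X\<close> has at most \<open>q\<close> roots, and the embedded ground field
  already supplies \<open>q\<close> of them.\<close>

lemma frob_fixedD:
  fixes x :: "'a::{field,finite} alg_closure"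
  assumes "frob x = x"
  obtains y where "x = to_ac y"
proof -
  define p :: "'a alg_closure poly" where "p = monom 1 (CARD('a)) - [:0, 1:]"
  have q: "CARD('a) > 1" by (rule card_field_gt_1)
  have cf: "coeff p (CARD('a)) = 1" using q by (auto simp: p_def coeff_pCons split: nat.splits)
  hence "p \<noteq> 0" by auto
  have "degree p \<le> CARD('a)" unfolding p_def using q
    by (intro degree_diff_le) (auto simp: degree_monom_le)
  have sub: "range to_ac \<subseteq> {x. poly p x = 0}"
    by (auto simp: p_def poly_monom simp flip: frob_def)
  have "card {x. poly p x = 0} \<le> CARD('a)"
    using card_poly_roots_bound[OF \<open>p \<noteq> 0\<close>] \<open>degree p \<le> CARD('a)\<close> by linarith
  moreover have "card (range (to_ac :: 'a \<Rightarrow> _)) = CARD('a)"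
    by (rule card_image) (rule inj_to_ac)
  ultimately have "range to_ac = {x. poly p x = 0}"
    using sub poly_roots_finite[OF \<open>p \<noteq> 0\<close>] card_seteq by metis
  moreover have "poly p x = 0" using assms by (simp add: p_def poly_monom frob_def)
  ultimately show ?thesis using that by blast
qed

section \<open>Cubics and quartics\<close>

lemmas ring_simps = algebra_simps power2_eq_square power3_eq_cube power4_eq_xxxx

lemma monic_cubic_splits:
  fixes p q r :: "'b::alg_closed_field"
  obtains x y z where "p = - (x + y + z)" "q = x * y + x * z + y * z" "r = - (x * y * z)"
proof -
  obtain x where x: "poly [:r, q, p, 1:] x = 0"
    using alg_closed_imp_poly_has_root[of "[:r, q, p, 1:]"] by auto
  define p' q' where "p' = p + x" and "q' = q + x * p'"
  obtain y where y: "poly [:q', p', 1:] y = 0"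
    using alg_closed_imp_poly_has_root[of "[:q', p', 1:]"] by auto
  define z where "z = - p' - y"
  have p: "p = - (x + y + z)" by (simp add: z_def p'_def)
  have q': "q' = y * z"
  proof -
    have "q' = - (y * (p' + y))" using y by (simp add: eq_neg_iff_add_eq_0)
    thus ?thesis by (simp add: z_def algebra_simps)
  qed
  have q: "q = x * y + x * z + y * z"
    using q' p by (simp add: q'_def p'_def algebra_simps)
  have "r = - (x * y * z)"
    using x unfolding p q by (simp add: algebra_simps add_eq_0_iff)
  thus ?thesis using that p q by blast
qed

lemma monic_quartic_splits:
  fixes p q r s :: "'b::alg_closed_field"
  obtains w x y z where "p = - (w + x + y + z)"
    "q = w * x + w * y + w * z + x * y + x * z + y * z"
    "r = - (w * x * y + w * x * z + w * y * z + x * y * z)" "s = w * x * y * z"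
proof -
  obtain w where w: "poly [:s, r, q, p, 1:] w = 0"
    using alg_closed_imp_poly_has_root[of "[:s, r, q, p, 1:]"] by auto
  define p' q' r' where "p' = p + w" and "q' = q + w * p'" and "r' = r + w * q'"
  obtain x y z where xyz: "p' = - (x + y + z)" "q' = x * y + x * z + y * z" "r' = - (x * y * z)"
    by (rule monic_cubic_splits)
  have "p = - (w + x + y + z)" using xyz(1) by (simp add: p'_def algebra_simps eq_neg_iff_add_eq_0)
  moreover have "q = w * x + w * y + w * z + x * y + x * z + y * z"
    using xyz(2) by (simp add: q'_def xyz(1) algebra_simps)
  moreover have "r = - (w * x * y + w * x * z + w * y * z + x * y * z)"
    using xyz(3) by (simp add: r'_def xyz(2) algebra_simps eq_neg_iff_add_eq_0)
  moreover have "s = w * x * y * z"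
  proof -
    have "s = - w * r'" using w
      by (simp add: r'_def q'_def p'_def algebra_simps eq_neg_iff_add_eq_0)
    thus ?thesis by (simp add: xyz(3))
  qed
  ultimately show ?thesis using that by blast
qed

lemma quadratic_eq_0_three_roots:
  fixes k l m :: "'b::idom"
  assumes "x \<noteq> y" "x \<noteq> z" "y \<noteq> z"
    and "k + l * x + m * x ^ 2 = 0" "k + l * y + m * y ^ 2 = 0" "k + l * z + m * z ^ 2 = 0"
  shows "k = 0 \<and> l = 0 \<and> m = 0"
proof -
  have "(x - y) * (l + m * (x + y)) = (k + l * x + m * x ^ 2) - (k + l * y + m * y ^ 2)"
    by (simp add: ring_simps)
  hence *: "l + m * (x + y) = 0" using assms(1,4,5) by simp
  have "(x - z) * (l + m * (x + z)) = (k + l * x + m * x ^ 2) - (k + l * z + m * z ^ 2)"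
    by (simp add: ring_simps)
  hence "l + m * (x + z) = 0" using assms(2,4,6) by simp
  hence "(l + m * (x + y)) - (l + m * (x + z)) = 0" using * by simp
  hence "m * (y - z) = 0" by (simp add: algebra_simps)
  hence "m = 0" using assms(3) by simp
  thus ?thesis using * assms(4) by simp
qed

text \<open>Frobenius maps roots to roots and fixes none, since a fixed root would be rational. If
  it swapped \<open>x\<close> and \<open>y\<close>, invariance of the sum of the roots would fix
  \<open>z\<close>. So it is a 3-cycle, and the roots are distinct in every characteristic.\<close>

lemma rootless_cubic_cyclic:
  fixes p q r :: "'a::{field,finite}"
  assumes no_root: "\<And>x. x ^ 3 + p * x ^ 2 + q * x + r \<noteq> 0"
  obtains x y z where "frob x = y" "frob y = z" "frob z = x" "x \<noteq> y" "x \<noteq> z" "y \<noteq> z"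
    "to_ac p = - (x + y + z)" "to_ac q = x * y + x * z + y * z" "to_ac r = - (x * y * z)"
proof -
  obtain x y1 z1 where 1: "to_ac p = - (x + y1 + z1)" "to_ac q = x * y1 + x * z1 + y1 * z1"
      "to_ac r = - (x * y1 * z1)"
    by (rule monic_cubic_splits)
  have fact1: "u ^ 3 + to_ac p * u ^ 2 + to_ac q * u + to_ac r = (u - x) * (u - y1) * (u - z1)" for u
    unfolding 1 by (simp add: algebra_simps power2_eq_square power3_eq_cube)
  have nofix: "frob u \<noteq> u" if "(u - x) * (u - y1) * (u - z1) = 0" for u
  proof
    assume "frob u = u"
    then obtain v where v: "u = to_ac v" by (rule frob_fixedD)
    have "to_ac (v ^ 3 + p * v ^ 2 + q * v + r) = 0"
      using that unfolding fact1[symmetric] v by simp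
    thus False using no_root unfolding to_ac_eq_0_iff by blast
  qed
  have root: "(frob u - x) * (frob u - y1) * (frob u - z1) = 0"
    if "(u - x) * (u - y1) * (u - z1) = 0" for u
  proof -
    have "frob (u ^ 3 + to_ac p * u ^ 2 + to_ac q * u + to_ac r) = 0"
      unfolding fact1 that by simp
    thus ?thesis unfolding fact1[symmetric] by simp
  qed
  define y where "y = frob x"
  have xy: "y \<noteq> x" using nofix[of x] by (auto simp: y_def)
  have "y = y1 \<or> y = z1" using root[of x] xy by (auto simp: y_def)
  then obtain z where z: "(y = y1 \<and> z = z1) \<or> (y = z1 \<and> z = y1)" by blast
  have 2: "to_ac p = - (x + y + z)" "to_ac q = x * y + x * z + y * z" "to_ac r = - (x * y * z)"
    using z 1 by (auto simp: algebra_simps)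
  have roots: "(u - x) * (u - y1) * (u - z1) = 0 \<longleftrightarrow> u = x \<or> u = y \<or> u = z" for u
    using z by auto
  have sum: "frob x + frob y + frob z = x + y + z"
    using arg_cong[OF 2(1), of frob] unfolding 2(1) frob_to_ac
    by (metis "2"(1) frob_add frob_minus frob_to_ac neg_equal_iff_equal)
  have nf: "frob y \<noteq> y" "frob z \<noteq> z" using nofix roots by blast+
  have "frob y = x \<or> frob y = z" using root[of y] nf roots by blast
  moreover have "frob y \<noteq> x"
  proof
    assume "frob y = x"
    hence "frob z = z" using sum by (simp add: y_def[symmetric] algebra_simps)
    thus False using nf by simp
  qed
  ultimately have fy: "frob y = z" by simp
  have fz: "frob z = x" using sum fy by (simp add: y_def[symmetric] algebra_simps)
  show ?thesis
    using that[of x y z] 2 fy fz xy nf \<open>frob y \<noteq> x\<close> y_def by metis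
qed

text \<open>Two applications of Frobenius turn the relation into a polynomial of degree at most 2
  with three distinct roots. All later comparisons of coefficients over the ground field rest on
  this.\<close>

lemma cyclic_independent:
  fixes k l m :: "'a::{field,finite}"
  assumes "x \<noteq> frob x" "x \<noteq> frob (frob x)"
    and "to_ac k + to_ac l * x + to_ac m * x ^ 2 = 0"
  shows "k = 0 \<and> l = 0 \<and> m = 0"
proof -
  have 2: "to_ac k + to_ac l * frob x + to_ac m * frob x ^ 2 = 0"
    using arg_cong[OF assms(3), of frob] by simp
  have 3: "to_ac k + to_ac l * frob (frob x) + to_ac m * frob (frob x) ^ 2 = 0"
    using arg_cong[OF 2, of frob] by simp
  have "frob x \<noteq> frob (frob x)" using assms(1) by simp
  from quadratic_eq_0_three_roots[OF assms(1,2) this assms(3) 2 3] show ?thesis by simp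
qed

text \<open>The discriminant of \<open>X^3 + p X^2 + q X + r\<close>, over any commutative ring so
  that the coefficients may themselves be polynomials in \<open>t\<close>.\<close>

definition disc3 :: "'b::comm_ring_1 \<Rightarrow> 'b \<Rightarrow> 'b \<Rightarrow> 'b" where
  "disc3 p q r = p ^ 2 * q ^ 2 - 4 * q ^ 3 - 4 * p ^ 3 * r - 27 * r ^ 2 + 18 * p * q * r"

lemma disc3_roots:
  "disc3 (- (x + y + z)) (x * y + x * z + y * z) (- (x * y * z)) =
     ((x - y) * (x - z) * (y - z)) ^ 2"
  by (simp add: disc3_def ring_simps)

lemma disc3_to_ac [simp]: "disc3 (to_ac p) (to_ac q) (to_ac r) = to_ac (disc3 p q r)"
  by (simp add: disc3_def)

text \<open>A 3-cycle is even, so Frobenius fixes the product of the differences of the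
  roots.\<close>

lemma rootless_cubic_disc3:
  fixes p q r :: "'a::{field,finite}"
  assumes "\<And>x. x ^ 3 + p * x ^ 2 + q * x + r \<noteq> 0"
  obtains w where "w \<noteq> 0" "disc3 p q r = w ^ 2"
proof -
  obtain x y z where 1: "frob x = y" "frob y = z" "frob z = x" "x \<noteq> y" "x \<noteq> z" "y \<noteq> z"
    "to_ac p = - (x + y + z)" "to_ac q = x * y + x * z + y * z" "to_ac r = - (x * y * z)"
    using rootless_cubic_cyclic[of p q r] assms by blast
  have "frob ((x - y) * (x - z) * (y - z)) = (x - y) * (x - z) * (y - z)"
    using 1(1-3) by (simp add: algebra_simps)
  then obtain w where w: "(x - y) * (x - z) * (y - z) = to_ac w" by (rule frob_fixedD)
  have "to_ac (disc3 p q r) = to_ac (w ^ 2)"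
    unfolding disc3_to_ac[symmetric] 1 disc3_roots w by simp
  hence "disc3 p q r = w ^ 2" by (simp only: to_ac_eq_iff)
  moreover have "w \<noteq> 0" using w 1(4-6) by auto
  ultimately show ?thesis using that by simp
qed

section \<open>Polynomials with only square values\<close>

lemma map_poly_hom_add:
  assumes "f 0 = 0" "\<And>x y. f (x + y) = f x + f y"
  shows "map_poly f (p + q) = map_poly f p + map_poly f q"
  by (rule poly_eqI) (simp add: coeff_map_poly assms)

lemma map_poly_hom_mult:
  fixes f :: "'b::comm_semiring_0 \<Rightarrow> 'c::comm_semiring_0"
  assumes "f 0 = 0" "\<And>x y. f (x + y) = f x + f y" "\<And>x y. f (x * y) = f x * f y"
  shows "map_poly f (p * q) = map_poly f p * map_poly f q"
proof (rule poly_eqI)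
  have sum: "f (sum g A) = (\<Sum>a\<in>A. f (g a))" for g and A :: "nat set"
    by (induction A rule: infinite_finite_induct) (simp_all add: assms)
  fix n show "coeff (map_poly f (p * q)) n = coeff (map_poly f p * map_poly f q) n"
    by (simp add: coeff_map_poly coeff_mult assms sum)
qed

text \<open>The polynomial \<open>D(t + u)\<close> in the variable \<open>u\<close>, with coefficients in \<open>F[t]\<close>.\<close>
definition taylor :: "'a::comm_ring_1 poly \<Rightarrow> 'a poly poly" where
  "taylor D = pcompose (map_poly (\<lambda>c. [:c:]) D) [:[:0, 1:], 1:]"

lemma taylor_0 [simp]: "taylor 0 = 0"
  by (simp add: taylor_def)

lemma taylor_pCons: "taylor (pCons a D) = [:[:a:]:] + [:[:0, 1:], 1:] * taylor D"
  by (simp add: taylor_def map_poly_pCons pcompose_pCons)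

lemma poly_taylor: "poly (taylor D) w = pcompose D ([:0, 1:] + w)"
  by (induction D) (simp_all add: taylor_pCons pcompose_pCons algebra_simps)

lemma coeff_taylor_pCons:
  "coeff (taylor (pCons a D)) i =
     (if i = 0 then [:a:] else 0) + [:0, 1:] * coeff (taylor D) i +
     (if i = 0 then 0 else coeff (taylor D) (i - 1))"
  by (cases i) (simp_all add: taylor_pCons)

lemma coeff_taylor_0 [simp]: "coeff (taylor D) 0 = D"
  by (induction D) (simp_all add: coeff_taylor_pCons)

lemma degree_coeff_taylor: "degree (coeff (taylor D) i) \<le> degree D"
proof (induction D arbitrary: i)
  case (pCons a D)
  show ?case
  proof (cases "D = 0")
    case False
    have "degree ([:0, 1:] * coeff (taylor D) i) \<le> Suc (degree D)"
      using degree_mult_le[of "[:0, 1:]" "coeff (taylor D) i"] pCons.IH[of i] by simp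
    moreover have "degree (coeff (taylor D) (i - 1)) \<le> Suc (degree D)"
      using pCons.IH[of "i - 1"] by simp
    ultimately show ?thesis using False
      unfolding coeff_taylor_pCons by (auto intro!: degree_add_le)
  qed (simp add: coeff_taylor_pCons)
qed simp

definition specialize :: "'a::comm_ring_1 \<Rightarrow> 'a poly poly \<Rightarrow> 'a poly" where
  "specialize t F = map_poly (\<lambda>p. poly p t) F"

lemma specialize_simps [simp]:
  "specialize t 0 = 0"
  "specialize t (pCons p F) = pCons (poly p t) (specialize t F)"
  "specialize t (F + G) = specialize t F + specialize t G"
  "specialize t (F - G) = specialize t F - specialize t G"
  "specialize t (F * G) = specialize t F * specialize t G"
  by (simp_all add: specialize_def map_poly_pCons map_poly_hom_add map_poly_hom_mult)
    (auto intro!: poly_eqI simp: coeff_map_poly)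

lemma specialize_power [simp]: "specialize t (F ^ n) = specialize t F ^ n"
  by (induction n) (simp_all add: one_pCons)

lemma specialize_smult [simp]: "specialize t (smult p F) = smult (poly p t) (specialize t F)"
  by (rule poly_eqI) (simp add: specialize_def coeff_map_poly)

lemma specialize_taylor: "specialize t (taylor D) = pcompose D [:t, 1:]"
  by (induction D) (simp_all add: taylor_pCons pcompose_pCons)

text \<open>Uniqueness of expansions in base \<open>u\<close>: the lowest digit is divisible by
  \<open>u\<close> but has smaller degree, so it vanishes; then \<open>u\<close> can be
  cancelled.\<close>

lemma base_expansion_eq_0:
  fixes F :: "'a::field poly poly"
  assumes "poly F u = 0" "\<And>i. degree (coeff F i) < degree u"
  shows "F = 0"
  using assms
proof (induction F)
  case (pCons c F)
  have "u dvd c"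
  proof -
    have "c = u * (- poly F u)" using pCons.prems(1) by (simp add: eq_neg_iff_add_eq_0)
    thus ?thesis by (rule dvdI)
  qed
  moreover have "degree c < degree u" using pCons.prems(2)[of 0] by simp
  ultimately have "c = 0" using dvd_imp_degree_le leD by blast
  moreover have "u \<noteq> 0" using pCons.prems(2)[of 0] by auto
  hence "poly F u = 0" using pCons.prems(1) \<open>c = 0\<close> by simp
  moreover have "degree (coeff F i) < degree u" for i using pCons.prems(2)[of "Suc i"] by simp
  ultimately show ?case using pCons.IH by simp
qed simp

lemma degree_coeff_mult_le:
  fixes F G :: "'a::comm_ring_1 poly poly"
  assumes "\<And>i. degree (coeff F i) \<le> m" "\<And>i. degree (coeff G i) \<le> n"
  shows "degree (coeff (F * G) i) \<le> m + n"
  unfolding coeff_mult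
proof (rule degree_sum_le)
  fix k assume "k \<in> {..i}"
  show "degree (coeff F k * coeff G (i - k)) \<le> m + n"
    using degree_mult_le[of "coeff F k" "coeff G (i - k)"] assms(1)[of k] assms(2)[of "i - k"]
    by linarith
qed simp

text \<open>The increment \<open>t^q - t\<close> leading from \<open>t\<close> to its Frobenius
  image; it vanishes at all rational points.\<close>

definition frobdiff :: "'a::{field,finite} poly" where
  "frobdiff = monom 1 (CARD('a)) - [:0, 1:]"

lemma degree_frobdiff: "degree (frobdiff :: 'a::{field,finite} poly) = CARD('a)"
  using card_field_gt_1[where ?'a = 'a] unfolding frobdiff_def diff_conv_add_uminus
  by (subst degree_add_eq_left) (auto simp: degree_monom_eq)

lemma poly_frobdiff [simp]: "poly frobdiff x = (0 :: 'a::{field,finite})"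
  by (simp add: frobdiff_def poly_monom power_card_eq_self)

lemma linear_dvd_frobdiff: "[:- x, 1:] dvd (frobdiff :: 'a::{field,finite} poly)"
  by (simp flip: poly_eq_0_iff_dvd)

lemma poly_taylor_frobdiff: "poly (taylor D) frobdiff = D ^ CARD('a)"
  for D :: "'a::{field,finite} poly"
  by (simp add: poly_taylor frobdiff_def poly_power_card)

text \<open>The closing count of Stepanov's method: \<open>n\<close> zeros, with multiplicity, at
  each of the \<open>q\<close> rational points exceed the degree.\<close>

lemma high_order_imp_eq_0:
  fixes p :: "'a::{field,finite} poly"
  assumes "\<And>x. [:- x, 1:] ^ n dvd p" "degree p < n * CARD('a)"
  shows "p = 0"
proof (rule ccontr)
  assume "p \<noteq> 0"
  have n: "n \<noteq> 0" using assms(2) by (cases n) auto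
  have ord: "n \<le> order x p" for x
    using assms(1)[of x] \<open>p \<noteq> 0\<close> by (simp add: order_divides)
  hence "{x. poly p x = 0} = UNIV"
    using n \<open>p \<noteq> 0\<close> by (metis (mono_tags) order_0I UNIV_eq_I le_zero_eq mem_Collect_eq)
  hence "n * CARD('a) \<le> (\<Sum>x | poly p x = 0. order x p)"
    using sum_bounded_below[of UNIV n "\<lambda>x. order x p"] ord by (simp add: mult.commute)
  thus False using sum_order_le_degree[OF \<open>p \<noteq> 0\<close>] assms(2) by linarith
qed

lemma linear_power_dvd_mult_cancel:
  fixes p g :: "'a::field poly"
  assumes "[:- x, 1:] ^ n dvd p * g" "poly g x \<noteq> 0"
  shows "[:- x, 1:] ^ n dvd p"
proof (cases "p = 0")
  case False
  moreover have "g \<noteq> 0" using assms(2) by auto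
  ultimately have "order x (p * g) = order x p + order x g" by (intro order_mult) simp
  also have "order x g = 0" using assms(2) by (rule order_0I)
  finally show ?thesis using assms(1) False \<open>g \<noteq> 0\<close> by (simp add: order_divides)
qed simp

lemma odd_card:
  assumes "(2 :: 'a::{field,finite}) \<noteq> 0"
  shows "odd (CARD('a))"
proof
  assume "even (CARD('a))"
  hence "(-1 :: 'a) ^ CARD('a) = 1" by simp
  hence "(1 :: 'a) + 1 = 0" by (simp add: power_card_eq_self eq_neg_iff_add_eq_0)
  thus False using assms by simp
qed

text \<open>
  With \<open>E = D\<^bsup>(q-1)/2\<^esup>\<close>, the product \<open>D E\<close> is a square root of \<open>D(t) D(t\<^sup>q)\<close> that agrees with
  \<open>D\<close> at all rational points. It is therefore given by the Taylor expansion of the square root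
  in powers of \<open>u = t\<^sup>q - t\<close>, up to order 4. For reasons of degree, this congruence is an
  equality, and so the Taylor expansion of the square root terminates.
\<close>
lemma everywhere_square_imp_square:
  fixes D :: "'a::{field,finite} poly"
  assumes two: "(2 :: 'a) \<noteq> 0" and card: "CARD('a) > 36"
    and deg: "degree D \<le> 6" and D0: "D \<noteq> 0" and sq: "\<And>t. \<exists>w. poly D t = w ^ 2"
  shows "\<exists>s. D = s ^ 2"
proof -
  let ?q = "CARD('a)"
  define u :: "'a poly" where "u = frobdiff"
  define E where "E = D ^ ((?q - 1) div 2)"
  define D1 D2 D3 where "D1 = coeff (taylor D) 1" and "D2 = coeff (taylor D) 2"
    and "D3 = coeff (taylor D) 3"
  define k :: "'a poly" where "k = [:inverse 2:]"
  \<comment> \<open>\<open>H\<close> is \<open>D^3\<close> times the expansion of the square root of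
    \<open>D(t + u) / D(t)\<close>, cut off at order 4; the factor \<open>D^3\<close> clears
    denominators. Comparing coefficients in \<open>H^2 = D^5 * taylor D\<close> below order 4
    determines \<open>p1\<close>, \<open>p2\<close>, \<open>p3\<close> in turn.\<close>
  define p1 where "p1 = k * D1"
  define p2 where "p2 = k * (D * D2 - p1 ^ 2)"
  define p3 where "p3 = k * D ^ 2 * D3 - p1 * p2"
  define H where "H = [:D ^ 3, D ^ 2 * p1, D * p2, p3:]"
  define K where "K = H ^ 2 - [:D ^ 5:] * taylor D"
  define h where "h = poly H u"
  have k2: "2 * k = 1"
  proof -
    have "2 * k = [:2:] * [:inverse 2:]" by (simp add: k_def numeral_poly)
    also have "\<dots> = 1" using two by (simp add: one_pCons)
    finally show ?thesis .
  qed
  have kk: "k * x + k * x = x" for x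
    using k2 by (metis mult.assoc mult_2 mult.left_neutral)
  have p1': "p1 + p1 = D1" by (simp add: p1_def kk)
  have p2': "p2 + p2 = D * D2 - p1 ^ 2" by (simp only: p2_def kk)
  have p3': "p3 + p3 = D ^ 2 * D3 - (p1 + p1) * p2"
    using kk[of "D ^ 2 * D3"] by (simp add: p3_def algebra_simps)
  have "coeff K i = 0" if "i < 4" for i
  proof -
    have c: "coeff K i = (\<Sum>j\<le>i. coeff H j * coeff H (i - j)) - D ^ 5 * coeff (taylor D) i"
      by (simp add: K_def power2_eq_square coeff_mult)
    have "i = 0 \<or> i = 1 \<or> i = 2 \<or> i = 3" using that by linarith
    then consider "i = 0" | "i = 1" | "i = 2" | "i = 3" by blast
    thus ?thesis
    proof cases
      case 1
      thus ?thesis unfolding c by (simp add: H_def algebra_simps eval_nat_numeral)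
    next
      case 2
      have "coeff K 1 = D ^ 5 * (p1 + p1 - D1)"
        unfolding c[unfolded 2]
        by (simp add: H_def D1_def algebra_simps eval_nat_numeral)
      thus ?thesis using p1' 2 by simp
    next
      case 3
      have "coeff K 2 = D ^ 4 * (p2 + p2 - (D * D2 - p1 ^ 2))"
        unfolding c[unfolded 3]
        by (simp add: H_def D2_def algebra_simps eval_nat_numeral)
      thus ?thesis using p2' 3 by simp
    next
      case 4
      have "coeff K 3 = D ^ 3 * (p3 + p3 - (D ^ 2 * D3 - (p1 + p1) * p2))"
        unfolding c[unfolded 4]
        by (simp add: H_def D3_def algebra_simps eval_nat_numeral)
      thus ?thesis using p3' 4 by simp
    qed
  qed
  hence "monom 1 4 dvd K" by (simp add: monom_1_dvd_iff')
  then obtain K' where K': "K = monom 1 4 * K'" by (elim dvdE)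
  have Ku: "poly K u = u ^ 4 * poly K' u"
    by (simp add: K' poly_monom)
  have tay: "poly (taylor D) u = D ^ ?q" by (simp add: u_def poly_taylor_frobdiff)
  have E2: "D * E ^ 2 = D ^ ?q"
  proof -
    have "Suc (2 * ((?q - 1) div 2)) = ?q" using odd_card[OF two] by presburger
    thus ?thesis unfolding E_def by (metis power_Suc power_mult mult.commute)
  qed
  have Ku': "poly K u = (h - D ^ 3 * E) * (h + D ^ 3 * E)"
  proof -
    have "poly K u = h ^ 2 - D ^ 5 * (D * E ^ 2)" by (simp add: K_def h_def tay E2)
    thus ?thesis by (simp add: algebra_simps eval_nat_numeral)
  qed
  have h_eq: "h = D ^ 3 + u * (D ^ 2 * p1 + u * (D * p2 + u * p3))"
    by (simp add: h_def H_def)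
  have dt: "degree D1 \<le> 6" "degree D2 \<le> 6" "degree D3 \<le> 6"
    unfolding D1_def D2_def D3_def using degree_coeff_taylor[of D] deg le_trans by blast+
  have dk: "degree k = 0" by (simp add: k_def)
  have d1: "degree p1 \<le> 6" unfolding p1_def using degree_mult_le[of k D1] dk dt by linarith
  have d2: "degree p2 \<le> 12"
  proof -
    have "degree (D * D2) \<le> 12" using degree_mult_le[of D D2] deg dt by linarith
    moreover have "degree (p1 ^ 2) \<le> 12" using degree_power_le[of p1 2] d1 by linarith
    ultimately have "degree (D * D2 - p1 ^ 2) \<le> 12" by (rule degree_diff_le)
    thus ?thesis unfolding p2_def using degree_mult_le[of k "D * D2 - p1 ^ 2"] dk by linarith
  qed
  have dD: "degree (D ^ n) \<le> 6 * n" for n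
    using degree_power_le[of D n] deg by (meson le_trans mult_le_mono1)
  have d3: "degree p3 \<le> 18"
  proof -
    have "degree (k * D ^ 2 * D3) \<le> 18"
      using degree_mult_le[of "k * D ^ 2" D3] degree_mult_le[of k "D ^ 2"] dD[of 2] dk dt
      by linarith
    moreover have "degree (p1 * p2) \<le> 18" using degree_mult_le[of p1 p2] d1 d2 by linarith
    ultimately show ?thesis unfolding p3_def by (rule degree_diff_le)
  qed
  have Hdeg: "degree (coeff H i) \<le> 18" for i
  proof -
    have "degree (D ^ 2 * p1) \<le> 18"
      using degree_mult_le[of "D ^ 2" p1] dD[of 2] d1 by linarith
    moreover have "degree (D * p2) \<le> 18" using degree_mult_le[of D p2] deg d2 by linarith
    ultimately show ?thesis using dD[of 3] d3
      by (auto simp: H_def coeff_pCons split: nat.splits)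
  qed
  \<comment> \<open>Where \<open>D\<close> is nonzero, \<open>E\<close> takes the value 1, so the
    factor \<open>h + D^3 E\<close> has value \<open>2 D^3\<close> and the other factor carries the
    whole zero of order 4. Where \<open>D\<close> vanishes, the extra factor \<open>D\<close> gives
    every term total order at least 4 in \<open>D\<close> and \<open>u\<close>.\<close>
  have "[:- t, 1:] ^ 4 dvd D * (h - D ^ 3 * E)" for t
  proof (cases "poly D t = 0")
    case False
    obtain w where w: "poly D t = w ^ 2" using sq by blast
    have "poly E t = w ^ (2 * ((?q - 1) div 2))" by (simp add: E_def w flip: power_mult)
    also have "2 * ((?q - 1) div 2) = ?q - 1" using odd_card[OF two] by presburger
    also have "w ^ (?q - 1) = 1" using False w by (intro power_card_minus_1) auto
    finally have "poly (h + D ^ 3 * E) t = 2 * poly D t ^ 3"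
      by (simp add: h_eq u_def)
    hence nz: "poly (h + D ^ 3 * E) t \<noteq> 0" using False two by simp
    have "[:- t, 1:] ^ 4 dvd u ^ 4"
      unfolding u_def by (intro dvd_power_same linear_dvd_frobdiff)
    hence "[:- t, 1:] ^ 4 dvd (h - D ^ 3 * E) * (h + D ^ 3 * E)"
      using Ku Ku' by (metis dvd_mult2)
    thus ?thesis using linear_power_dvd_mult_cancel[OF _ nz] dvd_mult by blast
  next
    case True
    define l where "l = [:- t, 1:]"
    have "l dvd D" using True by (simp add: l_def poly_eq_0_iff_dvd)
    then obtain D' where D': "D = l * D'" by (elim dvdE)
    have "l dvd u" by (simp add: l_def u_def linear_dvd_frobdiff)
    then obtain u' where u': "u = l * u'" by (elim dvdE)
    have "D * (h - D ^ 3 * E) =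
        D ^ 4 + u * D ^ 3 * p1 + u ^ 2 * D ^ 2 * p2 + u ^ 3 * D * p3 - D ^ 4 * E"
      by (simp add: h_eq algebra_simps eval_nat_numeral)
    also have "\<dots> = l ^ 4 * (D' ^ 4 + u' * D' ^ 3 * p1 + u' ^ 2 * D' ^ 2 * p2 + u' ^ 3 * D' * p3 -
        D' ^ 4 * E)"
      by (simp add: D' u' algebra_simps eval_nat_numeral)
    finally show ?thesis by (simp add: l_def)
  qed
  moreover have "degree (D * (h - D ^ 3 * E)) < 4 * ?q"
  proof -
    have du: "degree u = ?q" by (simp add: u_def degree_frobdiff)
    have step: "degree (a + u * b) \<le> n + ?q" if "degree a \<le> n" "degree b \<le> n" for a b n
      using that degree_mult_le[of u b] du by (intro degree_add_le) auto
    have c: "degree (D ^ 3) \<le> 18" "degree (D ^ 2 * p1) \<le> 18" "degree (D * p2) \<le> 18"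
      using Hdeg[of 0] Hdeg[of 1] Hdeg[of 2] by (simp_all add: H_def eval_nat_numeral)
    have e1: "degree (D * p2 + u * p3) \<le> 18 + ?q" by (rule step) fact+
    have e2: "degree (D ^ 2 * p1 + u * (D * p2 + u * p3)) \<le> (18 + ?q) + ?q"
      by (rule step) (use c(2) e1 in linarith)+
    have "degree h \<le> ((18 + ?q) + ?q) + ?q"
      unfolding h_eq by (rule step) (use c(1) e2 in linarith)+
    moreover have "degree (D ^ 3 * E) \<le> 18 + 3 * ?q"
      using degree_mult_le[of "D ^ 3" E] dD[of 3] dD[of "(?q - 1) div 2"] unfolding E_def by linarith
    ultimately have "degree (h - D ^ 3 * E) \<le> 18 + 3 * ?q" by (intro degree_diff_le) auto
    thus ?thesis using degree_mult_le[of D "h - D ^ 3 * E"] deg card by linarith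
  qed
  ultimately have "D * (h - D ^ 3 * E) = 0" by (rule high_order_imp_eq_0)
  hence "poly K u = 0" using D0 Ku' by simp
  \<comment> \<open>The coefficients of \<open>K\<close> have degree at most 2 * 18 = 5 * 6 + 6 =
    36; this is the source of the bound \<open>q > 36\<close>.\<close>
  have "K = 0"
  proof (rule base_expansion_eq_0)
    fix i
    have "degree (coeff (H ^ 2) i) \<le> 36"
      using degree_coeff_mult_le[of H 18 H 18 i] Hdeg by (simp add: power2_eq_square)
    moreover have "degree (D ^ 5 * coeff (taylor D) i) \<le> 36"
      using degree_mult_le[of "D ^ 5" "coeff (taylor D) i"] dD[of 5] degree_coeff_taylor[of D i] deg
      by linarith
    ultimately have "degree (coeff K i) \<le> 36" by (simp add: K_def degree_diff_le)
    thus "degree (coeff K i) < degree u" using card by (simp add: u_def degree_frobdiff)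
  qed fact
  \<comment> \<open>At a fixed base point with \<open>D(t)\<close> nonzero, \<open>K = 0\<close>
    says that \<open>D(t)^5 D(t + u)\<close> is a square in the variable \<open>u\<close>. The
    constant is a square too, and the substitution of \<open>X - t\<close> for \<open>u\<close>
    recovers \<open>D\<close>.\<close>
  obtain t where t: "poly D t \<noteq> 0"
  proof (rule ccontr)
    assume "\<not> thesis"
    hence "poly D t = 0" for t using that by blast
    thus False using poly_eqI_card[of D 0] deg card D0 by simp
  qed
  obtain w where w: "poly D t = w ^ 2" using sq by blast
  have w0: "w \<noteq> 0" using w t by auto
  have "specialize t K = 0" using \<open>K = 0\<close> by simp
  hence "specialize t H ^ 2 = smult (w ^ 10) (pcompose D [:t, 1:])"
    by (simp add: K_def specialize_taylor w flip: power_mult)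
  hence "pcompose (specialize t H ^ 2) [:- t, 1:] =
      smult (w ^ 10) (pcompose (pcompose D [:t, 1:]) [:- t, 1:])"
    by (simp add: pcompose_smult)
  also have "pcompose (pcompose D [:t, 1:]) [:- t, 1:] = D"
    by (simp flip: pcompose_assoc add: pcompose_pCons)
  finally have eq: "(pcompose (specialize t H) [:- t, 1:]) ^ 2 = smult (w ^ 10) D"
    by (simp add: power2_eq_square pcompose_mult)
  define v where "v = w ^ 5"
  have v: "v \<noteq> 0" "w ^ 10 = v * v" using w0 by (simp_all add: v_def flip: power_add)
  have "D = (smult (inverse v) (pcompose (specialize t H) [:- t, 1:])) ^ 2"
    using eq v by (simp add: power2_eq_square field_simps)
  thus ?thesis by blast
qed

section \<open>The analogue in characteristic 2\<close>

lemma char_2_poly: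
  fixes x :: "'a::comm_ring_1 poly"
  assumes "(2 :: 'a) = 0"
  shows "x + x = 0"
proof -
  have "x + x = smult (1 + 1) x" by (simp only: smult_add_left smult_1_left)
  thus ?thesis using assms by simp
qed

lemma CHAR_eq_2:
  assumes "(2 :: 'a::field) = 0"
  shows "CHAR('a) = 2"
proof (rule CHAR_eq_posI)
  show "of_nat 2 = (0 :: 'a)" using assms by simp
  fix n :: nat assume "n > 0" "n < 2"
  hence "n = 1" by linarith
  thus "of_nat n \<noteq> (0 :: 'a)" by simp
qed simp

text \<open>Write \<open>q = m 2^k\<close> with \<open>m\<close> odd. Additivity of the powers
  \<open>q\<close> and \<open>2^k\<close> yields \<open>(X + 1)^m = X^m + 1\<close> after cancelling
  the substitution of \<open>Y^(2^k)\<close>; for \<open>m > 1\<close> the linear coefficient would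
  give \<open>m = 0\<close> in the field.\<close>

lemma card_eq_power_of_2:
  assumes two: "(2 :: 'a::{field,finite}) = 0"
  obtains k where "CARD('a) = 2 ^ k"
proof -
  let ?q = "CARD('a)"
  have "?q \<noteq> 0" "\<not> is_unit (2 :: nat)" by simp_all
  then obtain m where m': "?q = 2 ^ multiplicity 2 ?q * m" and m: "\<not> 2 dvd m"
    by (rule multiplicity_decompose'[of ?q 2])
  define k where "k = multiplicity 2 ?q"
  have q: "?q = m * 2 ^ k" using m' unfolding k_def by (rule trans[OF _ mult.commute])
  have char: "CHAR('a) = 2" using two by (rule CHAR_eq_2)
  have char_poly: "CHAR('a poly) = 2" by (simp add: char)
  define Y :: "'a poly" where "Y = [:0, 1:]"
  have "(Y + 1) ^ ?q = Y ^ ?q + 1"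
    using power_card_add[where ?'a = 'a and ?'b = "'a poly", of Y 1] by simp
  also have "(Y + 1) ^ ?q = ((Y + 1) ^ (2 ^ k)) ^ m"
    unfolding q by (simp add: mult.commute flip: power_mult)
  also have "(Y + 1) ^ (2 ^ k) = Y ^ (2 ^ k) + 1"
    using freshmans_dream'[where ?'a = "'a poly", of "2 ^ k" k Y 1] by (simp add: char)
  also have "Y ^ ?q = (Y ^ (2 ^ k)) ^ m"
    unfolding q by (simp add: mult.commute flip: power_mult)
  finally have eq: "(Y ^ (2 ^ k) + 1) ^ m = (Y ^ (2 ^ k)) ^ m + 1" .
  have pc: "pcompose (p ^ n) r = pcompose p r ^ n" for p r :: "'a poly" and n
    by (induction n) (simp_all add: pcompose_mult pcompose_1)
  have "pcompose ([:1, 1:] ^ m - monom 1 m - 1) (Y ^ (2 ^ k)) = 0"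
    using eq by (simp add: pcompose_diff pc monom_altdef pcompose_pCons pcompose_1 one_pCons[symmetric]
      add.commute)
  moreover have "degree (Y ^ (2 ^ k)) > 0"
    by (simp add: Y_def degree_power_eq)
  ultimately have eq: "[:1, 1:] ^ m - monom 1 m - 1 = (0 :: 'a poly)"
    using pcompose_eq_0 by blast
  have "m = 1"
  proof (rule ccontr)
    assume "m \<noteq> 1"
    hence "m > 1" using m by (cases m) auto
    have "coeff ([:1, 1 :: 'a:] ^ m - monom 1 m - 1) 1 = of_nat m"
      using \<open>m > 1\<close> by (simp add: coeff_linear_poly_power coeff_1)
    hence "of_nat m = (0 :: 'a)" using eq by simp
    thus False using m by (simp add: of_nat_eq_0_iff_char_dvd char)
  qed
  hence "?q = 2 ^ k" using q by (simp only: mult_1)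
  thus ?thesis by (rule that)
qed

text \<open>
  \<open>H\<close> is \<open>A\<^sup>n\<close> times the sum of \<open>(B / A\<^sup>2)\<^bsup>2^i\<^esup>\<close> for \<open>i < j\<close>, where \<open>n = 2\<^sup>j\<close>. At a solution
  \<open>v / A\<close> of the equation \<open>y\<^sup>2 + y = B / A\<^sup>2\<close> the sum telescopes.
\<close>
lemma artin_schreier_sum:
  fixes A B :: "'a::field poly"
  assumes two: "(2 :: 'a) = 0" and deg: "degree A \<le> m" "degree B \<le> 2 * m"
  shows "\<exists>H. A ^ 2 * (H ^ 2 + A ^ (2 ^ j) * H) = A ^ 2 * B ^ (2 ^ j) + (A ^ (2 ^ j)) ^ 2 * B \<and>
    degree H \<le> m * 2 ^ j \<and>
    (\<forall>t v. v ^ 2 + v * poly A t = poly B t \<longrightarrow>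
       poly A t * poly H t = poly A t * v ^ (2 ^ j) + poly A t ^ (2 ^ j) * v)"
proof (induction j)
  case 0
  have "(2 :: 'a poly) = 0" using char_2_poly[OF two, of 1] by simp
  thus ?case by (intro exI[of _ 0]) (simp add: mult.commute two)
next
  case (Suc j)
  have c: "x + x = 0" for x :: 'a using two by (metis mult_2 mult_zero_left)
  have cp: "x + x = 0" for x :: "'a poly" using two by (rule char_2_poly)
  obtain H where H: "A ^ 2 * (H ^ 2 + A ^ (2 ^ j) * H) = A ^ 2 * B ^ (2 ^ j) + (A ^ (2 ^ j)) ^ 2 * B"
     "degree H \<le> m * 2 ^ j"
     "\<And>t v. v ^ 2 + v * poly A t = poly B t \<Longrightarrow>
       poly A t * poly H t = poly A t * v ^ (2 ^ j) + poly A t ^ (2 ^ j) * v"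
    using Suc.IH by blast
  define a b where "a = A ^ (2 ^ j)" and "b = B ^ (2 ^ j)"
  have a2: "A ^ (2 ^ Suc j) = a ^ 2" and b2: "B ^ (2 ^ Suc j) = b ^ 2"
    by (simp_all add: a_def b_def mult.commute flip: power_mult)
  \<comment> \<open>Adds the next summand \<open>b / a^2\<close> to the sum \<open>H / a\<close> and
    clears the denominator \<open>a^2\<close>.\<close>
  define H' where "H' = a * H + b"
  have "A ^ 2 * (H' ^ 2 + a ^ 2 * H') = a ^ 2 * (A ^ 2 * (H ^ 2 + a * H)) + A ^ 2 * b ^ 2 +
      A ^ 2 * a ^ 2 * b + (A ^ 2 * a * H * b + A ^ 2 * a * H * b)"
    by (simp add: H'_def ring_simps)
  also have "\<dots> = A ^ 2 * b ^ 2 + (a ^ 2) ^ 2 * B + (a ^ 2 * A ^ 2 * b + a ^ 2 * A ^ 2 * b)"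
    unfolding H(1)[folded a_def b_def] cp[of "A ^ 2 * a * H * b"]
    by (simp add: algebra_simps)
  finally have 1: "A ^ 2 * (H' ^ 2 + a ^ 2 * H') = A ^ 2 * b ^ 2 + (a ^ 2) ^ 2 * B"
    by (simp only: cp add_0_right)
  have 2: "degree H' \<le> m * 2 ^ Suc j"
  proof -
    have "degree a \<le> m * 2 ^ j" unfolding a_def
      using degree_power_le[of A "2 ^ j"] deg(1) by (meson le_trans mult_le_mono1)
    moreover have "degree b \<le> 2 * m * 2 ^ j" unfolding b_def
      using degree_power_le[of B "2 ^ j"] deg(2) by (meson le_trans mult_le_mono1)
    ultimately show ?thesis unfolding H'_def using degree_mult_le[of a H] H(2)
      by (intro degree_add_le) auto
  qed
  have 3: "poly A t * poly H' t = poly A t * v ^ (2 ^ Suc j) + poly A t ^ (2 ^ Suc j) * v"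
    if v: "v ^ 2 + v * poly A t = poly B t" for t v
  proof -
    define x y where "x = poly A t" and "y = v ^ (2 ^ j)"
    define z where "z = x ^ (2 ^ j)"
    have "CHAR('a) = 2" using two by (rule CHAR_eq_2)
    hence "(v ^ 2 + v * x) ^ (2 ^ j) = (v ^ 2) ^ (2 ^ j) + (v * x) ^ (2 ^ j)"
      by (intro freshmans_dream') auto
    also have "\<dots> = y ^ 2 + y * z"
      by (simp add: y_def z_def power_mult_distrib mult.commute flip: power_mult)
    finally have b: "poly b t = y ^ 2 + y * z" using v by (simp add: b_def x_def)
    have "poly A t * poly H' t = z * (x * poly H t) + x * poly b t"
      by (simp add: H'_def a_def x_def z_def algebra_simps)
    also have "x * poly H t = x * y + z * v"
      using H(3)[OF v] by (simp add: x_def y_def z_def)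
    also have "z * (x * y + z * v) + x * poly b t = x * y ^ 2 + z ^ 2 * v + (x * y * z + x * y * z)"
      by (simp add: b ring_simps)
    also have "\<dots> = x * y ^ 2 + z ^ 2 * v" by (simp add: c)
    finally show ?thesis by (simp add: x_def y_def z_def mult.commute flip: power_mult)
  qed
  show ?case using 1 2 3 unfolding a2 b2 by blast
qed

text \<open>
  The argument of \<open>everywhere_square_imp_square\<close> for a root of \<open>Z\<^sup>2 + A Z + B\<close> in place of
  the square root.
\<close>
lemma everywhere_root_imp_root_char_2:
  fixes A B :: "'a::{field,finite} poly"
  assumes two: "(2 :: 'a) = 0" and card: "CARD('a) > 36"
    and deg: "degree A \<le> 3" "degree B \<le> 6" and A0: "A \<noteq> 0"
    and root: "\<And>t. \<exists>v. v ^ 2 + v * poly A t = poly B t"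
  shows "\<exists>z. z ^ 2 + z * A = B"
proof -
  let ?q = "CARD('a)"
  have c: "x + x = 0" for x :: 'a using two by (metis mult_2 mult_zero_left)
  have cp: "x + x = 0" for x :: "'a poly" using two by (rule char_2_poly)
  obtain k where k: "?q = 2 ^ k" using card_eq_power_of_2[OF two] .
  obtain H where H: "A ^ 2 * (H ^ 2 + A ^ ?q * H) = A ^ 2 * B ^ ?q + (A ^ ?q) ^ 2 * B"
     "degree H \<le> 3 * ?q"
     "\<And>t v. v ^ 2 + v * poly A t = poly B t \<Longrightarrow>
       poly A t * poly H t = poly A t * v ^ ?q + poly A t ^ ?q * v"
    using artin_schreier_sum[OF two deg(1), of B k] deg(2) unfolding k by auto
  define u :: "'a poly" where "u = frobdiff"
  define A1 A2 A3 where "A1 = coeff (taylor A) 1" and "A2 = coeff (taylor A) 2"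
    and "A3 = coeff (taylor A) 3"
  define B1 B2 B3 where "B1 = coeff (taylor B) 1" and "B2 = coeff (taylor B) 2"
    and "B3 = coeff (taylor B) 3"
  \<comment> \<open>For a formal root \<open>z\<close> of \<open>z^2 + z A = B\<close>, consider the
    difference \<open>z(t + u) - (z / A)(t) * A(t + u)\<close>. It vanishes at \<open>u = 0\<close>,
    and its Taylor coefficients no longer involve \<open>z\<close>. \<open>G\<close> is
    \<open>A^4\<close> times this difference up to order 4, and \<open>K\<close> is
    \<open>A^8\<close> times the quadratic equation satisfied by the difference, with
    \<open>G / A^4\<close> inserted. At \<open>u = t^q - t\<close> the exact value of the difference
    is \<open>H\<close>.\<close>
  define H2 where "H2 = A ^ 2 * B2 - A1 ^ 2 * B - A * A1 * B1 - B1 ^ 2"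
  define H3 where "H3 = A ^ 3 * B3 - A ^ 2 * A2 * B1 - A1 * H2"
  define G where "G = [:0, A ^ 3 * B1, A * H2, H3:]"
  define K where "K = G ^ 2 + smult (A ^ 4) (taylor A * G) +
    smult (A ^ 6) (smult B (taylor A ^ 2) - smult (A ^ 2) (taylor B))"
  define h where "h = poly G u"
  have "coeff K i = 0" if "i < 4" for i
  proof -
    have cf: "coeff K i = (\<Sum>j\<le>i. coeff G j * coeff G (i - j)) +
        A ^ 4 * (\<Sum>j\<le>i. coeff (taylor A) j * coeff G (i - j)) +
        A ^ 6 * (B * (\<Sum>j\<le>i. coeff (taylor A) j * coeff (taylor A) (i - j)) -
                 A ^ 2 * coeff (taylor B) i)"
      by (simp add: K_def power2_eq_square coeff_mult)
    have "i = 0 \<or> i = 1 \<or> i = 2 \<or> i = 3" using that by linarith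
    then consider "i = 0" | "i = 1" | "i = 2" | "i = 3" by blast
    thus ?thesis
    proof cases
      case 1
      thus ?thesis unfolding cf by (simp add: G_def algebra_simps eval_nat_numeral)
    next
      case 2
      have "coeff K 1 = A ^ 7 * B * A1 + A ^ 7 * B * A1"
        unfolding cf[unfolded 2]
        by (simp add: G_def A1_def B1_def algebra_simps eval_nat_numeral)
      thus ?thesis using 2 by (simp add: cp)
    next
      case 3
      have "coeff K 2 = A ^ 7 * B * A2 + A ^ 7 * B * A2"
        unfolding cf[unfolded 3]
        by (simp add: G_def H2_def A1_def A2_def B1_def B2_def algebra_simps eval_nat_numeral)
      thus ?thesis using 3 by (simp add: cp)
    next
      case 4
      define x where "x = A ^ 4 * B1 * H2 + A ^ 6 * B * (A * A3 + A1 * A2)"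
      have "coeff K 3 = x + x"
        unfolding cf[unfolded 4]
        by (simp add: x_def G_def H3_def A1_def A2_def A3_def B1_def B2_def B3_def
          algebra_simps eval_nat_numeral)
      thus ?thesis using 4 by (simp add: cp)
    qed
  qed
  hence "monom 1 4 dvd K" by (simp add: monom_1_dvd_iff')
  then obtain K' where K': "K = monom 1 4 * K'" by (elim dvdE)
  have Ku: "poly K u = u ^ 4 * poly K' u"
    by (simp add: K' poly_monom)
  define \<theta> where "\<theta> = h + A ^ 4 * H"
  have Ku': "poly K u = \<theta> * (\<theta> + A ^ 4 * A ^ ?q)"
  proof -
    have "poly K u = h ^ 2 + A ^ 4 * (A ^ ?q * h) + A ^ 6 * (B * (A ^ ?q) ^ 2 - A ^ 2 * B ^ ?q)"
      by (simp add: K_def h_def u_def poly_taylor_frobdiff)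
    also have "\<dots> = h ^ 2 + A ^ 4 * A ^ ?q * h + A ^ 6 * (A ^ 2 * B ^ ?q + (A ^ ?q) ^ 2 * B) -
        (A ^ 8 * B ^ ?q + A ^ 8 * B ^ ?q)"
      by (simp add: algebra_simps flip: power_add)
    also have "\<dots> = h ^ 2 + A ^ 4 * A ^ ?q * h + A ^ 6 * (A ^ 2 * (H ^ 2 + A ^ ?q * H))"
      unfolding H(1)[symmetric] cp by simp
    also have "\<dots> = \<theta> * (\<theta> + A ^ 4 * A ^ ?q) - (A ^ 4 * H * h + A ^ 4 * H * h)"
      unfolding \<theta>_def by (simp add: algebra_simps eval_nat_numeral)
    finally show ?thesis by (simp add: cp)
  qed
  have h_eq: "h = u * (A ^ 3 * B1 + u * (A * H2 + u * H3))"
    by (simp add: h_def G_def)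
  have dA: "degree (A ^ n) \<le> 3 * n" for n
    using degree_power_le[of A n] deg by (meson le_trans mult_le_mono1)
  have dt: "degree A1 \<le> 3" "degree A2 \<le> 3" "degree B1 \<le> 6" "degree B2 \<le> 6" "degree B3 \<le> 6"
    unfolding A1_def A2_def B1_def B2_def B3_def
    using degree_coeff_taylor deg le_trans by blast+
  have d2: "degree H2 \<le> 12"
  proof -
    have "degree (A ^ 2 * B2) \<le> 12" using degree_mult_le[of "A ^ 2" B2] dA[of 2] dt by linarith
    moreover have "degree (A1 ^ 2 * B) \<le> 12"
      using degree_mult_le[of "A1 ^ 2" B] degree_power_le[of A1 2] dt deg by linarith
    moreover have "degree (A * A1 * B1) \<le> 12"
      using degree_mult_le[of "A * A1" B1] degree_mult_le[of A A1] dt deg by linarith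
    moreover have "degree (B1 ^ 2) \<le> 12" using degree_power_le[of B1 2] dt by linarith
    ultimately show ?thesis unfolding H2_def by (intro degree_diff_le)
  qed
  have d3: "degree H3 \<le> 15"
  proof -
    have "degree (A ^ 3 * B3) \<le> 15" using degree_mult_le[of "A ^ 3" B3] dA[of 3] dt by linarith
    moreover have "degree (A ^ 2 * A2 * B1) \<le> 15"
      using degree_mult_le[of "A ^ 2 * A2" B1] degree_mult_le[of "A ^ 2" A2] dA[of 2] dt by linarith
    moreover have "degree (A1 * H2) \<le> 15" using degree_mult_le[of A1 H2] d2 dt by linarith
    ultimately show ?thesis unfolding H3_def by (intro degree_diff_le)
  qed
  have d1: "degree (A ^ 3 * B1) \<le> 15" "degree (A * H2) \<le> 15"
    using degree_mult_le[of "A ^ 3" B1] dA[of 3] degree_mult_le[of A H2] deg d2 dt by linarith+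
  \<comment> \<open>Where \<open>A\<close> is nonzero, the two summands in the formula for
    \<open>A H\<close> coincide at a rational point, so \<open>H\<close> vanishes there and the
    second factor has value \<open>A^5\<close>. Where \<open>A\<close> vanishes, the extra factor
    \<open>A\<close> again gives every term order at least 4.\<close>
  have "[:- t, 1:] ^ 4 dvd A * \<theta>" for t
  proof (cases "poly A t = 0")
    case False
    obtain v where v: "v ^ 2 + v * poly A t = poly B t" using root by blast
    have "poly A t * poly H t = poly A t * v + poly A t * v"
      using H(3)[OF v] by (simp add: power_card_eq_self)
    hence "poly H t = 0" using False by (simp add: c)
    hence "poly (\<theta> + A ^ 4 * A ^ ?q) t = poly A t ^ 4 * poly A t"
      by (simp add: \<theta>_def h_eq u_def power_card_eq_self)
    hence nz: "poly (\<theta> + A ^ 4 * A ^ ?q) t \<noteq> 0" using False by simp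
    have "[:- t, 1:] ^ 4 dvd u ^ 4"
      unfolding u_def by (intro dvd_power_same linear_dvd_frobdiff)
    hence "[:- t, 1:] ^ 4 dvd \<theta> * (\<theta> + A ^ 4 * A ^ ?q)"
      using Ku Ku' by (metis dvd_mult2)
    thus ?thesis using linear_power_dvd_mult_cancel[OF _ nz] dvd_mult by blast
  next
    case True
    define l where "l = [:- t, 1:]"
    have "l dvd A" using True by (simp add: l_def poly_eq_0_iff_dvd)
    then obtain A' where A': "A = l * A'" by (elim dvdE)
    have "l dvd u" by (simp add: l_def u_def linear_dvd_frobdiff)
    then obtain u' where u': "u = l * u'" by (elim dvdE)
    have "A * \<theta> = u * A ^ 4 * B1 + u ^ 2 * A ^ 2 * H2 + u ^ 3 * A * H3 + A ^ 5 * H"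
      by (simp add: \<theta>_def h_eq algebra_simps eval_nat_numeral)
    also have "\<dots> = l ^ 4 * (u * A' ^ 4 * B1 + u' ^ 2 * A' ^ 2 * H2 + u' ^ 3 * A' * H3 +
        A' ^ 4 * A * H)"
      by (simp add: A' u' algebra_simps eval_nat_numeral)
    finally show ?thesis by (simp add: l_def)
  qed
  moreover have "degree (A * \<theta>) < 4 * ?q"
  proof -
    have du: "degree u = ?q" by (simp add: u_def degree_frobdiff)
    have step: "degree (a + u * b) \<le> n + ?q" if "degree a \<le> n" "degree b \<le> n" for a b n
      using that degree_mult_le[of u b] du by (intro degree_add_le) auto
    have e1: "degree (A * H2 + u * H3) \<le> 15 + ?q" by (rule step) fact+
    have e2: "degree (A ^ 3 * B1 + u * (A * H2 + u * H3)) \<le> (15 + ?q) + ?q"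
      by (rule step) (use d1(1) e1 in linarith)+
    have "degree h \<le> 15 + 3 * ?q"
      using degree_mult_le[of u "A ^ 3 * B1 + u * (A * H2 + u * H3)"] e2 du unfolding h_eq by linarith
    moreover have "degree (A ^ 4 * H) \<le> 15 + 3 * ?q"
      using degree_mult_le[of "A ^ 4" H] dA[of 4] H(2) by linarith
    ultimately have "degree \<theta> \<le> 15 + 3 * ?q" unfolding \<theta>_def by (rule degree_add_le)
    thus ?thesis using degree_mult_le[of A \<theta>] deg card by linarith
  qed
  ultimately have "A * \<theta> = 0" by (rule high_order_imp_eq_0)
  hence "poly K u = 0" using A0 Ku' by simp
  have "K = 0"
  proof (rule base_expansion_eq_0)
    fix i
    have G: "degree (coeff G j) \<le> 15" for j
      using d1 d3 by (auto simp: G_def coeff_pCons split: nat.splits)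
    have tA: "degree (coeff (taylor A) j) \<le> 3" for j
      using degree_coeff_taylor[of A j] deg by linarith
    have "degree (coeff (G ^ 2) i) \<le> 30"
      using degree_coeff_mult_le[of G 15 G 15 i] G by (simp add: power2_eq_square)
    moreover have "degree (A ^ 4 * coeff (taylor A * G) i) \<le> 30"
      using degree_mult_le[of "A ^ 4" "coeff (taylor A * G) i"] dA[of 4]
        degree_coeff_mult_le[of "taylor A" 3 G 15 i] G tA by simp
    moreover have "degree (A ^ 6 * (B * coeff (taylor A ^ 2) i - A ^ 2 * coeff (taylor B) i)) \<le> 30"
    proof -
      have "degree (B * coeff (taylor A ^ 2) i) \<le> 12"
        using degree_mult_le[of B "coeff (taylor A ^ 2) i"] deg
          degree_coeff_mult_le[of "taylor A" 3 "taylor A" 3 i] tA by (simp add: power2_eq_square)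
      moreover have "degree (A ^ 2 * coeff (taylor B) i) \<le> 12"
        using degree_mult_le[of "A ^ 2" "coeff (taylor B) i"] dA[of 2] degree_coeff_taylor[of B i] deg
        by linarith
      ultimately have "degree (B * coeff (taylor A ^ 2) i - A ^ 2 * coeff (taylor B) i) \<le> 12"
        by (rule degree_diff_le)
      thus ?thesis
        using degree_mult_le[of "A ^ 6" "B * coeff (taylor A ^ 2) i - A ^ 2 * coeff (taylor B) i"]
          dA[of 6] by linarith
    qed
    ultimately have "degree (coeff K i) \<le> 30"
      unfolding K_def coeff_add coeff_diff coeff_smult by (intro degree_add_le)
    thus "degree (coeff K i) < degree u" using card by (simp add: u_def degree_frobdiff)
  qed fact
  obtain t where t: "poly A t \<noteq> 0"
  proof (rule ccontr)
    assume "\<not> thesis"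
    hence "poly A t = 0" for t using that by blast
    thus False using poly_eqI_card[of A 0] deg card A0 by simp
  qed
  define a where "a = poly A t"
  obtain v where v: "v ^ 2 + v * a = poly B t" using root unfolding a_def by blast
  have a0: "a \<noteq> 0" using t by (simp add: a_def)
  define shift :: "'a poly \<Rightarrow> 'a poly" where "shift p = pcompose p [:- t, 1:]" for p
  have sh: "shift (p + r) = shift p + shift r" "shift (p - r) = shift p - shift r"
    "shift (p * r) = shift p * shift r" "shift (smult x p) = smult x (shift p)"
    "shift (pcompose p [:t, 1:]) = p" for p r x
    by (simp_all add: shift_def pcompose_add pcompose_diff pcompose_mult pcompose_smult
      pcompose_pCons flip: pcompose_assoc)
  define g where "g = shift (specialize t G)"
  have "shift (specialize t K) = 0" using \<open>K = 0\<close> by (simp add: shift_def)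
  hence g: "g * g + smult (a ^ 4) (A * g) +
      smult (a ^ 6) (smult (v ^ 2 + v * a) (A * A) - smult (a ^ 2) B) = 0"
    by (simp add: K_def specialize_taylor power2_eq_square sh g_def a_def[symmetric] v[symmetric])
  define g' where "g' = smult (inverse (a ^ 4)) g"
  define y where "y = v / a"
  have g': "g = smult (a ^ 4) g'" and vy: "v = y * a" using a0 by (simp_all add: g'_def y_def)
  have "smult (a ^ 8) (g' * g' + A * g' + smult (y ^ 2 + y) (A * A) - B) = 0"
    using g unfolding g' vy
    by (simp add: algebra_simps smult_add_right smult_diff_right smult_add_left eval_nat_numeral)
  hence eq: "g' * g' + A * g' + smult (y ^ 2 + y) (A * A) = B" using a0 by simp
  \<comment> \<open>Restores the multiple of \<open>A\<close> that was subtracted from the root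
    before expanding it.\<close>
  define z where "z = g' + smult y A"
  have "z * z + z * A = g' * g' + A * g' + smult (y ^ 2 + y) (A * A) +
      (smult y (A * g') + smult y (A * g'))"
    by (simp add: z_def algebra_simps smult_add_right smult_add_left power2_eq_square)
  also have "\<dots> = B" unfolding eq cp by simp
  finally have "z * z + z * A = B" .
  thus ?thesis by (intro exI[of _ z]) (simp add: power2_eq_square)
qed

section \<open>Diagonal cubic forms\<close>

text \<open>
  If \<open>C\<^sub>0\<close>, \<open>C\<^sub>1\<close>, \<open>C\<^sub>2\<close> are the three classes modulo cubes, the number of \<open>x \<in> C\<^sub>1\<close> with
  \<open>x + 1 \<in> C\<^sub>2\<close> exceeds that of \<open>x \<in> C\<^sub>0\<close> with \<open>x + 1 \<in> C\<^sub>0\<close> by one, hence is positive.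
\<close>
lemma diagonal_cubic_isotropic:
  fixes \<alpha> \<beta> \<gamma> :: "'a::{field,finite}"
  assumes nz: "\<alpha> \<noteq> 0" "\<beta> \<noteq> 0" "\<gamma> \<noteq> 0"
  shows "\<exists>x y z. (x \<noteq> 0 \<or> y \<noteq> 0 \<or> z \<noteq> 0) \<and> \<alpha> * x ^ 3 + \<beta> * y ^ 3 + \<gamma> * z ^ 3 = 0"
proof (rule ccontr)
  assume "\<not> ?thesis"
  hence no: "x = 0 \<and> y = 0 \<and> z = 0" if "\<alpha> * x ^ 3 + \<beta> * y ^ 3 + \<gamma> * z ^ 3 = 0" for x y z
    using that by blast
  define g h where "g = \<beta> / \<alpha>" and "h = \<gamma> / \<alpha>"
  have g0: "g \<noteq> 0" and h0: "h \<noteq> 0" using nz by (simp_all add: g_def h_def)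
  have no': "x = 0 \<and> y = 0 \<and> z = 0" if "x ^ 3 + g * y ^ 3 + h * z ^ 3 = 0" for x y z
  proof -
    have "\<alpha> * x ^ 3 + \<beta> * y ^ 3 + \<gamma> * z ^ 3 = \<alpha> * (x ^ 3 + g * y ^ 3 + h * z ^ 3)"
      using nz by (simp add: g_def h_def distrib_left)
    hence "\<alpha> * x ^ 3 + \<beta> * y ^ 3 + \<gamma> * z ^ 3 = 0" using that by simp
    thus ?thesis by (rule no)
  qed
  define C where "C = (\<lambda>x::'a. x ^ 3) ` (UNIV - {0})"
  have CI: "a ^ 3 \<in> C" if "a \<noteq> 0" for a
    using that unfolding C_def by (intro imageI) simp
  have CE: "\<exists>a. a \<noteq> 0 \<and> x = a ^ 3" if "x \<in> C" for x using that by (auto simp: C_def)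
  have C1: "1 \<in> C" using CI[of 1] by simp
  have Cm: "- x \<in> C" if x: "x \<in> C" for x
  proof -
    obtain a where "a \<noteq> 0" "x = a ^ 3" using CE[OF x] by blast
    thus ?thesis using CI[of "- a"] by simp
  qed
  have Cmult: "x * y \<in> C" if xy: "x \<in> C" "y \<in> C" for x y
  proof -
    obtain a where a: "a \<noteq> 0" "x = a ^ 3" using CE[OF xy(1)] by blast
    obtain b where b: "b \<noteq> 0" "y = b ^ 3" using CE[OF xy(2)] by blast
    show ?thesis using CI[of "a * b"] a b by (simp add: power_mult_distrib)
  qed
  have Cinv: "inverse x \<in> C" if x: "x \<in> C" for x
  proof -
    obtain a where "a \<noteq> 0" "x = a ^ 3" using CE[OF x] by blast
    thus ?thesis using CI[of "inverse a"] by (simp add: power_inverse)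
  qed
  have C0: "0 \<notin> C" by (auto simp: C_def)
  have gC: "g \<notin> C"
  proof
    assume "g \<in> C"
    then obtain a where "a \<noteq> 0" "g = a ^ 3" by (auto simp: C_def)
    thus False using no'[of a "-1" 0] by simp
  qed
  have hC: "h \<notin> C"
  proof
    assume "h \<in> C"
    then obtain a where "a \<noteq> 0" "h = a ^ 3" by (auto simp: C_def)
    thus False using no'[of a 0 "-1"] by simp
  qed
  have ghC: "h \<notin> (*) g ` C"
  proof
    assume "h \<in> (*) g ` C"
    then obtain a where "a \<noteq> 0" "h = g * a ^ 3" by (auto simp: C_def)
    thus False using no'[of 0 a "-1"] by simp
  qed
  have cosets: "x \<in> C" if "k * x \<in> (*) k ` C" "k \<noteq> 0" for k x using that by auto
  have disj: "C \<inter> (*) g ` C = {}" "C \<inter> (*) h ` C = {}" "(*) g ` C \<inter> (*) h ` C = {}"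
  proof -
    have *: "k \<in> C" if "x \<in> C" "k * x \<in> C" for k x
    proof -
      have "k = (k * x) * inverse x" using that C0 by (auto simp: field_simps)
      thus ?thesis using Cmult Cinv that by metis
    qed
    show "C \<inter> (*) g ` C = {}" "C \<inter> (*) h ` C = {}" using *[of _ g] *[of _ h] gC hC by auto
    show "(*) g ` C \<inter> (*) h ` C = {}"
    proof (rule ccontr)
      assume "\<not> ?thesis"
      then obtain x y where xy: "x \<in> C" "y \<in> C" "g * x = h * y" by auto
      have "h = g * (x * inverse y)" using xy C0 by (auto simp: field_simps)
      thus False using ghC Cmult Cinv xy by blast
    qed
  qed
  \<comment> \<open>As \<open>g\<close> is not a cube, cubing is not bijective. Hence there is a
    nontrivial cube root of unity, the cubes have index 3, and \<open>C\<close>, \<open>g C\<close>,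
    \<open>h C\<close> are all the classes.\<close>
  have "\<not> inj_on (\<lambda>x::'a. x ^ 3) (UNIV - {0})"
  proof
    assume "inj_on (\<lambda>x::'a. x ^ 3) (UNIV - {0})"
    hence "card C = card (UNIV - {0 :: 'a})" unfolding C_def by (rule card_image)
    moreover have "C \<subseteq> UNIV - {0}" using C0 by blast
    ultimately have "C = UNIV - {0}" by (intro card_subset_eq) auto
    thus False using gC g0 by auto
  qed
  then obtain a b :: 'a where ab: "a \<noteq> 0" "b \<noteq> 0" "a \<noteq> b" "a ^ 3 = b ^ 3"
    by (auto simp: inj_on_def)
  define w where "w = a / b"
  have w: "w ^ 3 = 1" "w \<noteq> 1" "w \<noteq> 0" using ab by (auto simp: w_def power_divide)
  have "(w - 1) * (w ^ 2 + w + 1) = w ^ 3 - 1" by (simp add: algebra_simps eval_nat_numeral)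
  hence w2: "w ^ 2 + w + 1 = 0" using w by simp
  have fiber: "card {x \<in> UNIV - {0}. x ^ 3 = c} = 3" if c: "c \<in> C" for c
  proof -
    obtain x where x: "x \<noteq> 0" "c = x ^ 3" using CE[OF c] by blast
    have "{y \<in> UNIV - {0}. y ^ 3 = c} = {x, w * x, w ^ 2 * x}"
    proof (intro equalityI subsetI)
      fix y assume "y \<in> {y \<in> UNIV - {0}. y ^ 3 = c}"
      hence "y ^ 3 - x ^ 3 = 0" using x by simp
      also have "y ^ 3 - x ^ 3 = (y - x) * (y ^ 2 + x * y + x ^ 2)"
        by (simp add: algebra_simps eval_nat_numeral)
      also have "y ^ 2 + x * y + x ^ 2 = (y - w * x) * (y - w ^ 2 * x) +
          (w ^ 2 + w + 1) * x * y + (1 - w ^ 3) * x ^ 2"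
        by (simp add: algebra_simps eval_nat_numeral)
      finally show "y \<in> {x, w * x, w ^ 2 * x}" using w w2 by auto
    next
      fix y assume "y \<in> {x, w * x, w ^ 2 * x}"
      moreover have "(w ^ 2) ^ 3 = 1" using w by (metis power_mult mult.commute power_one)
      ultimately show "y \<in> {y \<in> UNIV - {0}. y ^ 3 = c}"
        using x w by (auto simp: power_mult_distrib)
    qed
    moreover have "card {x, w * x, w ^ 2 * x} = 3"
    proof -
      have "w ^ 2 \<noteq> 1"
      proof
        assume "w ^ 2 = 1"
        hence "w ^ 3 = w" by (simp add: eval_nat_numeral)
        thus False using w by simp
      qed
      moreover have "w * w \<noteq> w" using w by simp
      ultimately show ?thesis using x w by (simp add: power2_eq_square)
    qed
    ultimately show ?thesis by simp
  qed
  have "card (UNIV - {0 :: 'a}) = (\<Sum>c\<in>C. card {x \<in> UNIV - {0}. x ^ 3 = c})"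
    unfolding C_def using sum.image_gen[of "UNIV - {0 :: 'a}" "\<lambda>_. 1 :: nat" "\<lambda>x. x ^ 3"] by simp
  also have "\<dots> = 3 * card C" using fiber by simp
  finally have card: "card (UNIV - {0 :: 'a}) = 3 * card C" .
  have cg: "card ((*) g ` C) = card C" and ch: "card ((*) h ` C) = card C"
    using g0 h0 by (auto intro!: card_image inj_onI)
  have cover: "C \<union> (*) g ` C \<union> (*) h ` C = UNIV - {0}"
  proof (rule card_subset_eq)
    show "C \<union> (*) g ` C \<union> (*) h ` C \<subseteq> UNIV - {0}" using C0 g0 h0 by auto
    have "card (C \<union> (*) g ` C \<union> (*) h ` C) = 3 * card C"
      using disj cg ch by (subst card_Un_disjoint card_Un_disjoint; (subst card_Un_disjoint)?; auto)
    thus "card (C \<union> (*) g ` C \<union> (*) h ` C) = card (UNIV - {0 :: 'a})" using card by simp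
  qed simp
  have ghC': "g * h \<in> C"
  proof -
    have "g * h \<in> C \<union> (*) g ` C \<union> (*) h ` C" unfolding cover using g0 h0 by simp
    moreover have "g * h \<notin> (*) g ` C" using cosets[of g h] g0 hC by blast
    moreover have "g * h \<notin> (*) h ` C" using cosets[of h g] h0 gC by (metis mult.commute)
    ultimately show ?thesis by blast
  qed
  \<comment> \<open>Without a solution, \<open>x\<close> in \<open>g C\<close> has
    \<open>x + 1\<close> in \<open>C\<close> or in \<open>g C\<close>. In the first case
    \<open>\<psi> x + 1 = - x\<close> lies in \<open>g C\<close>, in the second
    \<open>\<psi> x + 1 = - 1 / x\<close> lies in \<open>h C\<close>. So the cases can be told apart
    from the value, \<open>\<psi>\<close> is injective from \<open>g C\<close> into
    \<open>C\<close>, and it misses \<open>- 1\<close>, which contradicts equality of the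
    cardinalities.\<close>
  define \<psi> where "\<psi> x = (if x + 1 \<in> C then - (x + 1) else - (x + 1) / x)" for x
  have cases: "(x + 1 \<in> C \<and> \<psi> x \<in> C \<and> \<psi> x + 1 \<in> (*) g ` C) \<or>
      (x + 1 \<notin> C \<and> \<psi> x \<in> C \<and> \<psi> x + 1 \<in> (*) h ` C)" if x: "x \<in> (*) g ` C" for x
  proof -
    obtain c where c: "x = g * c" "c \<in> C" using x by auto
    have x0: "x \<noteq> 0" using c g0 C0 by auto
    have mx: "- x \<in> (*) g ` C" using c Cm by (auto simp: image_iff intro!: bexI[of _ "- c"])
    show ?thesis
    proof (cases "x + 1 \<in> C")
      case True
      thus ?thesis using Cm mx unfolding \<psi>_def by (simp del: minus_add_distrib)
    next
      case False
      have "x + 1 \<noteq> 0"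
      proof
        assume "x + 1 = 0"
        hence "x = - 1" by (simp add: eq_neg_iff_add_eq_0)
        hence "x \<in> C" using Cm C1 by simp
        thus False using disj x by blast
      qed
      moreover have "x + 1 \<notin> (*) h ` C"
      proof
        assume "x + 1 \<in> (*) h ` C"
        then obtain d where d: "x + 1 = h * d" "d \<in> C" by auto
        obtain y z where "y ^ 3 = c" "z ^ 3 = d" using c d by (auto simp: C_def)
        hence "1 ^ 3 + g * y ^ 3 + h * (- z) ^ 3 = 0" using c d by (simp add: algebra_simps)
        from no'[OF this] show False by simp
      qed
      ultimately have "x + 1 \<in> (*) g ` C" using cover False by blast
      then obtain d where d: "x + 1 = g * d" "d \<in> C" by auto
      have "\<psi> x = - (d * inverse c)"
        using False d(1) g0 by (simp add: \<psi>_def c(1) field_simps)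
      hence 1: "\<psi> x \<in> C" using Cm Cmult Cinv c d by simp
      have "\<psi> x + 1 = h * (- (inverse (g * h) * inverse c))"
        using False x0 h0 g0 C0 c by (simp add: \<psi>_def field_simps)
      hence "\<psi> x + 1 \<in> (*) h ` C" using Cm Cmult Cinv c(2) ghC' by blast
      thus ?thesis using 1 False by blast
    qed
  qed
  have "inj_on \<psi> ((*) g ` C)"
  proof (rule inj_onI)
    fix x y assume xy: "x \<in> (*) g ` C" "y \<in> (*) g ` C" "\<psi> x = \<psi> y"
    have nz': "x \<noteq> 0" "y \<noteq> 0" using xy g0 C0 by auto
    have "x + 1 \<in> C \<longleftrightarrow> y + 1 \<in> C" 
      using cases[OF xy(1)] cases[OF xy(2)] disj(3) unfolding xy(3) by blast
    hence "- (x + 1) = - (y + 1) \<or> - (x + 1) / x = - (y + 1) / y"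
      using xy(3) unfolding \<psi>_def by presburger
    moreover have "- (x + 1) * y = - (y + 1) * x" if "- (x + 1) / x = - (y + 1) / y"
      by (rule iffD1[OF frac_eq_eq[OF nz'] that])
    ultimately show "x = y" by (auto simp: algebra_simps)
  qed
  moreover have "\<psi> ` ((*) g ` C) \<subseteq> C - {- 1}"
  proof
    fix y assume "y \<in> \<psi> ` ((*) g ` C)"
    then obtain x where x: "y = \<psi> x" "x \<in> (*) g ` C" by blast
    have "0 \<notin> (*) g ` C" "0 \<notin> (*) h ` C" using C0 g0 h0 by auto
    hence "y + 1 \<noteq> 0" using cases[OF x(2)] unfolding x(1) by metis
    hence "y \<noteq> - 1" by (simp add: eq_neg_iff_add_eq_0)
    moreover have "y \<in> C" using cases[OF x(2)] unfolding x(1) by blast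
    ultimately show "y \<in> C - {- 1}" by blast
  qed
  ultimately have "card ((*) g ` C) \<le> card (C - {- 1})" by (rule card_inj_on_le) simp
  moreover have "card (C - {- 1}) < card C" using Cm[OF C1] by (intro card_Diff1_less) simp_all
  ultimately show False using cg by simp
qed

section \<open>Fibres and their resolvents\<close>

text \<open>
  The quartic \<open>P - t Q\<close> for the function of the theorem is \<open>fibre_poly\<close> with \<open>\<alpha> = a + d\<close> and
  \<open>\<beta> = b + e\<close>.
\<close>
definition fibre_roots ::
  "'b::comm_ring_1 \<Rightarrow> 'b \<Rightarrow> 'b \<Rightarrow> 'b \<Rightarrow> 'b \<Rightarrow> 'b \<Rightarrow> 'b \<Rightarrow> 'b \<Rightarrow> 'b \<Rightarrow> 'b \<Rightarrow> bool" where
  "fibre_roots \<alpha> \<beta> c d e t w x y z \<longleftrightarrow>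
     t = w + x + y + z \<and> \<alpha> = w * x + w * y + w * z + x * y + x * z + y * z \<and>
     \<beta> = t * d - (w * x * y + w * x * z + w * y * z + x * y * z) \<and> c = t * e + w * x * y * z"

definition fibre_poly :: "'b::comm_ring_1 \<Rightarrow> 'b \<Rightarrow> 'b \<Rightarrow> 'b \<Rightarrow> 'b \<Rightarrow> 'b \<Rightarrow> 'b \<Rightarrow> 'b" where
  "fibre_poly \<alpha> \<beta> c d e t x = x ^ 4 - t * x ^ 3 + \<alpha> * x ^ 2 + (\<beta> - t * d) * x + (c - t * e)"

lemma fibre_rootsD:
  assumes "fibre_roots \<alpha> \<beta> c d e t w x y z"
  shows "t = w + x + y + z" "\<alpha> = w * x + w * y + w * z + x * y + x * z + y * z"
    "\<beta> = t * d - (w * x * y + w * x * z + w * y * z + x * y * z)" "c = t * e + w * x * y * z"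
  using assms unfolding fibre_roots_def by blast+

lemma fibre_roots_swap:
  assumes "fibre_roots \<alpha> \<beta> c d e t w x y z"
  shows "fibre_roots \<alpha> \<beta> c d e t x w y z" "fibre_roots \<alpha> \<beta> c d e t w y x z"
    "fibre_roots \<alpha> \<beta> c d e t w x z y"
  using assms unfolding fibre_roots_def by (simp_all add: algebra_simps)

lemma fibre_poly_roots:
  assumes "fibre_roots \<alpha> \<beta> c d e t w x y z"
  shows "fibre_poly \<alpha> \<beta> c d e t u = (u - w) * (u - x) * (u - y) * (u - z)"
proof -
  define k l where "k = w * x * y + w * x * z + w * y * z + x * y * z" and "l = w * x * y * z"
  have t: "t = w + x + y + z" and \<alpha>: "\<alpha> = w * x + w * y + w * z + x * y + x * z + y * z"
    and \<beta>: "\<beta> = t * d - k" and c: "c = t * e + l"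
    using assms unfolding fibre_roots_def k_def l_def by simp_all
  have "fibre_poly \<alpha> \<beta> c d e t u = u ^ 4 - t * u ^ 3 + \<alpha> * u ^ 2 - k * u + l"
    unfolding fibre_poly_def \<beta> c by (simp add: algebra_simps)
  thus ?thesis unfolding t \<alpha> k_def l_def by (simp add: ring_simps)
qed

lemma fibre_roots_exist:
  fixes \<alpha> :: "'b::alg_closed_field"
  obtains w x y z where "fibre_roots \<alpha> \<beta> c d e t w x y z"
proof -
  obtain w x y z where "- t = - (w + x + y + z)"
    "\<alpha> = w * x + w * y + w * z + x * y + x * z + y * z"
    "\<beta> - t * d = - (w * x * y + w * x * z + w * y * z + x * y * z)" "c - t * e = w * x * y * z"
    by (rule monic_quartic_splits)
  hence "fibre_roots \<alpha> \<beta> c d e t w x y z"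
    unfolding fibre_roots_def by (simp add: algebra_simps)
  thus ?thesis by (rule that)
qed

text \<open>Ferrari's cubic resolvent of the quartic is \<open>\<zeta>\<^sup>3 - \<alpha> \<zeta>\<^sup>2 + res1 \<zeta> + res0\<close>.\<close>
definition res1 :: "'b::comm_ring_1 \<Rightarrow> 'b \<Rightarrow> 'b \<Rightarrow> 'b \<Rightarrow> 'b \<Rightarrow> 'b" where
  "res1 \<beta> c d e t = d * t ^ 2 + (4 * e - \<beta>) * t - 4 * c"

definition res0 :: "'b::comm_ring_1 \<Rightarrow> 'b \<Rightarrow> 'b \<Rightarrow> 'b \<Rightarrow> 'b \<Rightarrow> 'b \<Rightarrow> 'b" where
  "res0 \<alpha> \<beta> c d e t =
     e * t ^ 3 - (c + d ^ 2) * t ^ 2 + (2 * \<beta> * d - 4 * \<alpha> * e) * t + (4 * \<alpha> * c - \<beta> ^ 2)"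

text \<open>Taken from the cubic resolvent, because a quartic and its resolvent have the same
  discriminant (\<open>fibre_disc_roots\<close>).\<close>

definition fibre_disc :: "'b::comm_ring_1 \<Rightarrow> 'b \<Rightarrow> 'b \<Rightarrow> 'b \<Rightarrow> 'b \<Rightarrow> 'b \<Rightarrow> 'b" where
  "fibre_disc \<alpha> \<beta> c d e t = disc3 (- \<alpha>) (res1 \<beta> c d e t) (res0 \<alpha> \<beta> c d e t)"

lemma resolvent_roots:
  assumes "fibre_roots \<alpha> \<beta> c d e t w x y z"
  shows "\<alpha> = (w * x + y * z) + (w * y + x * z) + (w * z + x * y)"
    "res1 \<beta> c d e t = (w * x + y * z) * (w * y + x * z) + (w * x + y * z) * (w * z + x * y) +
       (w * y + x * z) * (w * z + x * y)"
    "res0 \<alpha> \<beta> c d e t = - ((w * x + y * z) * (w * y + x * z) * (w * z + x * y))"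
proof -
  define u v where "u = w * x * y + w * x * z + w * y * z + x * y * z" and "v = w * x * y * z"
  have t: "t = w + x + y + z" and \<alpha>: "\<alpha> = w * x + w * y + w * z + x * y + x * z + y * z"
    and \<beta>: "\<beta> = t * d - u" and c: "c = t * e + v"
    using assms unfolding fibre_roots_def u_def v_def by simp_all
  show "\<alpha> = (w * x + y * z) + (w * y + x * z) + (w * z + x * y)"
    unfolding \<alpha> by (simp add: algebra_simps)
  have "res1 \<beta> c d e t = t * u - 4 * v" unfolding res1_def \<beta> c by (simp add: ring_simps)
  thus "res1 \<beta> c d e t = (w * x + y * z) * (w * y + x * z) + (w * x + y * z) * (w * z + x * y) +
       (w * y + x * z) * (w * z + x * y)"
    unfolding t u_def v_def by (simp add: ring_simps)
  have "res0 \<alpha> \<beta> c d e t = - ((t ^ 2 - 4 * \<alpha>) * v + u ^ 2)"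
    unfolding res0_def \<beta> c by (simp add: ring_simps)
  thus "res0 \<alpha> \<beta> c d e t = - ((w * x + y * z) * (w * y + x * z) * (w * z + x * y))"
    unfolding t \<alpha> u_def v_def by (simp add: ring_simps)
qed

lemma resolvent_poly:
  assumes "fibre_roots \<alpha> \<beta> c d e t w x y z"
  shows "\<zeta> ^ 3 - \<alpha> * \<zeta> ^ 2 + res1 \<beta> c d e t * \<zeta> + res0 \<alpha> \<beta> c d e t =
    (\<zeta> - (w * x + y * z)) * (\<zeta> - (w * y + x * z)) * (\<zeta> - (w * z + x * y))"
proof -
  define p q r where "p = w * x + y * z" and "q = w * y + x * z" and "r = w * z + x * y"
  show ?thesis
    unfolding resolvent_roots(2,3)[OF assms, folded p_def q_def r_def]
      p_def[symmetric] q_def[symmetric] r_def[symmetric]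
    unfolding resolvent_roots(1)[OF assms, folded p_def q_def r_def] by (simp add: ring_simps)
qed

text \<open>Each difference of two resolvent roots is a product of two differences of roots of the
  quartic, and all six occur once.\<close>

lemma fibre_disc_roots:
  assumes "fibre_roots \<alpha> \<beta> c d e t w x y z"
  shows "fibre_disc \<alpha> \<beta> c d e t =
    ((w - x) * (w - y) * (w - z) * (x - y) * (x - z) * (y - z)) ^ 2"
proof -
  define p q r where "p = w * x + y * z" and "q = w * y + x * z" and "r = w * z + x * y"
  have "fibre_disc \<alpha> \<beta> c d e t = ((p - q) * (p - r) * (q - r)) ^ 2"
    unfolding fibre_disc_def resolvent_roots(2,3)[OF assms, folded p_def q_def r_def]
    unfolding resolvent_roots(1)[OF assms, folded p_def q_def r_def] disc3_roots ..
  also have "p - q = (w - z) * (x - y)" by (simp add: p_def q_def algebra_simps)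
  also have "p - r = (w - y) * (x - z)" by (simp add: p_def r_def algebra_simps)
  also have "q - r = (w - x) * (y - z)" by (simp add: q_def r_def algebra_simps)
  finally show ?thesis by (simp add: mult_ac)
qed

definition fibre_disc_poly :: "'b::comm_ring_1 \<Rightarrow> 'b \<Rightarrow> 'b \<Rightarrow> 'b \<Rightarrow> 'b \<Rightarrow> 'b poly" where
  "fibre_disc_poly \<alpha> \<beta> c d e =
     disc3 [:- \<alpha>:] [:- 4 * c, 4 * e - \<beta>, d:]
       [:4 * \<alpha> * c - \<beta> ^ 2, 2 * \<beta> * d - 4 * \<alpha> * e, - (c + d ^ 2), e:]"

lemma poly_disc3 [simp]: "poly (disc3 p q r) t = disc3 (poly p t) (poly q t) (poly r t)"
  by (simp add: disc3_def)

lemma poly_fibre_disc_poly [simp]: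
  "poly (fibre_disc_poly \<alpha> \<beta> c d e) t = fibre_disc \<alpha> \<beta> c d e t"
proof -
  have "poly [:- 4 * c, 4 * e - \<beta>, d:] t = res1 \<beta> c d e t"
    by (simp add: res1_def ring_simps)
  moreover have "poly [:4 * \<alpha> * c - \<beta> ^ 2, 2 * \<beta> * d - 4 * \<alpha> * e, - (c + d ^ 2), e:] t =
      res0 \<alpha> \<beta> c d e t"
    by (simp add: res0_def ring_simps)
  ultimately show ?thesis by (simp add: fibre_disc_poly_def fibre_disc_def del: poly_pCons) simp
qed

lemma poly_pderiv_disc3_const:
  fixes q r :: "'b::idom poly"
  shows "poly (pderiv (disc3 [:p:] q r)) t =
     poly (pderiv q) t * (2 * p ^ 2 * poly q t - 12 * poly q t ^ 2 + 18 * p * poly r t) +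
     poly (pderiv r) t * (18 * p * poly q t - 4 * p ^ 3 - 54 * poly r t)"
  unfolding disc3_def power2_eq_square power3_eq_cube pderiv_add pderiv_diff pderiv_mult
  by (simp add: pderiv_pCons algebra_simps)

text \<open>Used in reverse: if 4 and the denominator at \<open>x\<close> are nonzero, a vanishing
  derivative forces a second coincidence among the roots.\<close>

lemma pderiv_fibre_disc_double_root:
  fixes x :: "'b::idom"
  assumes "fibre_roots \<alpha> \<beta> c d e t x x y z"
  shows "poly (pderiv (fibre_disc_poly \<alpha> \<beta> c d e)) t =
    4 * ((x - y) * (x - z)) ^ 3 * ((x ^ 3 + d * x + e) * (y - z) ^ 2)"
proof -
  define v w where "v = x * x + y * z" and "w = x * y + x * z"
  have w': "w = x * z + x * y" by (simp add: w_def)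
  \<comment> \<open>\<open>k\<close> and \<open>l\<close> are the derivatives of \<open>res1\<close>
    and \<open>res0\<close>, so \<open>w k + l\<close> is the derivative in \<open>t\<close> of the
    resolvent at its double root \<open>w\<close>.\<close>
  define k l where "k = 2 * d * t + (4 * e - \<beta>)"
    and "l = 3 * e * t ^ 2 - 2 * (c + d ^ 2) * t + (2 * \<beta> * d - 4 * \<alpha> * e)"
  note rr = resolvent_roots[OF assms, folded v_def w_def w']
  have "poly (pderiv (fibre_disc_poly \<alpha> \<beta> c d e)) t =
      k * (2 * \<alpha> ^ 2 * res1 \<beta> c d e t - 12 * res1 \<beta> c d e t ^ 2 - 18 * \<alpha> * res0 \<alpha> \<beta> c d e t) +
      l * (4 * \<alpha> ^ 3 - 18 * \<alpha> * res1 \<beta> c d e t - 54 * res0 \<alpha> \<beta> c d e t)"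
  proof -
    have 1: "poly [:- 4 * c, 4 * e - \<beta>, d:] t = res1 \<beta> c d e t"
      by (simp add: res1_def ring_simps)
    have 0: "poly [:4 * \<alpha> * c - \<beta> ^ 2, 2 * \<beta> * d - 4 * \<alpha> * e, - (c + d ^ 2), e:] t =
        res0 \<alpha> \<beta> c d e t"
      by (simp add: res0_def ring_simps)
    have k: "poly (pderiv [:- 4 * c, 4 * e - \<beta>, d:]) t = k"
      by (simp add: k_def pderiv_pCons ring_simps)
    have l: "poly (pderiv [:4 * \<alpha> * c - \<beta> ^ 2, 2 * \<beta> * d - 4 * \<alpha> * e, - (c + d ^ 2), e:]) t = l"
      by (simp add: l_def pderiv_pCons ring_simps)
    show ?thesis
      unfolding fibre_disc_poly_def poly_pderiv_disc3_const k l 1 0 by (simp add: ring_simps)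
  qed
  also have "\<dots> = 4 * (v - w) ^ 3 * (w * k + l)"
    unfolding rr(2,3) unfolding rr(1) by (simp add: ring_simps)
  also have "v - w = (x - y) * (x - z)" by (simp add: v_def w_def algebra_simps)
  also have "w * k + l = (x ^ 3 + d * x + e) * (y - z) ^ 2"
    unfolding k_def l_def w_def fibre_rootsD(3,4)[OF assms] unfolding fibre_rootsD(1,2)[OF assms]
    by (simp add: ring_simps)
  finally show ?thesis .
qed

text \<open>Shows that in odd characteristic the discriminant vanishes to order exactly 3 at a
  quadruple root where the denominator is nonzero; an odd order is impossible for a square.\<close>

lemma fibre_disc_quadruple_root:
  assumes "fibre_roots \<alpha> \<beta> c d e t0 x x x x" and t: "t = t0 + \<epsilon>"
  shows "fibre_disc \<alpha> \<beta> c d e t = \<epsilon> ^ 3 * (- 4 * (4 * (x ^ 3 + d * x + e) + \<epsilon> * d) ^ 3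
    - 27 * \<epsilon> * (2 * x ^ 2 * d - x ^ 4 + 8 * x * e - d ^ 2 + \<epsilon> * e) ^ 2)"
proof -
  define Q m where "Q = x ^ 3 + d * x + e" and "m = 2 * x ^ 2 * d - x ^ 4 + 8 * x * e - d ^ 2 + \<epsilon> * e"
  \<comment> \<open>Translation by \<open>k\<close> depresses the cubic. Below,
    \<open>k = 2 x^2\<close> is the triple root of the resolvent at \<open>t0\<close>, so there is
    no division by 3.\<close>
  have shift: "disc3 (- (3 * k)) (C + 3 * k ^ 2) (A - k * C - k ^ 3) = - 4 * C ^ 3 - 27 * A ^ 2"
    for k C A :: 'a by (simp add: disc3_def ring_simps)
  have "\<alpha> = 3 * (2 * x ^ 2)" unfolding fibre_rootsD(2)[OF assms(1)] by (simp add: ring_simps)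
  moreover have "res1 \<beta> c d e t = \<epsilon> * (4 * Q + \<epsilon> * d) + 3 * (2 * x ^ 2) ^ 2"
    unfolding res1_def Q_def t fibre_rootsD(3,4)[OF assms(1)]
    unfolding fibre_rootsD(1,2)[OF assms(1)] by (simp add: ring_simps)
  moreover have "res0 \<alpha> \<beta> c d e t = \<epsilon> ^ 2 * m - 2 * x ^ 2 * (\<epsilon> * (4 * Q + \<epsilon> * d)) - (2 * x ^ 2) ^ 3"
    unfolding res0_def Q_def m_def t fibre_rootsD(3,4)[OF assms(1)]
    unfolding fibre_rootsD(1,2)[OF assms(1)] by (simp add: ring_simps)
  ultimately have "fibre_disc \<alpha> \<beta> c d e t = - 4 * (\<epsilon> * (4 * Q + \<epsilon> * d)) ^ 3 - 27 * (\<epsilon> ^ 2 * m) ^ 2"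
    unfolding fibre_disc_def by (simp only: shift)
  thus ?thesis unfolding Q_def[symmetric] m_def[symmetric] by (simp add: ring_simps)
qed

lemma fibre_poly_to_ac:
  "fibre_poly (to_ac \<alpha>) (to_ac \<beta>) (to_ac c) (to_ac d) (to_ac e) (to_ac t) (to_ac x) =
     to_ac (fibre_poly \<alpha> \<beta> c d e t x)"
  by (simp add: fibre_poly_def)

lemma fibre_disc_to_ac:
  "fibre_disc (to_ac \<alpha>) (to_ac \<beta>) (to_ac c) (to_ac d) (to_ac e) (to_ac t) =
     to_ac (fibre_disc \<alpha> \<beta> c d e t)"
  by (simp add: fibre_disc_def res1_def res0_def disc3_def)

lemma degree_disc3:
  fixes p q r :: "'b::comm_ring_1 poly"
  assumes "degree p = 0" "degree q \<le> 2" "degree r \<le> 3"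
  shows "degree (disc3 p q r) \<le> 6"
proof -
  have m: "degree (f * g) \<le> m + n" if "degree f \<le> m" "degree g \<le> n" for f g :: "'b poly" and m n
    using degree_mult_le[of f g] that by linarith
  have pow: "degree (f ^ k) \<le> m * k" if "degree f \<le> m" for f :: "'b poly" and m k
    using degree_power_le[of f k] that by (meson le_trans mult_le_mono1)
  have num: "degree (numeral k :: 'b poly) \<le> 0" for k by (simp add: numeral_poly)
  have p: "degree p \<le> 0" using assms by simp
  have "degree (p ^ 2 * q ^ 2) \<le> 0 * 2 + 2 * 2" by (intro m pow p assms)
  moreover have "degree (4 * q ^ 3) \<le> 0 + 2 * 3" by (intro m pow num p assms)
  moreover have "degree (4 * p ^ 3 * r) \<le> 0 + 0 * 3 + 3" by (intro m pow num p assms)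
  moreover have "degree (27 * r ^ 2) \<le> 0 + 3 * 2" by (intro m pow num p assms)
  moreover have "degree (18 * p * q * r) \<le> 0 + 0 + 2 + 3" by (intro m num p assms)
  ultimately show ?thesis unfolding disc3_def by (intro degree_add_le degree_diff_le) simp_all
qed

lemma coeff_disc3:
  "coeff (disc3 [:p0:] [:q0, q1, q2:] [:r0, r1, r2, r3:]) 6 = - 4 * q2 ^ 3 - 27 * r3 ^ 2"
  by (simp add: disc3_def numeral_poly power2_eq_square power3_eq_cube coeff_pCons
    split: nat.splits)

text \<open>The denominator has no rational zero, so infinity is its own fibre and bijectivity
  amounts to \<open>ex\<close> and \<open>uniq\<close> for finite \<open>t\<close>.\<close>

locale permuting_pencil =
  fixes a b c d e :: "'a::{field,finite}" and \<alpha> \<beta>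
  defines \<alpha>_def: "\<alpha> \<equiv> a + d" and \<beta>_def: "\<beta> \<equiv> b + e"
  assumes irr: "\<And>x. x ^ 3 + d * x + e \<noteq> 0" and nz: "\<not> (a = 0 \<and> b = 0 \<and> c = 0)"
    and ex: "\<And>t. \<exists>x. fibre_poly \<alpha> \<beta> c d e t x = 0"
    and uniq: "\<And>t x y. fibre_poly \<alpha> \<beta> c d e t x = 0 \<Longrightarrow> fibre_poly \<alpha> \<beta> c d e t y = 0 \<Longrightarrow> x = y"
begin

abbreviation fibre :: "'a alg_closure \<Rightarrow> 'a alg_closure \<Rightarrow> 'a alg_closure \<Rightarrow> 'a alg_closure \<Rightarrow>
    'a alg_closure \<Rightarrow> bool" where
  "fibre \<equiv> fibre_roots (to_ac \<alpha>) (to_ac \<beta>) (to_ac c) (to_ac d) (to_ac e)"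

abbreviation disc_poly :: "'a poly" where "disc_poly \<equiv> fibre_disc_poly \<alpha> \<beta> c d e"

lemma e_nz: "e \<noteq> 0"
  using irr[of 0] by simp

lemma frob_fibre:
  assumes "fibre t w x y z"
  shows "fibre (frob t) (frob w) (frob x) (frob y) (frob z)"
  using fibre_rootsD[OF assms, THEN arg_cong[of _ _ frob]]
  unfolding fibre_roots_def by simp

text \<open>Split off the rational root \<open>w\<close>. The remaining cubic either has no rational
  root, and Frobenius cycles its roots, or it has one, which equals \<open>w\<close> by
  uniqueness.\<close>

lemma fibre_cases:
  obtains (cyclic) w x y z where "fibre (to_ac t) (to_ac w) x y z" "frob x = y" "frob y = z"
      "frob z = x" "x \<noteq> y" "x \<noteq> z" "y \<noteq> z"
    | (double) w y z where "fibre (to_ac t) (to_ac w) (to_ac w) y z"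
proof -
  obtain w where w: "fibre_poly \<alpha> \<beta> c d e t w = 0" using ex by blast
  define p q r where "p = w - t" and "q = \<alpha> + w * p" and "r = \<beta> - t * d + w * q"
  have split: "fibre_poly \<alpha> \<beta> c d e t x = (x - w) * (x ^ 3 + p * x ^ 2 + q * x + r)" for x
  proof -
    have "fibre_poly \<alpha> \<beta> c d e t x =
        (x - w) * (x ^ 3 + p * x ^ 2 + q * x + r) + fibre_poly \<alpha> \<beta> c d e t w"
      by (simp add: fibre_poly_def p_def q_def r_def ring_simps)
    thus ?thesis using w by simp
  qed
  have c: "c = t * e - w * r" using split[of 0] by (simp add: fibre_poly_def algebra_simps)
  have fib: "fibre (to_ac t) (to_ac w) x y z"
    if "to_ac p = - (x + y + z)" "to_ac q = x * y + x * z + y * z" "to_ac r = - (x * y * z)" for x y z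
  proof -
    have "to_ac t = to_ac w - to_ac p" by (simp add: p_def)
    moreover have "to_ac \<alpha> = to_ac q - to_ac w * to_ac p" by (simp add: q_def)
    moreover have "to_ac \<beta> = to_ac t * to_ac d + to_ac r - to_ac w * to_ac q" by (simp add: r_def)
    moreover have "to_ac c = to_ac t * to_ac e - to_ac w * to_ac r" by (simp add: c)
    ultimately show ?thesis unfolding fibre_roots_def that by (simp add: algebra_simps)
  qed
  show ?thesis
  proof (cases "\<exists>x. x ^ 3 + p * x ^ 2 + q * x + r = 0")
    case False
    then obtain x y z where "frob x = y" "frob y = z" "frob z = x" "x \<noteq> y" "x \<noteq> z" "y \<noteq> z"
        "to_ac p = - (x + y + z)" "to_ac q = x * y + x * z + y * z" "to_ac r = - (x * y * z)"
      using rootless_cubic_cyclic[of p q r] by blast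
    thus ?thesis using cyclic fib by blast
  next
    case True
    then obtain x where x: "x ^ 3 + p * x ^ 2 + q * x + r = 0" by blast
    hence "fibre_poly \<alpha> \<beta> c d e t x = 0" using split by simp
    hence "x = w" using uniq w by blast
    obtain x' y z where *: "to_ac p = - (x' + y + z)" "to_ac q = x' * y + x' * z + y * z"
        "to_ac r = - (x' * y * z)"
      by (rule monic_cubic_splits)
    have "(to_ac w - x') * (to_ac w - y) * (to_ac w - z) =
        to_ac w ^ 3 + to_ac p * to_ac w ^ 2 + to_ac q * to_ac w + to_ac r"
      unfolding * by (simp add: ring_simps)
    also have "\<dots> = to_ac (w ^ 3 + p * w ^ 2 + q * w + r)" by simp
    also have "\<dots> = 0" using x unfolding \<open>x = w\<close> by simp
    finally consider "x' = to_ac w" | "y = to_ac w" | "z = to_ac w" by auto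
    thus ?thesis
    proof cases
      case 1
      thus ?thesis using double fib[OF *] by simp
    next
      case 2
      thus ?thesis using double fibre_roots_swap(2)[OF fib[OF *]] by simp
    next
      case 3
      thus ?thesis using double fibre_roots_swap(2)[OF fibre_roots_swap(3)[OF fib[OF *]]] by simp
    qed
  qed
qed

lemma fibre_root_cases:
  assumes "fibre (to_ac t) w x y z" and "fibre_poly \<alpha> \<beta> c d e t u = 0"
  shows "to_ac u = w \<or> to_ac u = x \<or> to_ac u = y \<or> to_ac u = z"
proof -
  have "(to_ac u - w) * (to_ac u - x) * (to_ac u - y) * (to_ac u - z) = 0"
    using fibre_poly_roots[OF assms(1), of "to_ac u"] assms(2) by (simp add: fibre_poly_to_ac)
  thus ?thesis by auto
qed

lemma rational_root_iff:
  assumes "fibre (to_ac t) w x y z"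
  shows "fibre_poly \<alpha> \<beta> c d e t u = 0 \<longleftrightarrow> to_ac u \<in> {w, x, y, z}"
  using fibre_root_cases[OF assms] fibre_poly_roots[OF assms, of "to_ac u"]
  by (auto simp: fibre_poly_to_ac)

text \<open>Frobenius permutes the two values and fixes the rational one, hence the other one too;
  both are then rational roots of one fibre.\<close>

lemma two_roots_imp_one:
  assumes fib: "fibre (to_ac t) w x y z" and set: "{w, x, y, z} = {u, v}"
  obtains r where "u = to_ac r" "v = to_ac r"
proof -
  have perm: "frob k \<in> {w, x, y, z}" if "k \<in> {w, x, y, z}" for k
  proof -
    have "fibre_poly (to_ac \<alpha>) (to_ac \<beta>) (to_ac c) (to_ac d) (to_ac e) (to_ac t) k = 0"
      using that unfolding fibre_poly_roots[OF fib] by auto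
    hence "frob (fibre_poly (to_ac \<alpha>) (to_ac \<beta>) (to_ac c) (to_ac d) (to_ac e) (to_ac t) k) = 0"
      by simp
    hence "fibre_poly (to_ac \<alpha>) (to_ac \<beta>) (to_ac c) (to_ac d) (to_ac e) (to_ac t) (frob k) = 0"
      by (simp add: fibre_poly_def)
    thus ?thesis unfolding fibre_poly_roots[OF fib] by auto
  qed
  obtain r where r: "fibre_poly \<alpha> \<beta> c d e t r = 0" using ex by blast
  have main: ?thesis if "{w, x, y, z} = {to_ac r, l}" "{u, v} = {to_ac r, l}" for l
  proof -
    have "frob l \<in> {to_ac r, l}" using perm[of l] that by blast
    hence "frob l = l" using frob_eq_iff[of l "to_ac r"] by auto
    then obtain l' where l: "l = to_ac l'" by (rule frob_fixedD)
    hence "fibre_poly \<alpha> \<beta> c d e t l' = 0" using rational_root_iff[OF fib] that by blast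
    hence "l' = r" using r uniq by blast
    thus ?thesis using \<open>\<And>r. u = to_ac r \<Longrightarrow> v = to_ac r \<Longrightarrow> thesis\<close> that(2) l
      by (metis insertCI insert_absorb2 singletonD)
  qed
  have "to_ac r \<in> {u, v}" using rational_root_iff[OF fib] r set by blast
  thus ?thesis using main[of v] main[of u] set by (metis insert_commute insertE singletonD)
qed

lemma root_independent:
  assumes "x ^ 3 + to_ac d * x + to_ac e = 0" and "to_ac k + to_ac l * x + to_ac m * x ^ 2 = 0"
  shows "k = 0 \<and> l = 0 \<and> m = 0"
proof -
  obtain r s u where r: "frob r = s" "frob s = u" "frob u = r" "r \<noteq> s" "r \<noteq> u" "s \<noteq> u"
      "to_ac (0 :: 'a) = - (r + s + u)" "to_ac d = r * s + r * u + s * u" "to_ac e = - (r * s * u)"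
    using rootless_cubic_cyclic[of 0 d e] irr by auto
  have "0 = x ^ 3 + to_ac 0 * x ^ 2 + to_ac d * x + to_ac e" using assms(1) by simp
  also have "\<dots> = (x - r) * (x - s) * (x - u)" unfolding r(7-9) by (simp add: ring_simps)
  finally have "x = r \<or> x = s \<or> x = u" by auto
  hence "x \<noteq> frob x" "x \<noteq> frob (frob x)" using r(1-6) by auto
  thus ?thesis using assms(2) cyclic_independent by blast
qed

text \<open>At a zero of the denominator the fibre equation reduces to
  \<open>a x^2 + b x + c = 0\<close>, which independence forbids.\<close>

lemma denominator_nz:
  assumes "fibre t x w y z"
  shows "x ^ 3 + to_ac d * x + to_ac e \<noteq> 0"
proof
  assume Q: "x ^ 3 + to_ac d * x + to_ac e = 0"
  have "fibre_poly (to_ac \<alpha>) (to_ac \<beta>) (to_ac c) (to_ac d) (to_ac e) t x = 0"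
    unfolding fibre_poly_roots[OF assms] by simp
  moreover have "fibre_poly (to_ac \<alpha>) (to_ac \<beta>) (to_ac c) (to_ac d) (to_ac e) t x =
      (x - t) * (x ^ 3 + to_ac d * x + to_ac e) + (to_ac c + to_ac b * x + to_ac a * x ^ 2)"
    by (simp add: fibre_poly_def \<alpha>_def \<beta>_def ring_simps)
  ultimately have "to_ac c + to_ac b * x + to_ac a * x ^ 2 = 0" using Q by simp
  hence "c = 0 \<and> b = 0 \<and> a = 0" using root_independent[OF Q] by blast
  thus False using nz by blast
qed

text \<open>In the cyclic case Frobenius permutes the four roots evenly, so the product of their
  differences is rational; otherwise the discriminant is 0.\<close>

lemma fibre_disc_square: "\<exists>w. fibre_disc \<alpha> \<beta> c d e t = w ^ 2"
proof (cases rule: fibre_cases[of t])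
  case (cyclic w x y z)
  define p where "p = (to_ac w - x) * (to_ac w - y) * (to_ac w - z) * (x - y) * (x - z) * (y - z)"
  have "frob p = p" unfolding p_def by (simp add: cyclic(2-4) algebra_simps)
  then obtain v where v: "p = to_ac v" by (rule frob_fixedD)
  have "to_ac (fibre_disc \<alpha> \<beta> c d e t) = p ^ 2"
    unfolding fibre_disc_to_ac[symmetric] fibre_disc_roots[OF cyclic(1)] p_def by (simp add: mult_ac)
  hence "to_ac (fibre_disc \<alpha> \<beta> c d e t) = to_ac (v ^ 2)" using v by simp
  thus ?thesis unfolding to_ac_eq_iff by blast
next
  case (double w y z)
  have "to_ac (fibre_disc \<alpha> \<beta> c d e t) = 0"
    unfolding fibre_disc_to_ac[symmetric] fibre_disc_roots[OF double(1)] by simp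
  thus ?thesis by (intro exI[of _ 0]) simp
qed

lemma degree_disc_poly: "degree disc_poly \<le> 6"
  unfolding fibre_disc_poly_def by (rule degree_disc3) simp_all

text \<open>The coefficient is the discriminant of the denominator, reflecting the fibre over
  infinity. It is nonzero, so the degree is exactly 6.\<close>

lemma coeff_disc_poly: "coeff disc_poly 6 = disc3 0 d e"
  unfolding fibre_disc_poly_def coeff_disc3 by (simp add: disc3_def)

lemma disc_poly_nz: "coeff disc_poly 6 \<noteq> 0"
proof -
  obtain w where "w \<noteq> 0" "disc3 0 d e = w ^ 2"
    using rootless_cubic_disc3[of 0 d e] irr by auto
  thus ?thesis by (simp add: coeff_disc_poly)
qed

end

section \<open>Odd characteristic\<close>

lemma map_poly_to_ac_simps [simp]:
  "map_poly to_ac (p + q) = map_poly to_ac p + map_poly to_ac q"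
  "map_poly to_ac (p - q) = map_poly to_ac p - map_poly to_ac q"
  "map_poly to_ac (p * q) = map_poly to_ac p * map_poly to_ac q"
  by (simp_all add: map_poly_hom_add map_poly_hom_mult) (rule poly_eqI, simp add: coeff_map_poly)

lemma map_poly_to_ac_power [simp]: "map_poly to_ac (p ^ n) = map_poly to_ac p ^ n"
  by (induction n) simp_all

lemma map_poly_to_ac_numeral [simp]: "map_poly to_ac (numeral n) = numeral n"
  by (simp add: numeral_poly map_poly_pCons)

lemma map_poly_to_ac_disc3 [simp]:
  "map_poly to_ac (disc3 p q r) = disc3 (map_poly to_ac p) (map_poly to_ac q) (map_poly to_ac r)"
  by (simp add: disc3_def)

lemma poly_map_poly_to_ac [simp]: "poly (map_poly to_ac p) (to_ac x) = to_ac (poly p x)"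
  by (induction p) (simp_all add: map_poly_pCons)

lemma map_poly_to_ac_fibre_disc_poly:
  "map_poly to_ac (fibre_disc_poly \<alpha> \<beta> c d e) =
     fibre_disc_poly (to_ac \<alpha>) (to_ac \<beta>) (to_ac c) (to_ac d) (to_ac e)"
  by (simp add: fibre_disc_poly_def map_poly_pCons)

lemma four_nz: "(2 :: 'b::idom) \<noteq> 0 \<Longrightarrow> (4 :: 'b) \<noteq> 0"
proof -
  have "(4 :: 'b) = 2 * 2" by simp
  thus "(2 :: 'b) \<noteq> 0 \<Longrightarrow> (4 :: 'b) \<noteq> 0" by (metis mult_eq_0_iff)
qed

context permuting_pencil
begin

lemma double_fibre:
  assumes "(2 :: 'a) \<noteq> 0" "fibre_disc (to_ac \<alpha>) (to_ac \<beta>) (to_ac c) (to_ac d) (to_ac e) t = 0"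
    "poly (pderiv (map_poly to_ac disc_poly)) t = 0"
  obtains (four) x y where "fibre t x x y y" | (three) x y where "fibre t x x x y"
proof -
  obtain w x y z where f: "fibre t w x y z" by (rule fibre_roots_exist)
  have "((w - x) * (w - y) * (w - z) * (x - y) * (x - z) * (y - z)) ^ 2 = 0"
    using assms(2) unfolding fibre_disc_roots[OF f] .
  then consider "w = x" | "w = y" | "w = z" | "x = y" | "x = z" | "y = z" by auto
  then obtain u v r where uvr: "fibre t u u v r"
  proof cases
    case 1 show ?thesis using that f unfolding 1 by blast
  next
    case 2 show ?thesis using that fibre_roots_swap(2)[OF f] unfolding 2 by blast
  next
    case 3 show ?thesis using that fibre_roots_swap(2)[OF fibre_roots_swap(3)[OF f]] unfolding 3 by blast
  next
    case 4 show ?thesis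
      using that fibre_roots_swap(2)[OF fibre_roots_swap(1)[OF f]] unfolding 4 by blast
  next
    case 5 show ?thesis
      using that fibre_roots_swap(2)[OF fibre_roots_swap(3)[OF fibre_roots_swap(1)[OF f]]]
      unfolding 5 by blast
  next
    case 6 show ?thesis
      using that fibre_roots_swap(2)[OF fibre_roots_swap(1)[OF fibre_roots_swap(3)[OF
        fibre_roots_swap(2)[OF f]]]] unfolding 6 by blast
  qed
  have "4 * ((u - v) * (u - r)) ^ 3 * ((u ^ 3 + to_ac d * u + to_ac e) * (v - r) ^ 2) = 0"
    using assms(3) unfolding map_poly_to_ac_fibre_disc_poly pderiv_fibre_disc_double_root[OF uvr] .
  moreover have "u ^ 3 + to_ac d * u + to_ac e \<noteq> 0"
    by (rule denominator_nz[OF fibre_roots_swap(1)[OF uvr]])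
  moreover have "(4 :: 'a alg_closure) \<noteq> 0"
    using four_nz[OF assms(1)] to_ac_eq_0_iff[of "4 :: 'a"] by simp
  ultimately consider "u = v" | "u = r" | "v = r" by auto
  thus ?thesis
  proof cases
    case 1
    thus ?thesis using three uvr by blast
  next
    case 2
    thus ?thesis using three fibre_roots_swap(3)[OF uvr] by blast
  next
    case 3
    thus ?thesis using four uvr by blast
  qed
qed

end

locale odd_pencil = permuting_pencil +
  fixes s
  assumes two: "(2 :: 'a) \<noteq> 0" and s: "disc_poly = s ^ 2"
begin

lemma degree_s: "degree s = 3"
proof -
  have "degree disc_poly \<ge> 6" using disc_poly_nz by (rule le_degree)
  hence "degree (s ^ 2) = 6" using degree_disc_poly s by simp
  moreover have "s \<noteq> 0" using s disc_poly_nz by auto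
  ultimately show ?thesis by (simp add: degree_power_eq)
qed

lemma map_s: "map_poly to_ac disc_poly = map_poly to_ac s ^ 2"
  unfolding s by simp

lemma disc_root_s:
  assumes "poly (map_poly to_ac s) t = 0"
  shows "fibre_disc (to_ac \<alpha>) (to_ac \<beta>) (to_ac c) (to_ac d) (to_ac e) t = 0"
    "poly (pderiv (map_poly to_ac disc_poly)) t = 0"
proof -
  have "fibre_disc (to_ac \<alpha>) (to_ac \<beta>) (to_ac c) (to_ac d) (to_ac e) t =
      poly (map_poly to_ac disc_poly) t" by (simp add: map_poly_to_ac_fibre_disc_poly)
  thus "fibre_disc (to_ac \<alpha>) (to_ac \<beta>) (to_ac c) (to_ac d) (to_ac e) t = 0"
    using assms by (simp add: map_s)
  show "poly (pderiv (map_poly to_ac disc_poly)) t = 0"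
    using assms by (simp add: map_s power2_eq_square pderiv_mult)
qed

text \<open>Over a rational zero of \<open>s\<close> the quartic has at most two distinct roots,
  hence a rational quadruple root. There the discriminant has order 3, whereas \<open>s^2\<close>
  has even order.\<close>

lemma s_rootless: "poly s t \<noteq> 0"
proof
  assume root: "poly s t = 0"
  have "poly (map_poly to_ac s) (to_ac t) = 0" using root by simp
  note dr = disc_root_s[OF this]
  obtain r where r: "fibre (to_ac t) (to_ac r) (to_ac r) (to_ac r) (to_ac r)"
  proof (cases rule: double_fibre[OF two dr])
    case (1 x y)
    thus ?thesis using two_roots_imp_one[OF 1, of x y] that by auto
  next
    case (2 x y)
    thus ?thesis using two_roots_imp_one[OF 2, of x y] that by auto
  qed
  have "fibre_roots \<alpha> \<beta> c d e t r r r r"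
    using r unfolding fibre_roots_def by (simp flip: to_ac_add to_ac_mult to_ac_diff)
  hence fr: "fibre_roots [:\<alpha>:] [:\<beta>:] [:c:] [:d:] [:e:] [:t:] [:r:] [:r:] [:r:] [:r:]"
    unfolding fibre_roots_def by (simp add: mult.commute)
  define l where "l = [:- t, 1:]"
  define K where "K = - 4 * (4 * ([:r:] ^ 3 + [:d:] * [:r:] + [:e:]) + l * [:d:]) ^ 3
    - 27 * l * (2 * [:r:] ^ 2 * [:d:] - [:r:] ^ 4 + 8 * [:r:] * [:e:] - [:d:] ^ 2 + l * [:e:]) ^ 2"
  have "fibre_disc [:\<alpha>:] [:\<beta>:] [:c:] [:d:] [:e:] [:0, 1:] = l ^ 3 * K"
    unfolding K_def by (rule fibre_disc_quadruple_root[OF fr]) (simp add: l_def)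
  moreover have "fibre_disc [:\<alpha>:] [:\<beta>:] [:c:] [:d:] [:e:] [:0, 1:] = disc_poly"
    by (simp add: fibre_disc_def fibre_disc_poly_def res1_def res0_def numeral_poly power2_eq_square
      power3_eq_cube algebra_simps)
  ultimately have sK: "s ^ 2 = l ^ 3 * K" using s by simp
  have "poly K t = - 4 * (4 * (r ^ 3 + d * r + e)) ^ 3"
    unfolding K_def l_def by (simp add: algebra_simps)
  also have "\<dots> = - 256 * (r ^ 3 + d * r + e) ^ 3"
    by (simp only: power_mult_distrib) simp
  finally have "poly K t = - 256 * (r ^ 3 + d * r + e) ^ 3" .
  moreover have "(256 :: 'a) = 2 ^ 8" by simp
  ultimately have K: "poly K t \<noteq> 0" using irr[of r] two by (metis mult_eq_0_iff neg_equal_0_iff_equal power_eq_0_iff mult_minus_left)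
  have "l dvd s" using root unfolding l_def by (simp add: poly_eq_0_iff_dvd)
  then obtain s1 where s1: "s = l * s1" by (elim dvdE)
  have l0: "l \<noteq> 0" by (simp add: l_def)
  have "l ^ 2 * s1 ^ 2 = l ^ 2 * (l * K)" using sK unfolding s1 by (simp add: ring_simps)
  hence s1': "s1 ^ 2 = l * K" using l0 by simp
  have "poly (s1 ^ 2) t = 0" unfolding s1' by (simp add: l_def)
  hence "l dvd s1" unfolding l_def by (simp add: poly_eq_0_iff_dvd)
  then obtain s2 where s2: "s1 = l * s2" by (elim dvdE)
  have "l * (l * s2 ^ 2) = l * K" using s1' unfolding s2 by (simp add: ring_simps)
  hence "K = l * s2 ^ 2" using l0 by simp
  hence "poly K t = 0" by (simp add: l_def)
  thus False using K by simp
qed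

lemma cyclic_disc_root:
  obtains t where "t \<noteq> frob t" "t \<noteq> frob (frob t)"
    "fibre_disc (to_ac \<alpha>) (to_ac \<beta>) (to_ac c) (to_ac d) (to_ac e) t = 0"
    "poly (pderiv (map_poly to_ac disc_poly)) t = 0"
proof -
  define k where "k = coeff s 3"
  have k: "k \<noteq> 0" using degree_s by (metis degree_0 k_def leading_coeff_0_iff zero_neq_numeral)
  have s_eq: "s = [:coeff s 0, coeff s 1, coeff s 2, k:]"
  proof (rule poly_eqI)
    fix n show "coeff s n = coeff [:coeff s 0, coeff s 1, coeff s 2, k:] n"
    proof (cases "n \<le> 3")
      case True
      hence "n = 0 \<or> n = 1 \<or> n = 2 \<or> n = 3" by linarith
      thus ?thesis by (auto simp: k_def eval_nat_numeral)
    next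
      case False
      hence "coeff s n = 0" using degree_s by (intro coeff_eq_0) simp
      moreover have "degree [:coeff s 0, coeff s 1, coeff s 2, k:] \<le> 3" by simp
      hence "coeff [:coeff s 0, coeff s 1, coeff s 2, k:] n = 0" using False
        by (intro coeff_eq_0) linarith
      ultimately show ?thesis by simp
    qed
  qed
  define p q r where "p = coeff s 2 / k" and "q = coeff s 1 / k" and "r = coeff s 0 / k"
  have ks: "s = smult k [:r, q, p, 1:]" using k s_eq by (simp add: p_def q_def r_def)
  have "x ^ 3 + p * x ^ 2 + q * x + r \<noteq> 0" for x
  proof
    assume *: "x ^ 3 + p * x ^ 2 + q * x + r = 0"
    have "poly s x = k * (x ^ 3 + p * x ^ 2 + q * x + r)"
      unfolding ks by (simp add: ring_simps)
    thus False using s_rootless[of x] * by simp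
  qed
  then obtain x y z where c: "frob x = y" "frob y = z" "frob z = x" "x \<noteq> y" "x \<noteq> z" "y \<noteq> z"
      "to_ac p = - (x + y + z)" "to_ac q = x * y + x * z + y * z" "to_ac r = - (x * y * z)"
    using rootless_cubic_cyclic[of p q r] by blast
  have "map_poly to_ac s = smult (to_ac k) [:to_ac r, to_ac q, to_ac p, 1:]"
    unfolding ks by (simp add: map_poly_pCons)
  hence "poly (map_poly to_ac s) x = to_ac k * (x ^ 3 + to_ac p * x ^ 2 + to_ac q * x + to_ac r)"
    by (simp add: ring_simps)
  also have "\<dots> = 0" unfolding c(7-9) by (simp add: ring_simps)
  finally show ?thesis using that[of x] disc_root_s[of x] c(1-6) by blast
qed

text \<open>The quartic is the square of \<open>X^2 - m X + n\<close> and \<open>t = 2 m\<close>.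
  Eliminating \<open>n\<close> leaves a quadratic relation for \<open>m\<close> over the ground
  field, whose coefficients must vanish.\<close>

lemma four_conclusion:
  assumes t: "t \<noteq> frob t" "t \<noteq> frob (frob t)" and f: "fibre t x x y y"
  shows "a = - 3 * d \<and> b = - 9 * e \<and> c = d ^ 2"
proof -
  define m n where "m = x + y" and "n = x * y"
  have tm: "t = 2 * m" using fibre_rootsD(1)[OF f] by (simp add: m_def)
  have *: "to_ac \<alpha> = m ^ 2 + 2 * n" "to_ac \<beta> = 2 * m * to_ac d - 2 * m * n"
     "to_ac c = 2 * m * to_ac e + n ^ 2"
    using fibre_rootsD(2-4)[OF f] unfolding tm m_def n_def by (simp_all add: ring_simps)
  have "m \<noteq> frob m" "m \<noteq> frob (frob m)" using t unfolding tm by auto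
  moreover have "to_ac (\<alpha> ^ 2 - 4 * c) + to_ac (\<beta> + 8 * e) * m + to_ac (- \<alpha> - 2 * d) * m ^ 2 = 0"
    by (simp add: *) (simp add: ring_simps)
  ultimately have "\<alpha> ^ 2 - 4 * c = 0 \<and> \<beta> + 8 * e = 0 \<and> - \<alpha> - 2 * d = 0"
    by (rule cyclic_independent)
  hence 1: "\<alpha> = - 2 * d" "\<beta> = - 8 * e" "\<alpha> ^ 2 = 4 * c"
    by (simp_all add: add_eq_0_iff diff_eq_eq) (metis minus_diff_eq minus_minus neg_equal_iff_equal diff_0 eq_iff_diff_eq_0)+
  have "4 * (c - d ^ 2) = 4 * c - \<alpha> ^ 2"
    unfolding 1(1) by (simp add: power_mult_distrib algebra_simps)
  also have "\<dots> = 0" using 1(3) by simp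
  finally have "4 * (c - d ^ 2) = 0" .
  moreover have "(4 :: 'a) \<noteq> 0" by (rule four_nz[OF two])
  ultimately have "c - d ^ 2 = 0" by (metis mult_eq_0_iff)
  hence "c = d ^ 2" by simp
  moreover have "a = \<alpha> - d" "b = \<beta> - e" by (simp_all add: \<alpha>_def \<beta>_def)
  hence "a = - 3 * d" "b = - 9 * e" unfolding 1(1,2) by (simp_all add: algebra_simps)
  ultimately show ?thesis by blast
qed

text \<open>In characteristic 3 the simple root is \<open>t\<close>, and \<open>x^3\<close> is
  linear in \<open>t\<close>; inserting this in the constant term gives a quadratic relation for
  \<open>t\<close> that forces \<open>a = b = c = 0\<close>.\<close>

lemma three_char_3:
  assumes t: "t \<noteq> frob t" "t \<noteq> frob (frob t)" and f: "fibre t x x x y" and three: "(3 :: 'a) = 0"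
  shows False
proof -
  have z: "3 * u = 0" for u :: "'a alg_closure"
  proof -
    have "(3 :: 'a alg_closure) = to_ac 3" by simp
    thus ?thesis using three by simp
  qed
  have "t = y"
  proof -
    have "t = 3 * x + y" unfolding fibre_rootsD(1)[OF f] by (simp add: algebra_simps)
    thus ?thesis unfolding z by simp
  qed
  have \<alpha>: "to_ac \<alpha> = 0"
  proof -
    have "to_ac \<alpha> = 3 * (x * x + x * y)"
      unfolding fibre_rootsD(2)[OF f] by (simp add: algebra_simps)
    thus ?thesis unfolding z .
  qed
  have \<beta>: "to_ac \<beta> = t * to_ac d - x ^ 3"
  proof -
    have "to_ac \<beta> = t * to_ac d - (x ^ 3 + 3 * (x * x * y))"
      unfolding fibre_rootsD(3)[OF f] by (simp add: ring_simps)
    thus ?thesis unfolding z by simp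
  qed
  have c: "to_ac c = t * to_ac e + x ^ 3 * t"
    using fibre_rootsD(4)[OF f] \<open>t = y\<close> by (simp add: ring_simps)
  have "to_ac c + to_ac (\<beta> - e) * t + to_ac (- d) * t ^ 2 = 0"
    unfolding c by (simp add: \<beta> ring_simps)
  hence "c = 0 \<and> \<beta> - e = 0 \<and> - d = 0" by (rule cyclic_independent[OF t])
  moreover have "\<alpha> = 0" using \<alpha> by simp
  ultimately show False using nz by (simp add: \<alpha>_def \<beta>_def)
qed

end

section \<open>Excluding triple roots outside characteristic 3\<close>

lemma double_roots_imp_eq_0:
  fixes p :: "'b::idom poly"
  assumes "x \<noteq> y" "x \<noteq> z" "y \<noteq> z" "degree p < 6"
    and "[:- x, 1:] ^ 2 dvd p" "[:- y, 1:] ^ 2 dvd p" "[:- z, 1:] ^ 2 dvd p"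
  shows "p = 0"
proof (rule ccontr)
  assume p: "p \<noteq> 0"
  have ord: "order x p \<ge> 2" "order y p \<ge> 2" "order z p \<ge> 2"
    using assms(5-7) p by (simp_all add: order_divides)
  have sub: "{x, y, z} \<subseteq> {x. poly p x = 0}"
    using ord p order_root[of p] by auto
  have "6 \<le> (\<Sum>w\<in>{x, y, z}. order w p)" using assms(1-3) ord by simp
  also have "\<dots> \<le> (\<Sum>w | poly p w = 0. order w p)"
    by (rule sum_mono2[OF poly_roots_finite[OF p] sub]) simp
  also have "\<dots> \<le> degree p" by (rule sum_order_le_degree[OF p])
  finally show False using assms(4) by simp
qed

text \<open>
  The numerator of the derivative of the rational function, which vanishes to order 2 at the
  points where the fibre has a triple root.
\<close>
lemma triple_root_dvd_wronskian:
  fixes x :: "'b::idom"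
  assumes "fibre_roots \<alpha> \<beta> c d e t x x x y"
  shows "[:- x, 1:] ^ 2 dvd
    [:\<beta> * e - c * d, 2 * \<alpha> * e, \<alpha> * d - 3 * c, 4 * e - 2 * \<beta>, 3 * d - \<alpha>, 0, 1:]"
proof -
  define l n p Q where "l = [:- x, 1:]" and "n = [:- y, 1:]"
    and "p = [:c - t * e, \<beta> - t * d, \<alpha>, - t, 1:]" and "Q = [:e, d, 0, 1:]"
  have dl: "pderiv l = 1" by (simp add: l_def pderiv_pCons one_pCons)
  have "p = l ^ 3 * n"
  proof -
    have "c - t * e = x * x * x * y" "\<beta> - t * d = - (x * x * x + x * x * y + x * x * y + x * x * y)"
      using fibre_rootsD(3,4)[OF assms] by simp_all
    thus ?thesis unfolding p_def l_def n_def fibre_rootsD(1,2)[OF assms]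
      by (simp add: ring_simps)
  qed
  hence "pderiv p * Q - p * pderiv Q = l ^ 2 * ((3 * n + l * pderiv n) * Q - l * n * pderiv Q)"
    unfolding power3_eq_cube power2_eq_square by (simp add: pderiv_mult dl algebra_simps)
  moreover have "pderiv p * Q - p * pderiv Q =
      [:\<beta> * e - c * d, 2 * \<alpha> * e, \<alpha> * d - 3 * c, 4 * e - 2 * \<beta>, 3 * d - \<alpha>, 0, 1:]"
    by (simp add: p_def Q_def pderiv_pCons algebra_simps)
  ultimately show ?thesis by (simp add: l_def)
qed

context permuting_pencil
begin

lemma fibre_value_unique:
  assumes "fibre t x w y z" "fibre t' x w' y' z'"
  shows "t = t'"
proof -
  have eq: "u * (x ^ 3 + to_ac d * x + to_ac e) = x ^ 4 + to_ac \<alpha> * x ^ 2 + to_ac \<beta> * x + to_ac c"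
    if "fibre u x w y z" for u w y z
  proof -
    have "fibre_poly (to_ac \<alpha>) (to_ac \<beta>) (to_ac c) (to_ac d) (to_ac e) u x = 0"
      unfolding fibre_poly_roots[OF that] by simp
    thus ?thesis by (simp add: fibre_poly_def algebra_simps)
  qed
  show ?thesis using eq[OF assms(1)] eq[OF assms(2)] denominator_nz[OF assms(1)]
    by (metis mult_right_cancel)
qed

text \<open>Frobenius cycles the resolvent roots. A rational one would equal its conjugate, and
  their difference is a product of differences of roots of the quartic.\<close>

lemma resolvent_rootless:
  assumes "fibre_disc \<alpha> \<beta> c d e t \<noteq> 0"
  shows "\<zeta> ^ 3 - \<alpha> * \<zeta> ^ 2 + res1 \<beta> c d e t * \<zeta> + res0 \<alpha> \<beta> c d e t \<noteq> 0"
proof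
  assume *: "\<zeta> ^ 3 - \<alpha> * \<zeta> ^ 2 + res1 \<beta> c d e t * \<zeta> + res0 \<alpha> \<beta> c d e t = 0"
  show False
  proof (cases rule: fibre_cases[of t])
    case (cyclic w x y z)
    have "to_ac (\<zeta> ^ 3 - \<alpha> * \<zeta> ^ 2 + res1 \<beta> c d e t * \<zeta> + res0 \<alpha> \<beta> c d e t) =
        to_ac \<zeta> ^ 3 - to_ac \<alpha> * to_ac \<zeta> ^ 2 +
        res1 (to_ac \<beta>) (to_ac c) (to_ac d) (to_ac e) (to_ac t) * to_ac \<zeta> +
        res0 (to_ac \<alpha>) (to_ac \<beta>) (to_ac c) (to_ac d) (to_ac e) (to_ac t)"
      by (simp add: res1_def res0_def)
    also note resolvent_poly[OF cyclic(1)]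
    finally have "to_ac \<zeta> = to_ac w * x + y * z \<or> to_ac \<zeta> = to_ac w * y + x * z \<or>
        to_ac \<zeta> = to_ac w * z + x * y"
      unfolding * by auto
    moreover have False
      if "to_ac \<zeta> = to_ac w * p + q * r" "frob p = q" "frob q = r" "frob r = p" "p \<noteq> q" "r \<noteq> p" for p q r
    proof -
      have "to_ac \<zeta> = to_ac w * q + r * p"
        using arg_cong[OF that(1), of frob] that(2-4) by simp
      hence "to_ac w * p + q * r = to_ac w * q + r * p" using that(1) by simp
      hence "(to_ac w - r) * (p - q) = 0" by (simp add: algebra_simps)
      hence "r = to_ac w" using that(5) by simp
      hence "p = r" using that(4) by simp
      thus False using that(6) by simp
    qed
    ultimately show False using cyclic(2-7) by (metis mult.commute)
  next
    case (double w y z)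
    have "to_ac (fibre_disc \<alpha> \<beta> c d e t) = 0"
      unfolding fibre_disc_to_ac[symmetric] fibre_disc_roots[OF double] by simp
    thus False using assms by simp
  qed
qed

end

context odd_pencil
begin

text \<open>The triple roots over the three conjugates of \<open>t\<close> are distinct double zeros
  of the Wronskian \<open>N\<close>. As \<open>N\<close> is monic of degree 6, it is the square of
  the monic cubic \<open>n\<close> with these roots; the coefficients of \<open>n\<close> are then
  eliminated.\<close>

lemma three_equations:
  assumes t: "t \<noteq> frob t" "t \<noteq> frob (frob t)" and f: "fibre t x x x y"
  shows "(3 * d - \<alpha>) ^ 2 = 4 * (\<alpha> * d - 3 * c)" "(2 * e - \<beta>) * (3 * d - \<alpha>) = 2 * \<alpha> * e"
    "(2 * e - \<beta>) ^ 2 = \<beta> * e - c * d"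
proof -
  define x1 x2 where "x1 = frob x" and "x2 = frob x1"
  have f1: "fibre (frob t) x1 x1 x1 (frob y)" unfolding x1_def by (rule frob_fibre[OF f])
  have f2: "fibre (frob (frob t)) x2 x2 x2 (frob (frob y))"
    unfolding x2_def by (rule frob_fibre[OF f1])
  have dist: "x \<noteq> x1" "x \<noteq> x2" "x1 \<noteq> x2"
  proof -
    show "x \<noteq> x1" using fibre_value_unique[OF f, of "frob t"] f1 t by blast
    show "x \<noteq> x2" using fibre_value_unique[OF f, of "frob (frob t)"] f2 t by blast
    show "x1 \<noteq> x2" using fibre_value_unique[OF f1, of "frob (frob t)"] f2 t by auto
  qed
  define A B C D E where "A = to_ac \<alpha>" and "B = to_ac \<beta>" and "C = to_ac c" and "D = to_ac d"
    and "E = to_ac e"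
  define N where "N = [:B * E - C * D, 2 * A * E, A * D - 3 * C, 4 * E - 2 * B, 3 * D - A, 0, 1:]"
  define n0 n1 n2 where "n0 = - (x * x1 * x2)" and "n1 = x * x1 + x * x2 + x1 * x2"
    and "n2 = - (x + x1 + x2)"
  define n where "n = [:n0, n1, n2, 1:]"
  have n: "n = [:- x, 1:] * [:- x1, 1:] * [:- x2, 1:]"
    by (simp add: n_def n0_def n1_def n2_def algebra_simps)
  have nN: "n ^ 2 - N = [:n0 ^ 2 - (B * E - C * D), 2 * n0 * n1 - 2 * A * E,
      n1 ^ 2 + 2 * n0 * n2 - (A * D - 3 * C), 2 * n0 + 2 * n1 * n2 - (4 * E - 2 * B),
      n2 ^ 2 + 2 * n1 - (3 * D - A), 2 * n2:]"
    by (simp add: n_def N_def power2_eq_square algebra_simps)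
  have "n ^ 2 - N = 0"
  proof (rule double_roots_imp_eq_0[OF dist])
    show "degree (n ^ 2 - N) < 6" unfolding nN by simp
    have "[:- k, 1:] ^ 2 dvd n ^ 2 - N"
      if "[:- k, 1:] dvd n" "[:- k, 1:] ^ 2 dvd N" for k
      using that by (intro dvd_diff dvd_power_same)
    moreover have "[:- x, 1:] dvd n" "[:- x1, 1:] dvd n" "[:- x2, 1:] dvd n"
      unfolding n by (simp_all only: dvd_mult dvd_mult2 dvd_triv_left dvd_triv_right)
    moreover have "[:- x, 1:] ^ 2 dvd N" "[:- x1, 1:] ^ 2 dvd N" "[:- x2, 1:] ^ 2 dvd N"
      unfolding N_def A_def B_def C_def D_def E_def
      by (rule triple_root_dvd_wronskian, rule f f1 f2)+
    ultimately show "[:- x, 1:] ^ 2 dvd n ^ 2 - N" "[:- x1, 1:] ^ 2 dvd n ^ 2 - N"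
      "[:- x2, 1:] ^ 2 dvd n ^ 2 - N" by blast+
  qed
  hence eqs: "n0 ^ 2 = B * E - C * D" "2 * n0 * n1 = 2 * A * E"
      "n1 ^ 2 + 2 * n0 * n2 = A * D - 3 * C" "2 * n0 + 2 * n1 * n2 = 4 * E - 2 * B"
      "n2 ^ 2 + 2 * n1 = 3 * D - A" "2 * n2 = 0"
    unfolding nN by simp_all
  have two': "(2 :: 'a alg_closure) \<noteq> 0" using two to_ac_eq_0_iff[of "2 :: 'a"] by simp
  have n2: "n2 = 0" using eqs(6) two' by simp
  have n1: "2 * n1 = 3 * D - A" using eqs(5) n2 by simp
  have "2 * n0 = 2 * (2 * E - B)" using eqs(4) n2 by simp
  hence n0: "n0 = 2 * E - B" using two' by (metis mult_left_cancel)
  have "(3 * D - A) ^ 2 = 4 * n1 ^ 2" unfolding n1[symmetric] by (simp add: power2_eq_square)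
  hence "to_ac ((3 * d - \<alpha>) ^ 2) = to_ac (4 * (\<alpha> * d - 3 * c))"
    using eqs(3) n2 by (simp add: A_def C_def D_def)
  thus "(3 * d - \<alpha>) ^ 2 = 4 * (\<alpha> * d - 3 * c)" by (simp only: to_ac_eq_iff)
  have "n0 * (2 * n1) = 2 * A * E" using eqs(2) by (simp add: mult_ac)
  hence "to_ac ((2 * e - \<beta>) * (3 * d - \<alpha>)) = to_ac (2 * \<alpha> * e)"
    unfolding n0 n1 by (simp add: A_def B_def D_def E_def)
  thus "(2 * e - \<beta>) * (3 * d - \<alpha>) = 2 * \<alpha> * e" by (simp only: to_ac_eq_iff)
  have "to_ac ((2 * e - \<beta>) ^ 2) = to_ac (\<beta> * e - c * d)"
    using eqs(1) unfolding n0 by (simp add: B_def C_def D_def E_def)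
  thus "(2 * e - \<beta>) ^ 2 = \<beta> * e - c * d" by (simp only: to_ac_eq_iff)
qed

lemma three_parameters:
  assumes three: "(3 :: 'a) \<noteq> 0" and eqs: "(3 * d - \<alpha>) ^ 2 = 4 * (\<alpha> * d - 3 * c)"
    "(2 * e - \<beta>) * (3 * d - \<alpha>) = 2 * \<alpha> * e" "(2 * e - \<beta>) ^ 2 = \<beta> * e - c * d"
  shows "d = 0 \<and> b = 3 * e \<and> 12 * c = - (a ^ 2)"
proof -
  have 1: "12 * c = 8 * (a * d) - a ^ 2"
    using eqs(1) by (simp add: \<alpha>_def ring_simps)
  have 2: "a * (b - 3 * e) = 2 * (d * b)"
    using eqs(2) by (simp add: \<alpha>_def \<beta>_def ring_simps)
  have 3: "b * (b - 3 * e) + c * d = 0"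
    using eqs(3) by (simp add: \<beta>_def ring_simps)
  have n12: "(12 :: 'a) \<noteq> 0"
  proof -
    have "(12 :: 'a) = 2 * 2 * 3" by simp
    thus ?thesis using two three by (metis mult_eq_0_iff)
  qed
  define m where "m = 24 * b ^ 2 + 8 * (a ^ 2 * d) - a ^ 3"
  have "d * m = 12 * (b * (2 * (d * b))) + a * d * (8 * (a * d) - a ^ 2)"
    by (simp add: m_def ring_simps)
  also have "\<dots> = 12 * a * (b * (b - 3 * e) + c * d)"
    unfolding 1[symmetric] 2[symmetric] by (simp add: algebra_simps)
  finally have "d * m = 0" unfolding 3 by simp
  moreover have "m \<noteq> 0" if "d \<noteq> 0"
  proof
    assume "m = 0"
    have a0: "a \<noteq> 0"
    proof
      assume "a = 0"
      hence "c = 0" "b = 0" using 1 2 n12 two \<open>d \<noteq> 0\<close> by simp_all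
      thus False using nz \<open>a = 0\<close> by blast
    qed
    \<comment> \<open>Eliminating \<open>c\<close> has left \<open>d m = 0\<close>. If
      \<open>m = 0\<close>, then \<open>- 2 b / a\<close> is a root of the denominator, as
      \<open>3 a^3\<close> times the denominator at \<open>r\<close> is
      \<open>- b m\<close>.\<close>
    define r where "r = - (2 * b / a)"
    have ar: "a * r = - (2 * b)" using a0 by (simp add: r_def)
    have "3 * a ^ 3 * (r ^ 3 + d * r + e) = 3 * (a * r) ^ 3 + 3 * a ^ 2 * d * (a * r) + a ^ 2 * (3 * a * e)"
      by (simp add: ring_simps)
    also have "3 * a * e = a * b - 2 * (d * b)" using 2 by (simp add: algebra_simps)
    also have "3 * (a * r) ^ 3 + 3 * a ^ 2 * d * (a * r) + a ^ 2 * (a * b - 2 * (d * b)) = - b * m"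
      unfolding ar m_def by (simp add: ring_simps)
    finally have "3 * a ^ 3 * (r ^ 3 + d * r + e) = 0" using \<open>m = 0\<close> by simp
    thus False using irr[of r] a0 three by simp
  qed
  ultimately have d: "d = 0" by auto
  moreover have "b = 3 * e"
  proof (rule ccontr)
    assume "b \<noteq> 3 * e"
    hence "b = 0" "a = 0" using 2 3 d by simp_all
    moreover have "c = 0" using 1 d \<open>a = 0\<close> n12 by simp
    ultimately show False using nz by blast
  qed
  moreover have "12 * c = - (a ^ 2)" using 1 d by simp
  ultimately show ?thesis by blast
qed

text \<open>
  Here the resolvent is the pure cubic equation \<open>w\<^sup>3 + \<sigma>(t) = 0\<close> for \<open>w = \<zeta> - 2 \<kappa>\<close>, which is
  brought to diagonal form by the linear factors of the Hessian of \<open>\<sigma>\<close>.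
\<close>
lemma no_pure_resolvent:
  assumes three: "(3 :: 'a) \<noteq> 0" and params: "d = 0" "b = 3 * e" "12 * c = - (a ^ 2)"
  shows False
proof -
  have n: "(4 :: 'a) \<noteq> 0" "(6 :: 'a) \<noteq> 0" "(12 :: 'a) \<noteq> 0" "(16 :: 'a) \<noteq> 0"
  proof -
    have "(6 :: 'a) = 2 * 3" "(4 :: 'a) = 2 * 2" "(12 :: 'a) = 2 * 2 * 3" "(16 :: 'a) = 2 * 2 * 2 * 2"
      by simp_all
    thus "(4 :: 'a) \<noteq> 0" "(6 :: 'a) \<noteq> 0" "(12 :: 'a) \<noteq> 0" "(16 :: 'a) \<noteq> 0"
      using two three by (metis mult_eq_0_iff)+
  qed
  \<comment> \<open>Since \<open>\<alpha> = a = 6 \<kappa>\<close>, translation by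
    \<open>2 \<kappa>\<close> removes the quadratic term of the resolvent; the relation for
    \<open>c\<close> removes the linear one.\<close>
  define \<kappa> where "\<kappa> = a / 6"
  have a: "a = 6 * \<kappa>" using n by (simp add: \<kappa>_def)
  have "12 * c = 12 * (- 3 * \<kappa> ^ 2)" using params(3) unfolding a by (simp add: power_mult_distrib)
  hence c: "c = - 3 * \<kappa> ^ 2" using n(3) by (metis mult_left_cancel)
  define \<sigma> where "\<sigma> t = e * t ^ 3 + 3 * \<kappa> ^ 2 * t ^ 2 - 24 * \<kappa> * e * t - (64 * \<kappa> ^ 3 + 16 * e ^ 2)" for t
  have no_cube: "x ^ 3 \<noteq> - e" for x
    using irr[of x] params(1) by (simp add: eq_neg_iff_add_eq_0)
  have disc: "fibre_disc \<alpha> \<beta> c d e t \<noteq> 0" for t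
    using s_rootless[of t] arg_cong[OF s, of "\<lambda>p. poly p t"] by simp
  have no_sol: "w ^ 3 + \<sigma> t \<noteq> 0" for w t
  proof -
    have "(2 * \<kappa> + w) ^ 3 - \<alpha> * (2 * \<kappa> + w) ^ 2 + res1 \<beta> c d e t * (2 * \<kappa> + w) + res0 \<alpha> \<beta> c d e t =
        w ^ 3 + \<sigma> t"
      unfolding \<alpha>_def \<beta>_def res1_def res0_def \<sigma>_def a c params(1,2) by (simp add: ring_simps)
    thus ?thesis using resolvent_rootless[OF disc[of t], of "2 * \<kappa> + w"] by simp
  qed
  show False
  proof (cases "\<kappa> = 0")
    case True
    \<comment> \<open>Here \<open>\<sigma>\<close> is already diagonal. A solution with
      \<open>v = 0\<close>, a point at infinity, would make \<open>- e\<close> a cube.\<close>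
    obtain w t v where wtv: "w \<noteq> 0 \<or> t \<noteq> 0 \<or> v \<noteq> 0" "1 * w ^ 3 + e * t ^ 3 + (- 16 * e ^ 2) * v ^ 3 = 0"
      using diagonal_cubic_isotropic[of 1 e "- 16 * e ^ 2"] e_nz n(4) by auto
    have "v \<noteq> 0"
    proof
      assume v: "v = 0"
      hence eq: "w ^ 3 = - e * t ^ 3" using wtv(2) by (simp add: eq_neg_iff_add_eq_0)
      hence "t \<noteq> 0" using wtv(1) v by auto
      hence "(w / t) ^ 3 = - e" using eq by (simp add: power_divide)
      thus False using no_cube by blast
    qed
    hence "(w / v) ^ 3 + \<sigma> (t / v) = (1 * w ^ 3 + e * t ^ 3 + (- 16 * e ^ 2) * v ^ 3) / v ^ 3"
      using True by (simp add: \<sigma>_def power_divide field_simps)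
    thus False using wtv(2) no_sol by simp
  next
    case False
    define p q r where "p = 3 * \<kappa> ^ 2 / e" and "q = - 24 * \<kappa>" and "r = - (64 * \<kappa> ^ 3 + 16 * e ^ 2) / e"
    have er: "e * p = 3 * \<kappa> ^ 2" "e * r = - (64 * \<kappa> ^ 3 + 16 * e ^ 2)"
      using e_nz by (simp_all add: p_def r_def)
    have "x ^ 3 + p * x ^ 2 + q * x + r \<noteq> 0" for x
    proof
      assume "x ^ 3 + p * x ^ 2 + q * x + r = 0"
      moreover have "\<sigma> x = e * (x ^ 3) + (e * p) * x ^ 2 + e * q * x + e * r"
        unfolding er by (simp add: \<sigma>_def q_def algebra_simps)
      hence "\<sigma> x = e * (x ^ 3 + p * x ^ 2 + q * x + r)" by (simp add: algebra_simps)
      ultimately show False using no_sol[of 0 x] by simp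
    qed
    then obtain W where W: "W \<noteq> 0" "disc3 p q r = W ^ 2"
      using rootless_cubic_disc3[of p q r] by blast
    define \<Delta> where "\<Delta> = e ^ 2 - \<kappa> ^ 3"
    have "e ^ 4 * disc3 p q r = (e * p) ^ 2 * e ^ 2 * q ^ 2 - 4 * e ^ 4 * q ^ 3 - 4 * (e * p) ^ 3 * (e * r)
        - 27 * e ^ 2 * (e * r) ^ 2 + 18 * (e * p) * e ^ 2 * q * (e * r)"
      by (simp add: disc3_def ring_simps)
    also have "\<dots> = - 27 * 256 * \<Delta> ^ 3"
      unfolding er q_def \<Delta>_def by (simp add: ring_simps)
    finally have d1: "(e ^ 2 * W) ^ 2 = - 27 * 256 * \<Delta> ^ 3"
      unfolding W(2) by (simp add: power_mult_distrib flip: power_mult)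
    have "fibre_disc \<alpha> \<beta> c d e 0 = - 27 * \<sigma> 0 ^ 2"
      unfolding fibre_disc_def disc3_def \<alpha>_def \<beta>_def res1_def res0_def \<sigma>_def a c params(1,2)
      by (simp add: ring_simps)
    hence d2: "poly s 0 ^ 2 = - 27 * \<sigma> 0 ^ 2" using arg_cong[OF s, of "\<lambda>p. poly p 0"] by simp
    \<comment> \<open>\<open>- 27 * 256 * \<Delta>^3\<close> is a square as \<open>e^4\<close> times
      the discriminant of a rootless cubic, and \<open>- 27 * \<sigma>(0)^2\<close> is a square as a
      value of \<open>s^2\<close>. The quotient makes \<open>\<Delta>^3\<close>, hence
      \<open>\<Delta>\<close>, a square, so the Hessian splits over the ground field.\<close>
    define V where "V = e ^ 2 * W * \<sigma> 0 / (16 * poly s 0)"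
    have s0: "poly s 0 \<noteq> 0" by (rule s_rootless)
    have V: "\<Delta> ^ 3 = V ^ 2"
    proof -
      have n256: "(256 :: 'a) \<noteq> 0"
      proof -
        have "(256 :: 'a) = 16 * 16" by simp
        thus ?thesis using n(4) by (metis mult_eq_0_iff)
      qed
      have "V ^ 2 * (256 * poly s 0 ^ 2) = (e ^ 2 * W) ^ 2 * \<sigma> 0 ^ 2"
        using s0 n256 by (simp add: V_def power_divide power_mult_distrib)
      also have "\<dots> = \<Delta> ^ 3 * (256 * poly s 0 ^ 2)" unfolding d1 d2 by (simp add: algebra_simps)
      finally have "V ^ 2 * (256 * poly s 0 ^ 2) = \<Delta> ^ 3 * (256 * poly s 0 ^ 2)" .
      moreover have "(256 :: 'a) * poly s 0 ^ 2 \<noteq> 0" using n256 s0 by simp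
      ultimately show ?thesis by simp
    qed
    have \<Delta>0: "\<Delta> \<noteq> 0"
    proof
      assume "\<Delta> = 0"
      hence "e ^ 2 = \<kappa> ^ 3" by (simp add: \<Delta>_def)
      hence "(- (e / \<kappa>)) ^ 3 = - e" using False e_nz
        by (simp add: power_divide eval_nat_numeral)
      thus False using no_cube by blast
    qed
    define \<delta> where "\<delta> = V / \<Delta>"
    have "\<delta> ^ 2 * \<Delta> ^ 2 = \<Delta> * \<Delta> ^ 2"
      using V \<Delta>0 by (simp add: \<delta>_def power_divide) (simp add: eval_nat_numeral)
    hence \<delta>: "\<delta> ^ 2 = \<Delta>" using \<Delta>0 by simp
    have \<delta>0: "\<delta> \<noteq> 0" using \<delta> \<Delta>0 by auto
    define g h where "g = e + \<delta>" and "h = e - \<delta>"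
    have gh: "\<kappa> ^ 3 = g * h"
      using \<delta> by (simp add: \<Delta>_def g_def h_def ring_simps)
    have gh0: "g \<noteq> 0" "h \<noteq> 0" using gh False by auto
    obtain x y z where XYZ: "x \<noteq> 0 \<or> y \<noteq> 0 \<or> z \<noteq> 0" "g * x ^ 3 + (- h) * y ^ 3 + 2 * z ^ 3 = 0"
      using diagonal_cubic_isotropic[of g "- h" 2] gh0 two by auto
    \<comment> \<open>\<open>v\<close> and \<open>\<tau>\<close> solve the linear system stated
      below for \<open>x\<close> and \<open>y\<close>; its determinant is
      \<open>2 \<kappa> (g - h)^3\<close>. The coordinate on the pencil is
      \<open>t = 4 \<tau> / v\<close>, and \<open>\<sigma>'\<close> is
      \<open>v^3 \<sigma>(t)\<close>.\<close>
    define v where "v = ((g + 2 * h) * y - (2 * g + h) * x) / (g - h) ^ 3"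
    define \<tau> where "\<tau> = (g * (g + 5 * h) * x - h * (5 * g + h) * y) / (2 * \<kappa> * (g - h) ^ 3)"
    have gmh: "g - h = 2 * \<delta>" by (simp add: g_def h_def)
    hence "g - h \<noteq> 0" using two \<delta>0 by simp
    hence gmh0: "(g - h) ^ 3 \<noteq> 0" by simp
    define k where "k = (g - h) ^ 3"
    have k0: "k \<noteq> 0" using gmh0 by (simp add: k_def)
    have kv: "k * v = (g + 2 * h) * y - (2 * g + h) * x"
      using gmh0 by (simp add: v_def k_def)
    have kt: "2 * \<kappa> * (k * \<tau>) = g * (g + 5 * h) * x - h * (5 * g + h) * y"
      using gmh0 two False by (simp add: \<tau>_def k_def)
    have x: "x = 2 * \<kappa> * (g + 2 * h) * \<tau> + h * (5 * g + h) * v"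
    proof -
      have "k * (2 * \<kappa> * (g + 2 * h) * \<tau> + h * (5 * g + h) * v) =
          (g + 2 * h) * (2 * \<kappa> * (k * \<tau>)) + h * (5 * g + h) * (k * v)" by (simp add: algebra_simps)
      also have "\<dots> = k * x" unfolding kv kt unfolding k_def by (simp add: ring_simps)
      finally show ?thesis using k0 by simp
    qed
    have y: "y = 2 * \<kappa> * (2 * g + h) * \<tau> + g * (g + 5 * h) * v"
    proof -
      have "k * (2 * \<kappa> * (2 * g + h) * \<tau> + g * (g + 5 * h) * v) =
          (2 * g + h) * (2 * \<kappa> * (k * \<tau>)) + g * (g + 5 * h) * (k * v)" by (simp add: algebra_simps)
      also have "\<dots> = k * y" unfolding kv kt unfolding k_def by (simp add: ring_simps)
      finally show ?thesis using k0 by simp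
    qed
    have cube: "(2 * \<kappa> * p * \<tau> + q * v) ^ 3 = 8 * (g * h) * p ^ 3 * \<tau> ^ 3 + 12 * \<kappa> ^ 2 * p ^ 2 * q * \<tau> ^ 2 * v +
        6 * \<kappa> * p * q ^ 2 * \<tau> * v ^ 2 + q ^ 3 * v ^ 3" for p q
      unfolding gh[symmetric] by (simp add: ring_simps)
    define \<sigma>' where "\<sigma>' = 64 * e * \<tau> ^ 3 + 48 * \<kappa> ^ 2 * \<tau> ^ 2 * v - 96 * \<kappa> * e * \<tau> * v ^ 2 -
        (64 * (g * h) + 16 * e ^ 2) * v ^ 3"
    have diag: "g * x ^ 3 + (- h) * y ^ 3 = 2 * (g * h) * \<delta> ^ 3 * \<sigma>'"
      unfolding x y cube \<sigma>'_def unfolding g_def h_def by (simp add: ring_simps)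
    have key: "(g * h) * \<delta> ^ 3 * \<sigma>' + z ^ 3 = 0"
    proof -
      have "2 * ((g * h) * \<delta> ^ 3 * \<sigma>' + z ^ 3) = g * x ^ 3 + (- h) * y ^ 3 + 2 * z ^ 3"
        unfolding diag by (simp only: distrib_left mult.assoc)
      also note XYZ(2)
      finally show ?thesis using two by (metis mult_eq_0_iff)
    qed
    \<comment> \<open>The coefficient \<open>g h \<delta>^3 = (\<kappa> \<delta>)^3\<close> is a
      cube and can be absorbed into \<open>z\<close>.\<close>
    define w where "w = z / (\<kappa> * \<delta>)"
    have z: "z ^ 3 = (g * h) * \<delta> ^ 3 * w ^ 3"
      using False \<delta>0 unfolding gh[symmetric] by (simp add: w_def power_divide power_mult_distrib)
    have "(g * h) * \<delta> ^ 3 * (w ^ 3 + \<sigma>') = 0"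
      using key unfolding z by (simp add: algebra_simps)
    hence w: "w ^ 3 + \<sigma>' = 0" using gh0 \<delta>0 by simp
    show False
    proof (cases "v = 0")
      case True
      hence eq: "w ^ 3 = - e * (4 * \<tau>) ^ 3"
        using w by (simp add: \<sigma>'_def power_mult_distrib eq_neg_iff_add_eq_0 mult_ac)
      have "\<tau> \<noteq> 0"
      proof
        assume "\<tau> = 0"
        hence "x = 0" "y = 0" "w = 0" using x y True eq by simp_all
        thus False using XYZ(1) False \<delta>0 by (simp add: w_def)
      qed
      define m where "m = 4 * \<tau>"
      have "m \<noteq> 0" "w ^ 3 = - e * m ^ 3" using \<open>\<tau> \<noteq> 0\<close> n(1) eq by (simp_all add: m_def)
      hence "(w / m) ^ 3 = - e" by (simp add: power_divide)
      thus False using no_cube by blast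
    next
      case v: False
      have "v ^ 3 * \<sigma> (4 * \<tau> / v) = \<sigma>'"
        unfolding \<sigma>_def \<sigma>'_def gh[symmetric] using v
        by (simp add: power_divide field_simps eval_nat_numeral)
      hence "v ^ 3 * ((w / v) ^ 3 + \<sigma> (4 * \<tau> / v)) = 0"
        using w v by (simp add: distrib_left power_divide)
      thus False using v no_sol by simp
    qed
  qed
qed

lemma odd_conclusion: "a = - 3 * d \<and> b = - 9 * e \<and> c = d ^ 2"
proof -
  obtain t where t: "t \<noteq> frob t" "t \<noteq> frob (frob t)"
    "fibre_disc (to_ac \<alpha>) (to_ac \<beta>) (to_ac c) (to_ac d) (to_ac e) t = 0"
    "poly (pderiv (map_poly to_ac disc_poly)) t = 0"
    by (rule cyclic_disc_root)
  show ?thesis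
  proof (cases rule: double_fibre[OF two t(3,4)])
    case (1 x y)
    thus ?thesis using four_conclusion t(1,2) by blast
  next
    case (2 x y)
    have "(3 :: 'a) \<noteq> 0" using three_char_3[OF t(1,2) 2] by blast
    thus ?thesis
      using three_parameters three_equations[OF t(1,2) 2] no_pure_resolvent by blast
  qed
qed

end

section \<open>Characteristic 2\<close>

text \<open>
  In characteristic 2, the substitution \<open>\<zeta> = z + \<alpha>\<close> turns the resolvent into \<open>z\<^sup>3 + C z + A\<close>,
  where \<open>C\<close> is \<open>res_lin\<close> and \<open>A\<close> is \<open>res_const\<close>.
\<close>
definition res_lin :: "'b::comm_ring_1 \<Rightarrow> 'b \<Rightarrow> 'b \<Rightarrow> 'b poly" where
  "res_lin \<alpha> \<beta> d = [:\<alpha> ^ 2, \<beta>, d:]"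

definition res_const :: "'b::comm_ring_1 \<Rightarrow> 'b \<Rightarrow> 'b \<Rightarrow> 'b \<Rightarrow> 'b \<Rightarrow> 'b poly" where
  "res_const \<alpha> \<beta> c d e = [:\<beta> ^ 2, \<alpha> * \<beta>, \<alpha> * d + c + d ^ 2, e:]"

lemma char_2_simps:
  assumes "(2 :: 'b::field) = 0"
  shows "(3 :: 'b) = 1" "(4 :: 'b) = 0" "(5 :: 'b) = 1" "(6 :: 'b) = 0" "(9 :: 'b) = 1"
    "\<And>x :: 'b. - x = x" "\<And>x :: 'b. x + x = 0"
proof -
  show *: "x + x = 0" for x :: 'b using assms by (metis mult_2 mult_zero_left)
  show "- x = x" for x :: 'b using *[of x] by (simp only: neg_eq_iff_add_eq_0)
  have "(3 :: 'b) = 2 + 1" "(4 :: 'b) = 2 + 2" "(5 :: 'b) = 2 + 2 + 1" "(6 :: 'b) = 2 + 2 + 2"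
    "(9 :: 'b) = 2 + 2 + 2 + 2 + 1" by simp_all
  thus "(3 :: 'b) = 1" "(4 :: 'b) = 0" "(5 :: 'b) = 1" "(6 :: 'b) = 0" "(9 :: 'b) = 1"
    unfolding assms by simp_all
qed

lemma shifted_resolvent_roots:
  fixes w :: "'b::field"
  assumes two: "(2 :: 'b) = 0" and f: "fibre_roots \<alpha> \<beta> c d e t w x y z"
  defines "p \<equiv> w * x + y * z + \<alpha>" and "q \<equiv> w * y + x * z + \<alpha>" and "r \<equiv> w * z + x * y + \<alpha>"
  shows "p + q + r = 0" "poly (res_lin \<alpha> \<beta> d) t = p * q + p * r + q * r"
    "poly (res_const \<alpha> \<beta> c d e) t = p * q * r"
proof -
  note c2 = char_2_simps[OF two]
  define p' q' r' where "p' = w * x + y * z" and "q' = w * y + x * z" and "r' = w * z + x * y"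
  have R: "\<alpha> = p' + q' + r'" "res1 \<beta> c d e t = p' * q' + p' * r' + q' * r'"
    "res0 \<alpha> \<beta> c d e t = - (p' * q' * r')"
    using resolvent_roots[OF f] by (simp_all add: p'_def q'_def r'_def)
  have pqr: "p = p' + \<alpha>" "q = q' + \<alpha>" "r = r' + \<alpha>"
    by (simp_all add: p_def q_def r_def p'_def q'_def r'_def)
  have "p + q + r = (p' + q' + r') + 3 * \<alpha>" unfolding pqr by (simp add: algebra_simps)
  also have "\<dots> = \<alpha> + \<alpha>" unfolding R(1)[symmetric] c2 by (simp add: two)
  finally show "p + q + r = 0" unfolding c2(7) .
  have "p * q + p * r + q * r = (p' * q' + p' * r' + q' * r') + 2 * \<alpha> * (p' + q' + r') + 3 * \<alpha> ^ 2"
    unfolding pqr by (simp add: ring_simps)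
  also have "\<dots> = res1 \<beta> c d e t + \<alpha> ^ 2"
    unfolding R(2)[symmetric] by (simp add: two c2)
  also have "\<dots> = poly (res_lin \<alpha> \<beta> d) t"
    unfolding res1_def res_lin_def c2 diff_conv_add_uminus by (simp add: c2 ring_simps)
  finally show "poly (res_lin \<alpha> \<beta> d) t = p * q + p * r + q * r" ..
  have "p * q * r = p' * q' * r' + \<alpha> * (p' * q' + p' * r' + q' * r') + \<alpha> ^ 2 * (p' + q' + r') + \<alpha> ^ 3"
    unfolding pqr by (simp add: ring_simps)
  also have "\<dots> = - res0 \<alpha> \<beta> c d e t + \<alpha> * res1 \<beta> c d e t + (\<alpha> ^ 3 + \<alpha> ^ 3)"
    unfolding R(1)[symmetric] R(2)[symmetric] R(3) by (simp add: ring_simps)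
  also have "\<dots> = poly (res_const \<alpha> \<beta> c d e) t"
    unfolding res1_def res0_def res_const_def c2 diff_conv_add_uminus
    by (simp add: c2 two ring_simps)
  finally show "poly (res_const \<alpha> \<beta> c d e) t = p * q * r" ..
qed

text \<open>The sum \<open>v\<close> is invariant under cyclic shifts but not under transpositions,
  in every characteristic. In characteristic 2 its equation becomes
  \<open>v^2 + A v + A^2 + C^3 = 0\<close>.\<close>

lemma cyclic_sum_equation:
  fixes p q r :: "'b::comm_ring_1"
  assumes "p + q + r = 0"
  defines "v \<equiv> p ^ 2 * q + q ^ 2 * r + r ^ 2 * p"
  shows "v ^ 2 + 3 * (p * q * r) * v + 9 * (p * q * r) ^ 2 + (p * q + p * r + q * r) ^ 3 = 0"
proof -
  have r: "r = - p - q" using assms(1) by (simp add: eq_neg_iff_add_eq_0 algebra_simps)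
  show ?thesis unfolding v_def r by (simp add: ring_simps)
qed

text \<open>Differentiating the equation of \<open>z\<close> at a zero of \<open>A\<close> kills the
  derivative of \<open>z\<close> and leaves \<open>z A' = C^2 C'\<close>. Squaring and inserting
  \<open>z^2 = C^3\<close> gives \<open>A'^2 = C C'^2\<close>, which is the claim.\<close>

lemma simple_branch_point:
  fixes z :: "'b::field poly"
  assumes two: "(2 :: 'b) = 0"
    and z: "z ^ 2 + z * res_const \<alpha> \<beta> c d e = res_const \<alpha> \<beta> c d e ^ 2 + res_lin \<alpha> \<beta> d ^ 3"
    and t: "poly (res_const \<alpha> \<beta> c d e) t = 0" "poly (res_lin \<alpha> \<beta> d) t \<noteq> 0"
  shows "e ^ 2 * t ^ 4 = \<beta> ^ 2 * t * (d * t + \<beta>)"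
proof -
  note c2 = char_2_simps[OF two]
  define A C where "A = res_const \<alpha> \<beta> c d e" and "C = res_lin \<alpha> \<beta> d"
  define k where "k = poly C t"
  have "pderiv (z * z + z * A) = pderiv (A * A + C * C * C)"
    using z by (simp add: A_def C_def power2_eq_square power3_eq_cube)
  hence "poly (pderiv (z * z + z * A)) t = poly (pderiv (A * A + C * C * C)) t" by simp
  hence "2 * (poly z t * poly (pderiv z) t) + poly z t * poly (pderiv A) t =
      3 * (k * k * poly (pderiv C) t)"
    using t(1) by (simp add: pderiv_mult pderiv_add A_def[symmetric] k_def algebra_simps)
  hence eq: "poly z t * poly (pderiv A) t = k ^ 2 * poly (pderiv C) t"
    by (simp add: two c2 power2_eq_square)
  have z2: "poly z t ^ 2 = k ^ 3"
    using arg_cong[OF z, of "\<lambda>p. poly p t"] t(1) by (simp add: k_def C_def)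
  have A': "poly (pderiv A) t = e * t ^ 2 + \<alpha> * \<beta>"
    by (simp add: A_def res_const_def pderiv_pCons c2 two ring_simps)
  have C': "poly (pderiv C) t = \<beta>"
    by (simp add: C_def res_lin_def pderiv_pCons two c2 ring_simps)
  have "k ^ 3 * (e * t ^ 2 + \<alpha> * \<beta>) ^ 2 = (poly z t * poly (pderiv A) t) ^ 2"
    unfolding A' z2[symmetric] by (simp add: power_mult_distrib)
  also have "\<dots> = k ^ 3 * (k * \<beta> ^ 2)" unfolding eq C' by (simp add: ring_simps)
  finally have "(e * t ^ 2 + \<alpha> * \<beta>) ^ 2 = k * \<beta> ^ 2"
    using t(2) by (simp add: k_def C_def)
  also have "k = d * t ^ 2 + \<beta> * t + \<alpha> ^ 2" by (simp add: k_def C_def res_lin_def ring_simps)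
  also have "(e * t ^ 2 + \<alpha> * \<beta>) ^ 2 =
      e ^ 2 * t ^ 4 + \<alpha> ^ 2 * \<beta> ^ 2 + 2 * (e * t ^ 2 * (\<alpha> * \<beta>))" by (simp add: ring_simps)
  finally show ?thesis unfolding two by (simp add: ring_simps)
qed

locale even_pencil = permuting_pencil +
  assumes two: "(2 :: 'a) = 0" and card: "CARD('a) > 36"
begin

abbreviation "A \<equiv> res_const \<alpha> \<beta> c d e"
abbreviation "C \<equiv> res_lin \<alpha> \<beta> d"

lemma two_ac: "(2 :: 'a alg_closure) = 0"
  using arg_cong[OF two, of to_ac] by simp

lemma map_poly_A: "map_poly to_ac A = res_const (to_ac \<alpha>) (to_ac \<beta>) (to_ac c) (to_ac d) (to_ac e)"
  by (simp add: res_const_def map_poly_pCons)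

lemma map_poly_C: "map_poly to_ac C = res_lin (to_ac \<alpha>) (to_ac \<beta>) (to_ac d)"
  by (simp add: res_lin_def map_poly_pCons)

text \<open>In the cyclic case the cyclic sum is fixed by Frobenius. With a double root,
  \<open>A\<close> vanishes and only a square root of \<open>C^3\<close> is needed.\<close>

lemma resolvent_root: "\<exists>v. v ^ 2 + v * poly A t = poly (A ^ 2 + C ^ 3) t"
proof (cases rule: fibre_cases[of t])
  case (cyclic w x y z)
  note c2 = char_2_simps[OF two_ac]
  define p q r where "p = to_ac w * x + y * z + to_ac \<alpha>" and "q = to_ac w * y + x * z + to_ac \<alpha>"
    and "r = to_ac w * z + x * y + to_ac \<alpha>"
  note R = shifted_resolvent_roots[OF two_ac cyclic(1), folded p_def q_def r_def,
      folded map_poly_A map_poly_C, unfolded poly_map_poly_to_ac]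
  have fr: "frob p = q" "frob q = r" "frob r = p"
    unfolding p_def q_def r_def using cyclic(2-4) by (simp_all add: mult.commute)
  define v where "v = p ^ 2 * q + q ^ 2 * r + r ^ 2 * p"
  have "frob v = v" unfolding v_def using fr by simp
  then obtain v' where v': "v = to_ac v'" by (rule frob_fixedD)
  have "v ^ 2 + to_ac (poly A t) * v + to_ac (poly A t) ^ 2 + to_ac (poly C t) ^ 3 = 0"
    using cyclic_sum_equation[OF R(1)] unfolding v_def[symmetric] R(2,3)[symmetric] c2 by simp
  hence "to_ac (v' ^ 2 + v' * poly A t + (poly A t ^ 2 + poly C t ^ 3)) = 0"
    unfolding v' by (simp add: algebra_simps)
  hence "v' ^ 2 + v' * poly A t = - (poly A t ^ 2 + poly C t ^ 3)"
    unfolding to_ac_eq_0_iff by (simp only: eq_neg_iff_add_eq_0)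
  thus ?thesis unfolding char_2_simps(6)[OF two] by auto
next
  case (double w y z)
  define p q where "p = to_ac w * to_ac w + y * z + to_ac \<alpha>" and "q = to_ac w * y + to_ac w * z + to_ac \<alpha>"
  have q': "to_ac w * z + to_ac w * y + to_ac \<alpha> = q" by (simp add: q_def)
  note R = shifted_resolvent_roots[OF two_ac double, folded p_def q_def, unfolded q',
      folded map_poly_A map_poly_C, unfolded poly_map_poly_to_ac]
  have "p = 0" using R(1) char_2_simps(7)[OF two_ac, of q] by (simp add: add.assoc)
  hence A0: "poly A t = 0" using R(3) by simp
  \<comment> \<open>In a field of \<open>2^k\<close> elements, \<open>x^(2^(k-1))\<close> is a
    square root of \<open>x\<close>.\<close>
  obtain k where k: "CARD('a) = 2 ^ k" using card_eq_power_of_2[OF two] .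
  have "k \<noteq> 0" using card k by (cases k) auto
  then obtain j where "k = Suc j" by (cases k) auto
  hence "(poly C t ^ 3) ^ CARD('a) = ((poly C t ^ 3) ^ (2 ^ j)) ^ 2"
    unfolding k by (simp add: mult.commute flip: power_mult)
  hence "((poly C t ^ 3) ^ (2 ^ j)) ^ 2 = poly C t ^ 3" by (simp add: power_card_eq_self)
  thus ?thesis using A0 by (intro exI[of _ "(poly C t ^ 3) ^ (2 ^ j)"]) simp
qed

lemma resolvent_poly_root:
  obtains z where "z ^ 2 + z * A = A ^ 2 + C ^ 3"
proof -
  have dA: "degree A \<le> 3" and dC: "degree C \<le> 2" by (simp_all add: res_const_def res_lin_def)
  have "degree (A ^ 2 + C ^ 3) \<le> 6"
    using degree_power_le[of A 2] degree_power_le[of C 3] dA dC by (intro degree_add_le) linarith+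
  moreover have "A \<noteq> 0" using e_nz by (simp add: res_const_def)
  ultimately show ?thesis
    using everywhere_root_imp_root_char_2[OF two card dA, of "A ^ 2 + C ^ 3"] resolvent_root that
    by blast
qed

text \<open>All shifted resolvent roots vanish, so the quartic has at most two distinct roots and
  thus a rational quadruple root \<open>r\<close>. Then \<open>t = 4 r\<close>,
  \<open>\<alpha> = 6 r^2\<close> and consequently \<open>\<beta>\<close> vanish in characteristic
  2.\<close>

lemma double_zero:
  assumes "poly A t = 0" "poly C t = 0"
  shows "t = 0 \<and> \<alpha> = 0 \<and> \<beta> = 0"
proof -
  note c2 = char_2_simps[OF two_ac]
  obtain w x y z where f: "fibre (to_ac t) w x y z" by (rule fibre_roots_exist)
  define p q r where "p = w * x + y * z + to_ac \<alpha>" and "q = w * y + x * z + to_ac \<alpha>"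
    and "r = w * z + x * y + to_ac \<alpha>"
  note R = shifted_resolvent_roots[OF two_ac f, folded p_def q_def r_def,
      folded map_poly_A map_poly_C, unfolded poly_map_poly_to_ac, unfolded assms to_ac_0]
  have van: "k = 0" if "k = p \<or> k = q \<or> k = r" for k
  proof -
    have "k ^ 3 = k ^ 2 * (p + q + r) - k * (p * q + p * r + q * r) + p * q * r"
      using that by (auto simp: ring_simps)
    also have "\<dots> = 0" unfolding R(1) R(2,3)[symmetric] by simp
    finally show ?thesis by simp
  qed
  have "p = 0" "q = 0" "r = 0" using van by blast+
  hence "p - q = 0" "p - r = 0" "q - r = 0" by simp_all
  hence "(w - z) * (x - y) = 0" "(w - y) * (x - z) = 0" "(w - x) * (y - z) = 0"
    by (simp_all add: p_def q_def r_def algebra_simps)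
  hence "\<exists>u v. {w, x, y, z} = {u, v}" by auto
  then obtain u v where uv: "{w, x, y, z} = {u, v}" by blast
  obtain r where "u = to_ac r" "v = to_ac r" by (rule two_roots_imp_one[OF f uv])
  hence r: "w = to_ac r" "x = to_ac r" "y = to_ac r" "z = to_ac r" using uv by auto
  note D = fibre_rootsD[OF f, unfolded r]
  have t: "to_ac t = 0"
    using D(1) char_2_simps(7)[OF two_ac] by (simp add: add.assoc)
  have "to_ac \<alpha> = 6 * (to_ac r * to_ac r)" using D(2) by simp
  hence \<alpha>: "to_ac \<alpha> = 0" unfolding c2 by simp
  have "to_ac \<beta> = - (4 * (to_ac r * to_ac r * to_ac r))" using D(3) t by simp
  hence "to_ac \<beta> = 0" unfolding c2 by simp
  thus ?thesis using t \<alpha> by simp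
qed

text \<open>At a nonzero zero \<open>t\<close>, the branch point equation says that
  \<open>e t / \<beta>\<close> is a rational root of the denominator.\<close>

lemma rational_zero:
  assumes "poly A t = 0"
  shows "t = 0"
proof (rule ccontr)
  assume t: "t \<noteq> 0"
  hence C: "poly C t \<noteq> 0" using double_zero[OF assms] by blast
  obtain z where z: "z ^ 2 + z * A = A ^ 2 + C ^ 3" by (rule resolvent_poly_root)
  have "e ^ 2 * t ^ 4 = \<beta> ^ 2 * t * (d * t + \<beta>)"
    by (rule simple_branch_point[OF two z assms C])
  hence "t * (e ^ 2 * t ^ 3) = t * (\<beta> ^ 2 * (d * t + \<beta>))" by (simp add: ring_simps)
  hence eq: "e ^ 2 * t ^ 3 = \<beta> ^ 2 * (d * t + \<beta>)" using t by simp
  have \<beta>: "\<beta> \<noteq> 0" using eq t e_nz by auto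
  define r where "r = e * t / \<beta>"
  have br: "\<beta> * r = e * t" using \<beta> by (simp add: r_def)
  have "\<beta> ^ 3 * (r ^ 3 + d * r + e) = (\<beta> * r) ^ 3 + \<beta> ^ 2 * d * (\<beta> * r) + \<beta> ^ 3 * e"
    by (simp add: ring_simps)
  also have "\<dots> = e * (e ^ 2 * t ^ 3 + \<beta> ^ 2 * (d * t + \<beta>))"
    unfolding br by (simp add: ring_simps)
  also have "\<dots> = 0" unfolding eq char_2_simps(7)[OF two] by simp
  finally show False using \<beta> irr[of r] by simp
qed

text \<open>Otherwise \<open>A\<close> has a zero \<open>x\<close> of degree 3, and
  \<open>u = e x / \<beta>\<close> is a root of the denominator. Rewriting \<open>A(x) = 0\<close>
  in terms of \<open>u\<close> gives a quadratic relation, hence \<open>\<beta> = e\<close>,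
  \<open>\<alpha> = d\<close>, \<open>c = 0\<close>, so \<open>a = b = c = 0\<close>.\<close>

lemma zero_exists: "\<exists>t. poly A t = 0"
proof (rule ccontr)
  assume no: "\<not> ?thesis"
  have A: "poly A t = e * t ^ 3 + (\<alpha> * d + c + d ^ 2) * t ^ 2 + \<alpha> * \<beta> * t + \<beta> ^ 2" for t
    by (simp add: res_const_def ring_simps)
  define p q r where "p = (\<alpha> * d + c + d ^ 2) / e" and "q = \<alpha> * \<beta> / e" and "r = \<beta> ^ 2 / e"
  have "poly A t = e * (t ^ 3 + p * t ^ 2 + q * t + r)" for t
    using e_nz unfolding A by (simp add: p_def q_def r_def distrib_left)
  hence "t ^ 3 + p * t ^ 2 + q * t + r \<noteq> 0" for t using no by (metis mult_zero_right)
  then obtain x y z where xyz: "frob x = y" "frob y = z" "frob z = x" "x \<noteq> y" "x \<noteq> z" "y \<noteq> z"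
      "to_ac p = - (x + y + z)" "to_ac q = x * y + x * z + y * z" "to_ac r = - (x * y * z)"
    using rootless_cubic_cyclic[of p q r] by blast
  have indep: "x \<noteq> frob x" "x \<noteq> frob (frob x)" using xyz(1-6) by auto
  have \<beta>: "\<beta> \<noteq> 0" using no A[of 0] by auto
  have x0: "x \<noteq> 0" using indep(1) by auto
  have Ax: "poly (map_poly to_ac A) x = 0"
  proof -
    have "poly (map_poly to_ac A) x =
        to_ac e * (x ^ 3 + to_ac p * x ^ 2 + to_ac q * x + to_ac r)"
      using e_nz unfolding map_poly_A
      by (simp add: res_const_def p_def q_def r_def ring_simps)
    also have "\<dots> = 0" unfolding xyz(7-9) by (simp add: ring_simps)
    finally show ?thesis .
  qed
  have Cx: "poly (map_poly to_ac C) x \<noteq> 0"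
  proof
    assume "poly (map_poly to_ac C) x = 0"
    hence "to_ac (\<alpha> ^ 2) + to_ac \<beta> * x + to_ac d * x ^ 2 = 0"
      unfolding map_poly_C by (simp add: res_lin_def ring_simps)
    hence "\<beta> = 0" using cyclic_independent[OF indep] by blast
    thus False using \<beta> by simp
  qed
  obtain s where s: "s ^ 2 + s * A = A ^ 2 + C ^ 3" by (rule resolvent_poly_root)
  have "map_poly to_ac (s ^ 2 + s * A) = map_poly to_ac (A ^ 2 + C ^ 3)" unfolding s ..
  hence s': "map_poly to_ac s ^ 2 + map_poly to_ac s * map_poly to_ac A =
      map_poly to_ac A ^ 2 + map_poly to_ac C ^ 3" by simp
  have "to_ac e ^ 2 * x ^ 4 = to_ac \<beta> ^ 2 * x * (to_ac d * x + to_ac \<beta>)"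
    by (rule simple_branch_point[OF two_ac s'[unfolded map_poly_A map_poly_C]
          Ax[unfolded map_poly_A] Cx[unfolded map_poly_C]])
  hence "x * (to_ac e ^ 2 * x ^ 3) = x * (to_ac \<beta> ^ 2 * (to_ac d * x + to_ac \<beta>))"
    by (simp add: ring_simps)
  hence eq: "to_ac e ^ 2 * x ^ 3 = to_ac \<beta> ^ 2 * (to_ac d * x + to_ac \<beta>)" using x0 by simp
  define u where "u = to_ac e * x / to_ac \<beta>"
  have bu: "to_ac \<beta> * u = to_ac e * x" using \<beta> by (simp add: u_def)
  have "to_ac \<beta> ^ 3 * (u ^ 3 + to_ac d * u + to_ac e) =
      (to_ac \<beta> * u) ^ 3 + to_ac \<beta> ^ 2 * to_ac d * (to_ac \<beta> * u) + to_ac \<beta> ^ 3 * to_ac e"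
    by (simp add: ring_simps)
  also have "\<dots> = to_ac e * (to_ac e ^ 2 * x ^ 3 + to_ac \<beta> ^ 2 * (to_ac d * x + to_ac \<beta>))"
    unfolding bu by (simp add: ring_simps)
  also have "\<dots> = 0" unfolding eq char_2_simps(7)[OF two_ac] by simp
  finally have Qu: "u ^ 3 + to_ac d * u + to_ac e = 0" using \<beta> by simp
  have ex: "to_ac e * x = to_ac \<beta> * u" by (simp add: bu)
  have "to_ac e ^ 2 * poly (map_poly to_ac A) x = (to_ac e * x) ^ 3 +
      to_ac (\<alpha> * d + c + d ^ 2) * (to_ac e * x) ^ 2 +
      to_ac (\<alpha> * \<beta>) * to_ac e * (to_ac e * x) + to_ac \<beta> ^ 2 * to_ac e ^ 2"
    unfolding map_poly_A by (simp add: res_const_def ring_simps)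
  also have "\<dots> = to_ac \<beta> ^ 2 * (to_ac \<beta> * (u ^ 3 + to_ac d * u + to_ac e) +
      (to_ac (e ^ 2 - \<beta> * e) + to_ac (\<alpha> * e - \<beta> * d) * u + to_ac (\<alpha> * d + c + d ^ 2) * u ^ 2))"
    unfolding ex by (simp add: ring_simps)
  finally have "to_ac (e ^ 2 - \<beta> * e) + to_ac (\<alpha> * e - \<beta> * d) * u +
      to_ac (\<alpha> * d + c + d ^ 2) * u ^ 2 = 0"
    unfolding Ax Qu using \<beta> by simp
  hence "e ^ 2 - \<beta> * e = 0 \<and> \<alpha> * e - \<beta> * d = 0 \<and> \<alpha> * d + c + d ^ 2 = 0"
    by (rule root_independent[OF Qu])
  hence *: "(e - \<beta>) * e = 0" "\<alpha> * e - \<beta> * d = 0" "\<alpha> * d + c + d ^ 2 = 0"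
    by (simp_all add: ring_simps)
  have be: "\<beta> = e" using *(1) e_nz by simp
  hence ad: "\<alpha> = d" using *(2) e_nz by (simp add: mult.commute)
  have "c = - (d ^ 2 + d ^ 2)" using *(3) unfolding ad
    by (simp add: eq_neg_iff_add_eq_0 power2_eq_square algebra_simps)
  hence "c = 0" unfolding char_2_simps(7)[OF two] by simp
  moreover have "a = 0" using ad by (simp add: \<alpha>_def)
  moreover have "b = 0" using be by (simp add: \<beta>_def)
  ultimately show False using nz by blast
qed

text \<open>As 0 is the only rational zero of \<open>A\<close>, first \<open>\<beta> = 0\<close> and
  then \<open>A = e t^3\<close>. Now \<open>C\<close> has zero derivative, so differentiating the
  equation of \<open>z\<close> gives \<open>z + X z' = 0\<close>; hence \<open>z(0) = 0\<close>, and
  \<open>z(0)^2 = \<alpha>^6\<close> gives \<open>\<alpha> = 0\<close>.\<close>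

lemma even_conclusion: "a = - 3 * d \<and> b = - 9 * e \<and> c = d ^ 2"
proof -
  note c2 = char_2_simps[OF two]
  have A: "poly A t = e * t ^ 3 + (\<alpha> * d + c + d ^ 2) * t ^ 2 + \<alpha> * \<beta> * t + \<beta> ^ 2" for t
    by (simp add: res_const_def ring_simps)
  obtain t where "poly A t = 0" using zero_exists by blast
  hence "poly A 0 = 0" using rational_zero by metis
  hence \<beta>: "\<beta> = 0" using A[of 0] by simp
  define m where "m = \<alpha> * d + c + d ^ 2"
  have "poly A (- (m / e)) = 0"
    using e_nz unfolding A m_def[symmetric] unfolding \<beta> by (simp add: field_simps eval_nat_numeral)
  hence "- (m / e) = 0" by (rule rational_zero)
  hence m: "m = 0" using e_nz by simp
  have A': "A = [:0, 0, 0, e:]" by (simp add: res_const_def \<beta> m[unfolded m_def])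
  have C': "C = [:\<alpha> ^ 2, 0, d:]" by (simp add: res_lin_def \<beta>)
  have "\<alpha> = 0"
  proof -
    obtain z where z: "z ^ 2 + z * A = A ^ 2 + C ^ 3" by (rule resolvent_poly_root)
    have dA: "pderiv A = [:0, 0, e:]" unfolding A' by (simp add: pderiv_pCons c2)
    have dC: "pderiv C = 0" unfolding C' by (simp add: pderiv_pCons two)
    have "pderiv (z * z + z * A) = pderiv (A * A + C * C * C)"
      using z by (simp add: power2_eq_square power3_eq_cube)
    hence "(z * pderiv z + z * pderiv z) + (z * pderiv A + pderiv z * A) =
        A * pderiv A + A * pderiv A"
      unfolding pderiv_add pderiv_mult dC by (simp add: algebra_simps)
    hence "z * pderiv A + pderiv z * A = 0"
      unfolding char_2_poly[OF two] by simp
    moreover have "z * pderiv A + pderiv z * A = [:0, 0, e:] * (z + [:0, 1:] * pderiv z)"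
      unfolding dA unfolding A' by (simp add: algebra_simps)
    ultimately have "z + [:0, 1:] * pderiv z = 0" using e_nz by simp
    hence "poly (z + [:0, 1:] * pderiv z) 0 = 0" by simp
    hence "poly z 0 = 0" by simp
    moreover have "poly z 0 ^ 2 = (\<alpha> ^ 2) ^ 3"
      using arg_cong[OF z, of "\<lambda>p. poly p 0"] unfolding A' C' by simp
    ultimately show ?thesis by simp
  qed
  hence "a = - d" "b = - e" "c = - (d ^ 2)" using \<beta> m
    by (simp_all add: \<alpha>_def \<beta>_def m_def eq_neg_iff_add_eq_0)
  thus ?thesis by (simp add: c2)
qed

end

section \<open>The doubling map\<close>

text \<open>
  In odd characteristic, the map is multiplication by 2 on the elliptic curve
  \<open>y\<^sup>2 = x\<^sup>3 + d x + e\<close>, in terms of the coordinate \<open>x\<close> and up to the factor 4; the factorization reflects the translations by the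
  points of order 2.
\<close>
lemma doubling_map_factorization:
  fixes x y :: "'b::comm_ring_1"
  assumes "d = r * s + r * u + s * u" "e = - (r * s * u)" "r + s + u = 0"
  shows "(x ^ 4 - 2 * d * x ^ 2 - 8 * e * x + d ^ 2) * (y ^ 3 + d * y + e) -
      (y ^ 4 - 2 * d * y ^ 2 - 8 * e * y + d ^ 2) * (x ^ 3 + d * x + e) =
    (x - y) * ((x * y - d - r * (x + y) - 2 * r ^ 2) * (x * y - d - s * (x + y) - 2 * s ^ 2) *
      (x * y - d - u * (x + y) - 2 * u ^ 2))"
proof -
  have u: "u = - r - s" using assms(3) by (simp add: eq_neg_iff_add_eq_0 algebra_simps)
  show ?thesis unfolding assms(1,2) u by (simp add: ring_simps)
qed

text \<open>A vanishing factor is a quadratic relation for a root of the denominator. Independence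
  forces its coefficients \<open>- 2\<close> and \<open>- (x + y)\<close> to vanish; together these
  give \<open>x = y\<close>.\<close>

lemma doubling_map_inj:
  fixes d e x y :: "'a::{field,finite}"
  assumes irr: "\<And>x. x ^ 3 + d * x + e \<noteq> 0"
    and eq: "(x ^ 4 - 2 * d * x ^ 2 - 8 * e * x + d ^ 2) * (y ^ 3 + d * y + e) =
      (y ^ 4 - 2 * d * y ^ 2 - 8 * e * y + d ^ 2) * (x ^ 3 + d * x + e)"
  shows "x = y"
proof (rule ccontr)
  assume "x \<noteq> y"
  obtain r s u where rsu: "frob r = s" "frob s = u" "frob u = r" "r \<noteq> s" "r \<noteq> u" "s \<noteq> u"
      "to_ac (0 :: 'a) = - (r + s + u)" "to_ac d = r * s + r * u + s * u" "to_ac e = - (r * s * u)"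
    using rootless_cubic_cyclic[of 0 d e] irr by auto
  define m where "m k = to_ac x * to_ac y - to_ac d - k * (to_ac x + to_ac y) - 2 * k ^ 2" for k
  have "r + s + u = 0" using rsu(7) by (metis neg_0_equal_iff_equal to_ac_0)
  from doubling_map_factorization[OF rsu(8,9) this, of "to_ac x" "to_ac y", folded m_def]
  have "(to_ac x - to_ac y) * (m r * m s * m u) =
      to_ac ((x ^ 4 - 2 * d * x ^ 2 - 8 * e * x + d ^ 2) * (y ^ 3 + d * y + e) -
      (y ^ 4 - 2 * d * y ^ 2 - 8 * e * y + d ^ 2) * (x ^ 3 + d * x + e))" by simp
  also have "\<dots> = 0" unfolding eq by simp
  finally obtain k where k: "k = r \<or> k = s \<or> k = u" "m k = 0" using \<open>x \<noteq> y\<close> by auto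
  have "k \<noteq> frob k" "k \<noteq> frob (frob k)" using k(1) rsu(1-6) by auto
  moreover have "to_ac (x * y - d) + to_ac (- (x + y)) * k + to_ac (- 2) * k ^ 2 = 0"
    using k(2) by (simp add: m_def algebra_simps)
  ultimately have "- (x + y) = 0 \<and> - 2 = (0 :: 'a)" using cyclic_independent by blast
  hence "x + y = 0" and two: "(2 :: 'a) = 0" by (simp_all only: neg_equal_0_iff_equal)
  have "x - y = (x + y) - 2 * y" by simp
  hence "x - y = 0" unfolding two \<open>x + y = 0\<close> by simp
  thus False using \<open>x \<noteq> y\<close> by simp
qed

section \<open>From the rational function to its fibres\<close>

lemma ratfun_map_sum:
  fixes a b c d e :: "'a::field"
  assumes nz: "\<not> (a = 0 \<and> b = 0 \<and> c = 0)" and irr: "irreducible [:e, d, 0, 1:]"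
  shows "ratfun_map (Fract [:0, 1:] 1 + Fract [:c, b, a:] [:e, d, 0, 1:]) =
    proj_map [:c, b + e, a + d, 0, 1:] [:e, d, 0, 1:]"
proof -
  define P Q R where "P = [:c, b + e, a + d, 0, 1:]" and "Q = [:e, d, 0, 1:]" and "R = [:c, b, a:]"
  have P: "P = [:0, 1:] * Q + R" by (simp add: P_def Q_def R_def)
  have "coprime P Q"
  proof (rule coprimeI)
    fix g assume g: "g dvd P" "g dvd Q"
    then obtain k where k: "Q = g * k" by (elim dvdE)
    show "is_unit g"
    proof (rule ccontr)
      assume "\<not> is_unit g"
      \<comment> \<open>The irreducible \<open>Q\<close> then divides \<open>g\<close>, hence
        \<open>P\<close> and the nonzero remainder \<open>R\<close> of degree at most 2.\<close>
      hence "is_unit k" using irreducibleD[OF irr, of g k] k by (auto simp: Q_def)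
      hence "Q dvd g" unfolding k by (simp add: mult_unit_dvd_iff)
      hence "Q dvd P - [:0, 1:] * Q"
        using g(1) by (intro dvd_diff dvd_triv_right) (rule dvd_trans)
      hence "Q dvd R" by (simp add: P)
      moreover have "R \<noteq> 0" using nz by (auto simp: R_def)
      ultimately have "degree Q \<le> degree R" by (rule dvd_imp_degree_le)
      moreover have "degree R \<le> 2" by (simp add: R_def)
      ultimately show False by (simp add: Q_def)
    qed
  qed
  moreover have "Fract [:0, 1:] 1 + Fract R Q = Fract P Q"
    by (simp add: P Q_def)
  ultimately show ?thesis
    using ratfun_map_Fract[of P Q] unfolding P_def Q_def R_def by simp
qed

text \<open>Infinity is fixed because the numerator has larger degree, and no finite point goes
  there because the denominator is rootless. What remains is the bijectivity of \<open>g\<close> on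
  the field.\<close>

lemma permutation_ratfun_iff:
  fixes a b c d e :: "'a::{field,finite}"
  assumes nz: "\<not> (a = 0 \<and> b = 0 \<and> c = 0)" and irr: "irreducible [:e, d, 0, 1:]"
    and rootless: "\<And>x. x ^ 3 + d * x + e \<noteq> 0"
  shows "permutation_ratfun (Fract [:0, 1:] 1 + Fract [:c, b, a:] [:e, d, 0, 1:]) \<longleftrightarrow>
    (\<forall>t. \<exists>!x. fibre_poly (a + d) (b + e) c d e t x = 0)"
proof -
  define g where "g x = (x ^ 4 + (a + d) * x ^ 2 + (b + e) * x + c) / (x ^ 3 + d * x + e)" for x
  define G where "G = proj_map [:c, b + e, a + d, 0, 1:] [:e, d, 0, 1:]"
  have G: "G (Finite x) = Finite (g x)" "G Infinity = Infinity" for x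
    using rootless[of x] by (simp_all add: G_def g_def ring_simps)
  have fib: "fibre_poly (a + d) (b + e) c d e t x = 0 \<longleftrightarrow> g x = t" for t x
  proof -
    have "fibre_poly (a + d) (b + e) c d e t x =
        (x ^ 4 + (a + d) * x ^ 2 + (b + e) * x + c) - t * (x ^ 3 + d * x + e)"
      by (simp add: fibre_poly_def ring_simps)
    thus ?thesis using rootless[of x] by (simp add: g_def divide_eq_eq)
  qed
  have "bij G \<longleftrightarrow> bij g"
  proof
    assume bij: "bij G"
    have "inj g"
    proof (rule injI)
      fix x y assume "g x = g y"
      hence "G (Finite x) = G (Finite y)" by (simp add: G)
      thus "x = y" using bij_is_inj[OF bij] by (auto dest: injD)
    qed
    thus "bij g" using finite_UNIV_inj_surj[of g] by (simp add: bij_def)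
  next
    assume bij: "bij g"
    show "bij G"
    proof (rule bijI)
      show "inj G"
      proof (rule injI)
        fix p q assume "G p = G q"
        thus "p = q" using bij_is_inj[OF bij] by (cases p; cases q) (auto simp: G dest: injD)
      qed
      show "surj G"
      proof (rule surjI[of _ "\<lambda>p. case p of Finite t \<Rightarrow> Finite (inv_into UNIV g t) | Infinity \<Rightarrow> Infinity"])
        fix p
        show "G (case p of Finite t \<Rightarrow> Finite (inv_into UNIV g t) | Infinity \<Rightarrow> Infinity) = p"
          using bij_is_surj[OF bij] by (cases p) (simp_all add: G surj_f_inv_f)
      qed
    qed
  qed
  also have "\<dots> \<longleftrightarrow> (\<forall>t. \<exists>!x. g x = t)" by (rule bij_iff)
  finally show ?thesis
    unfolding permutation_ratfun_def ratfun_map_sum[OF nz irr] G_def[symmetric] fib .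
qed

lemma irreducible_cubic_rootless:
  fixes d e x :: "'a::field"
  assumes "irreducible [:e, d, 0, 1:]"
  shows "x ^ 3 + d * x + e \<noteq> 0"
proof
  assume "x ^ 3 + d * x + e = 0"
  hence "poly [:e, d, 0, 1:] x = 0" by (simp add: ring_simps)
  then obtain k where k: "[:e, d, 0, 1:] = [:- x, 1:] * k"
    unfolding poly_eq_0_iff_dvd by (elim dvdE)
  have "\<not> is_unit [:- x, 1:]" by (simp add: is_unit_iff_degree)
  hence "is_unit k" using irreducibleD[OF assms k] by blast
  hence "degree k = 0" "k \<noteq> 0" by (auto simp: is_unit_poly_iff)
  hence "degree ([:- x, 1:] * k) = 1" by (subst degree_mult_eq) auto
  thus False unfolding k[symmetric] by simp
qed

theorem theorem3p1:
  fixes a b c d e :: "'a::{field,finite}" and f :: "'a poly fract"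
  assumes "f = Fract [:0, 1:] 1 + Fract [:c, b, a:] [:e, d, 0, 1:]"
    and "\<not> (a = 0 \<and> b = 0 \<and> c = 0)"
    and "irreducible [:e, d, 0, 1:]"
  shows "(CARD('a) \<ge> 113 \<longrightarrow>
            (permutation_ratfun f \<longleftrightarrow> a = -3 * d \<and> b = -9 * e \<and> c = d^2)) \<and>
         (a = -3 * d \<and> b = -9 * e \<and> c = d^2 \<longrightarrow> permutation_ratfun f)"
proof -
  have rootless: "x ^ 3 + d * x + e \<noteq> 0" for x
    using assms(3) by (rule irreducible_cubic_rootless)
  have perm: "permutation_ratfun f \<longleftrightarrow> (\<forall>t. \<exists>!x. fibre_poly (a + d) (b + e) c d e t x = 0)"
    unfolding assms(1) by (rule permutation_ratfun_iff[OF assms(2,3) rootless])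
  have suff: "permutation_ratfun f" if "a = -3 * d" "b = -9 * e" "c = d^2"
  proof -
    \<comment> \<open>Under the conditions, \<open>a + d = - 2 d\<close> and
      \<open>b + e = - 8 e\<close>, which yields the numerator of the duplication formula.\<close>
    define g where "g x = (x ^ 4 - 2 * d * x ^ 2 - 8 * e * x + d ^ 2) / (x ^ 3 + d * x + e)" for x
    have "fibre_poly (a + d) (b + e) c d e t x = 0 \<longleftrightarrow> g x = t" for t x
    proof -
      have "fibre_poly (a + d) (b + e) c d e t x =
          (x ^ 4 - 2 * d * x ^ 2 - 8 * e * x + d ^ 2) - t * (x ^ 3 + d * x + e)"
        unfolding fibre_poly_def that by (simp add: ring_simps)
      thus ?thesis using rootless[of x] by (simp add: g_def divide_eq_eq)
    qed
    moreover have "inj g"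
    proof (rule injI)
      fix x y assume "g x = g y"
      hence "(x ^ 4 - 2 * d * x ^ 2 - 8 * e * x + d ^ 2) * (y ^ 3 + d * y + e) =
          (y ^ 4 - 2 * d * y ^ 2 - 8 * e * y + d ^ 2) * (x ^ 3 + d * x + e)"
        unfolding g_def by (rule iffD1[OF frac_eq_eq[OF rootless rootless]])
      thus "x = y" by (rule doubling_map_inj[OF rootless])
    qed
    hence "bij g" using finite_UNIV_inj_surj[of g] by (simp add: bij_def)
    ultimately show ?thesis unfolding perm by (simp add: bij_iff)
  qed
  have nec: "a = -3 * d \<and> b = -9 * e \<and> c = d^2"
    if card: "CARD('a) \<ge> 113" and "permutation_ratfun f"
  proof -
    have ex1: "\<exists>!x. fibre_poly (a + d) (b + e) c d e t x = 0" for t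
      using that(2) unfolding perm by blast
    interpret permuting_pencil a b c d e "a + d" "b + e"
      using rootless assms(2) ex1 by unfold_locales blast+
    show ?thesis
    proof (cases "(2 :: 'a) = 0")
      case True
      interpret even_pencil a b c d e "a + d" "b + e"
        using True card by unfold_locales simp_all
      show ?thesis by (rule even_conclusion)
    next
      case False
      have "\<exists>s. disc_poly = s ^ 2"
      proof (rule everywhere_square_imp_square[OF False _ degree_disc_poly])
        show "CARD('a) > 36" using card by simp
        show "disc_poly \<noteq> 0" using disc_poly_nz by auto
        show "\<exists>w. poly disc_poly t = w ^ 2" for t using fibre_disc_square[of t] by simp
      qed
      then obtain s where s: "disc_poly = s ^ 2" by blast
      interpret odd_pencil a b c d e "a + d" "b + e" s
        using False s by unfold_locales
      show ?thesis by (rule odd_conclusion)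
    qed
  qed
  show ?thesis using suff nec by blast
qed

end
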